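(* Let $\mathcal{A} \subset \mathbb{D} = \{z \in \mathbb{C} : |z| < 1\}$ be a set with $2 \le \mathrm{card}\, \mathcal{A} < \infty$. Then there is a minimal subshift $\Omega \subset \mathcal{A}^{\mathbb{Z}_+}$ of Verblunsky coefficients, which is not periodic, such that the associated set $\Sigma \subset \partial \mathbb{D}$ has strictly positive Lebesgue (arc length) measure.
   Context: Here $\mathbb{Z}_+ = \{0,1,2,\dots\}$ is the index set of one-sided sequences $\alpha = \{\alpha_n\}_{n \ge 0}$, and $\partial \mathbb{D}$ is the unit circle. Verblunsky coefficients: every sequence $\{\alpha_n\}_{n\ge 0} \subset \mathbb{D}$ is the sequence of Verblunsky coefficients of exactly one probability measure $\nu_\alpha$ on $\partial\mathbb{D}$ with infinite support; that is, the monic orthogonal polynomials $\Phi_n$ of $\nu_\alpha$ satisfy $\Phi_0 = 1$ and $\Phi_{n+1}(z) = z\Phi_n(z) - \overline{\alpha_n}\, \Phi_n^*(z)$, where $\Phi_n^*(z) = z^n \overline{\Phi_n(1/\overline{z})}$. The measure $\nu_\alpha$ is called the measure associated with $\alpha$. Subshifts: for a finite set $\mathcal{A} \subset \mathbb{D}$, equip $\mathcal{A}^{\mathbb{Z}_+}$ with the product topology and let $(T\alpha)_n = \alpha_{n+1}$. A subshift of Verblunsky coefficients is a nonempty $T$-invariant closed subset $\Omega$ of $\mathcal{A}^{\mathbb{Z}_+}$. It is minimal if the $T$-orbit of every $\alpha \in \Omega$ is dense in $\Omega$. If $\Omega$ is minimal, then either all elements are periodic or all elements are not periodic; in the latter case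 $\Omega$ is called not periodic. The set $\Sigma$: if $\Omega$ is a minimal subshift of Verblunsky coefficients which is not periodic, there is a set $\Sigma \subseteq \partial\mathbb{D}$ such that for each $\alpha \in \Omega$, the topological support of $\nu_\alpha$ minus its isolated points equals $\Sigma$. This is the set associated with $\Omega$. *)

theory Defs
  imports "HOL-Probability.Probability" "HOL-Computational_Algebra.Polynomial"
begin

section \<open>Probability measures on the unit circle\<close>

definition circle_borel :: "complex measure" where
  "circle_borel = restrict_space borel (sphere 0 1)"

definition circle_prob_measure :: "complex measure \<Rightarrow> bool" where
  "circle_prob_measure \<nu> \<longleftrightarrow> prob_space \<nu> \<and> sets \<nu> = sets circle_borel"

definition circle_support :: "complex measure \<Rightarrow> complex set" where
  "circle_support \<nu> =
     {z \<in> sphere 0 1. \<forall>U. open U \<longrightarrow> z \<in> U \<longrightarrow> emeasure \<nu> (U \<inter> sphere 0 1) > 0}"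

text \<open>Unnormalised, so the total mass of the circle is \<open>2 * pi\<close>.\<close>

definition arc_length_measure :: "complex measure" where
  "arc_length_measure = distr (restrict_space lborel {0..<2 * pi}) circle_borel cis"

section \<open>Verblunsky coefficients\<close>

definition monic_orthogonal_polys :: "complex measure \<Rightarrow> (nat \<Rightarrow> complex poly) \<Rightarrow> bool" where
  "monic_orthogonal_polys \<nu> \<Phi> \<longleftrightarrow>
     (\<forall>n. degree (\<Phi> n) = n \<and> lead_coeff (\<Phi> n) = 1) \<and>
     (\<forall>m n. m \<noteq> n \<longrightarrow> (LINT z|\<nu>. cnj (poly (\<Phi> m) z) * poly (\<Phi> n) z) = 0)"

text \<open>The reversed polynomial of \<open>p\<close>, reversed with respect to the degree of \<open>p\<close>;
  \<open>poly_reversed_poly\<close> below gives the usual formula.\<close>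

definition reversed_poly :: "complex poly \<Rightarrow> complex poly" where
  "reversed_poly p = reflect_poly (map_poly cnj p)"

lemma poly_reversed_poly:
  assumes "z \<noteq> 0"
  shows "poly (reversed_poly p) z = z ^ degree p * cnj (poly p (1 / cnj z))"
proof -
  have "degree (map_poly cnj p) = degree p"
    by (rule degree_map_poly) auto
  moreover have "poly (map_poly cnj p) w = cnj (poly p (cnj w))" for w
    by (simp add: poly_altdef degree_map_poly coeff_map_poly)
  ultimately show ?thesis
    using assms by (simp add: reversed_poly_def poly_reflect_poly_nz inverse_eq_divide)
qed

definition has_verblunsky_coeffs :: "complex measure \<Rightarrow> (nat \<Rightarrow> complex) \<Rightarrow> bool" where
  "has_verblunsky_coeffs \<nu> \<alpha> \<longleftrightarrow>
     circle_prob_measure \<nu> \<and> infinite (circle_support \<nu>) \<and>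
     (\<exists>\<Phi>. monic_orthogonal_polys \<nu> \<Phi> \<and> \<Phi> 0 = 1 \<and>
        (\<forall>n. \<Phi> (Suc n) = [:0, 1:] * \<Phi> n - smult (cnj (\<alpha> n)) (reversed_poly (\<Phi> n))))"

text \<open>By Verblunsky's theorem the description is proper whenever \<open>\<alpha>\<close> takes values in the
  open unit disk; otherwise the value is unspecified.\<close>

definition verblunsky_measure :: "(nat \<Rightarrow> complex) \<Rightarrow> complex measure" where
  "verblunsky_measure \<alpha> = (THE \<nu>. has_verblunsky_coeffs \<nu> \<alpha>)"

section \<open>Subshifts\<close>

definition shift :: "(nat \<Rightarrow> 'a) \<Rightarrow> nat \<Rightarrow> 'a" where
  "shift \<alpha> = (\<lambda>n. \<alpha> (Suc n))"

definition sequence_space :: "'a set \<Rightarrow> (nat \<Rightarrow> 'a) topology" where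
  "sequence_space A = product_topology (\<lambda>_. discrete_topology A) UNIV"

definition subshift :: "'a set \<Rightarrow> (nat \<Rightarrow> 'a) set \<Rightarrow> bool" where
  "subshift A \<Omega> \<longleftrightarrow> \<Omega> \<noteq> {} \<and> closedin (sequence_space A) \<Omega> \<and> shift ` \<Omega> \<subseteq> \<Omega>"

definition minimal_subshift :: "'a set \<Rightarrow> (nat \<Rightarrow> 'a) set \<Rightarrow> bool" where
  "minimal_subshift A \<Omega> \<longleftrightarrow> subshift A \<Omega> \<and>
     (\<forall>\<alpha>\<in>\<Omega>. \<Omega> \<subseteq> sequence_space A closure_of (range (\<lambda>n. (shift ^^ n) \<alpha>)))"

definition periodic_seq :: "(nat \<Rightarrow> 'a) \<Rightarrow> bool" where
  "periodic_seq \<alpha> \<longleftrightarrow> (\<exists>p>0. (shift ^^ p) \<alpha> = \<alpha>)"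

text \<open>In a minimal subshift either all elements are periodic or none is.\<close>

definition nonperiodic_subshift :: "(nat \<Rightarrow> 'a) set \<Rightarrow> bool" where
  "nonperiodic_subshift \<Omega> \<longleftrightarrow> (\<forall>\<alpha>\<in>\<Omega>. \<not> periodic_seq \<alpha>)"

section \<open>The set associated with a subshift of Verblunsky coefficients\<close>

definition associated_set :: "(nat \<Rightarrow> complex) set \<Rightarrow> complex set \<Rightarrow> bool" where
  "associated_set \<Omega> \<Sigma> \<longleftrightarrow>
     (\<forall>\<alpha>\<in>\<Omega>. \<Sigma> = circle_support (verblunsky_measure \<alpha>)
              - {z. z isolated_in circle_support (verblunsky_measure \<alpha>)})"

end

theory Submission
  imports Defs "HOL-Analysis.Kronecker_Approximation_Theorem"
begin

text \<open>
  For a finite word \<open>u\<close> over the disk let \<open>S(u)\<close> be the set of points of the circle at which the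
  normalised Szego transfer matrix of \<open>u\<close> is elliptic, so that the coefficient sequence
  \<open>u u u ...\<close> has a bounded generalised eigenfunction there (\<open>elliptic u\<close>, described by angles).
  If a power \<open>u^N\<close> occurs infinitely often in \<open>\<alpha>\<close>, cutting this eigenfunction off to the
  occurrences yields infinitely many mutually orthogonal approximate eigenvectors of
  multiplication by \<open>z\<close> on \<open>L^2(\<nu>)\<close>. Hence each point of \<open>S(u)\<close> is, up to an error that vanishes
  as \<open>N\<close> grows, a non-isolated point of the support of \<open>\<nu>\<close> (\<open>elliptic_detects\<close>, \<open>ess_near\<close>). So
  \<open>\<Sigma>\<close> almost contains \<open>S(u)\<close> for every word \<open>u\<close> that occurs in high powers.

  Aperiodicity forces the words to change: \<open>u\<close> has to be replaced by \<open>u^k v\<close>, which in general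
  opens gaps: each single \<open>S(u^k v)\<close> misses a part of \<open>S(u)\<close>. The union over \<open>k\<close> does not. Half the
  trace of the transfer matrix of \<open>u^k v\<close> has the form \<open>R cos(k \<phi> - \<psi>)\<close>, where \<open>\<phi>\<close> is the rotation
  angle of \<open>u\<close>, so its modulus is smaller than 1 for some \<open>k\<close> as soon as \<open>\<phi> / \<pi>\<close> is irrational, and this
  excludes only countably many points (\<open>elliptic_insertion\<close>). Thus finitely many of the sets
  \<open>S(u^k v)\<close> cover \<open>S(u)\<close> up to any prescribed measure.

  The subshift comes from a tower of finite lists of words. It starts from two letters, and the
  next list consists of all \<open>u^k v\<close> with \<open>u\<close> in the old list and \<open>1 \<le> k \<le> K\<close>, where \<open>v\<close> is the
  concatenation of the \<open>N\<close>-th powers of all old words. Each new word contains all old words, so the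
  limit sequence is uniformly recurrent and its orbit closure is minimal; the lengths of \<open>u v\<close> and
  \<open>u u v\<close> differ by the length of \<open>u\<close>, so a period would descend the tower down to period 1, which
  the two letters exclude. Choosing \<open>N\<close> and \<open>K\<close> large at each level keeps the total loss of measure
  below the measure of \<open>S(a)\<close> for the first letter \<open>a\<close>.

  The link between words and measures is the CMV matrix \<open>C = L M\<close>, a product of two direct sums of
  unitary 2 by 2 blocks. The measure is constructed from the moments \<open>\<langle>C^j e_0, e_0\<rangle>\<close> by Fejer
  means and Helly selection, and it is determined by them (\<open>spectral_verblunsky_measure\<close>). If
  \<open>f\<close> is the function with coordinates \<open>c\<close>, then the norm of \<open>(z - z0) f\<close> is that of \<open>M c - z0 L* c\<close>,
  and this depends only on the Verblunsky coefficients in the window that carries \<open>c\<close>. A shift of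
  the window by an odd number merely exchanges \<open>L\<close> and \<open>M\<close>. This locality gives the estimate
  \<open>ess_near\<close> for powers of words, and also the constancy of \<open>\<Sigma>\<close> on a minimal subshift
  (\<open>ess_subset\<close>), because there every window of one element recurs in every other element.
\<close>

section \<open>Finitely supported sequences\<close>

text \<open>Only finitely supported elements of the Hilbert space of square summable sequences occur. The
  infinite sums below are therefore finite; they spare a common bound for the supports.\<close>

definition finsupp :: "(nat \<Rightarrow> complex) \<Rightarrow> bool" where
  "finsupp c \<longleftrightarrow> (\<exists>N. \<forall>n\<ge>N. c n = 0)"

definition ip :: "(nat \<Rightarrow> complex) \<Rightarrow> (nat \<Rightarrow> complex) \<Rightarrow> complex" where
  "ip c d = (\<Sum>n. c n * cnj (d n))"

definition nsq :: "(nat \<Rightarrow> complex) \<Rightarrow> real" where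
  "nsq c = (\<Sum>n. (cmod (c n))\<^sup>2)"

definition bvec :: "nat \<Rightarrow> nat \<Rightarrow> complex" where
  "bvec k n = (if n = k then 1 else 0)"

lemma finsupp_bvec [simp]: "finsupp (bvec k)"
  unfolding finsupp_def bvec_def by (rule exI[of _ "Suc k"]) auto

lemma finsupp_0 [simp]: "finsupp (\<lambda>n. 0)"
  by (auto simp: finsupp_def)

lemma finsupp_scale [intro]: "finsupp c \<Longrightarrow> finsupp (\<lambda>n. t * c n)"
  by (auto simp: finsupp_def)

lemma finsupp_add [intro]:
  assumes "finsupp c" "finsupp d" shows "finsupp (\<lambda>n. c n + d n)"
proof -
  obtain N M where "\<forall>n\<ge>N. c n = 0" "\<forall>n\<ge>M. d n = 0"
    using assms by (auto simp: finsupp_def)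
  then show ?thesis by (auto simp: finsupp_def intro!: exI[of _ "max N M"])
qed

lemma finsupp_diff [intro]:
  assumes "finsupp c" "finsupp d" shows "finsupp (\<lambda>n. c n - d n)"
  using finsupp_add[OF assms(1) finsupp_scale[OF assms(2), of "-1"]] by simp

lemma finsupp_sum [intro]:
  assumes "\<And>i. i \<in> I \<Longrightarrow> finsupp (c i)" shows "finsupp (\<lambda>n. \<Sum>i\<in>I. c i n)"
  using assms by (induction I rule: infinite_finite_induct) auto

lemma summable_finsupp:
  fixes g :: "nat \<Rightarrow> complex"
  assumes "finsupp c" shows "summable (\<lambda>n. c n * g n)" "summable (\<lambda>n. g n * c n)"
proof -
  obtain N where "\<forall>n\<ge>N. c n = 0" using assms by (auto simp: finsupp_def)
  then show "summable (\<lambda>n. c n * g n)" "summable (\<lambda>n. g n * c n)"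
    by (auto intro!: summable_finite[of "{..<N}"] simp flip: not_le)
qed

lemma summable_norm_finsupp:
  assumes "finsupp c" shows "summable (\<lambda>n. (cmod (c n))\<^sup>2)"
proof -
  obtain N where "\<forall>n\<ge>N. c n = 0" using assms by (auto simp: finsupp_def)
  then show ?thesis
    by (auto intro!: summable_finite[of "{..<N}"] simp flip: not_le)
qed

lemma nsq_eq_sum:
  assumes "\<And>n. n \<ge> N \<Longrightarrow> c n = 0" shows "nsq c = (\<Sum>n<N. (cmod (c n))\<^sup>2)"
  unfolding nsq_def by (rule suminf_finite) (auto simp: not_less assms)

lemma ip_eq_sum:
  assumes "\<And>n. n \<ge> N \<Longrightarrow> c n = 0" shows "ip c d = (\<Sum>n<N. c n * cnj (d n))"
  unfolding ip_def by (rule suminf_finite) (auto simp: not_less assms)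

lemma ip_self: assumes "finsupp c" shows "ip c c = complex_of_real (nsq c)"
proof -
  obtain N where "\<forall>n\<ge>N. c n = 0" using assms by (auto simp: finsupp_def)
  then show ?thesis by (simp add: nsq_eq_sum[of N] ip_eq_sum[of N] complex_norm_square del: of_real_power)
qed

lemma nsq_nonneg: "finsupp c \<Longrightarrow> 0 \<le> nsq c"
  unfolding nsq_def by (rule suminf_nonneg[OF summable_norm_finsupp]) auto

lemma nsq_pos: assumes "finsupp c" "c n \<noteq> 0" shows "0 < nsq c"
  unfolding nsq_def by (rule suminf_pos2[OF summable_norm_finsupp[OF assms(1)], of n]) (use assms in auto)

lemma ip_cnj: assumes "finsupp c" "finsupp d" shows "cnj (ip c d) = ip d c"
proof -
  obtain N M where N: "\<forall>n\<ge>N. c n = 0" and M: "\<forall>n\<ge>M. d n = 0"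
    using assms by (auto simp: finsupp_def)
  have "ip c d = (\<Sum>n<max N M. c n * cnj (d n))" "ip d c = (\<Sum>n<max N M. d n * cnj (c n))"
    using N M by (auto intro!: ip_eq_sum)
  then show ?thesis by (simp add: mult.commute)
qed

lemma ip_add_left: "finsupp c \<Longrightarrow> finsupp d \<Longrightarrow> ip (\<lambda>n. c n + d n) g = ip c g + ip d g"
  unfolding ip_def by (simp add: distrib_right suminf_add summable_finsupp)

lemma ip_scale_left: "finsupp c \<Longrightarrow> ip (\<lambda>n. t * c n) g = t * ip c g"
  unfolding ip_def by (simp add: mult.assoc suminf_mult summable_finsupp)

lemma ip_add_right: "finsupp c \<Longrightarrow> finsupp d \<Longrightarrow> finsupp g \<Longrightarrow> ip g (\<lambda>n. c n + d n) = ip g c + ip g d"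
  using ip_cnj[of g "\<lambda>n. c n + d n"] ip_cnj[of c g] ip_cnj[of d g]
  by (metis complex_cnj_add complex_cnj_cnj finsupp_add ip_add_left)

lemma ip_scale_right: "finsupp c \<Longrightarrow> finsupp g \<Longrightarrow> ip g (\<lambda>n. t * c n) = cnj t * ip g c"
  by (metis complex_cnj_cnj complex_cnj_mult finsupp_scale ip_cnj ip_scale_left)

lemma ip_sum_left: "(\<And>i. i \<in> I \<Longrightarrow> finsupp (c i)) \<Longrightarrow> ip (\<lambda>n. \<Sum>i\<in>I. c i n) g = (\<Sum>i\<in>I. ip (c i) g)"
proof (induction I rule: infinite_finite_induct)
  case (insert x F)
  then show ?case by (simp add: ip_add_left finsupp_sum)
qed (simp_all add: ip_def)

lemma ip_sum_right: "finsupp g \<Longrightarrow> (\<And>i. i \<in> I \<Longrightarrow> finsupp (c i)) \<Longrightarrow> ip g (\<lambda>n. \<Sum>i\<in>I. c i n) = (\<Sum>i\<in>I. ip g (c i))"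
proof (induction I rule: infinite_finite_induct)
  case (insert x F)
  then show ?case by (simp add: ip_add_right finsupp_sum)
qed (simp_all add: ip_def)

lemma ip_bvec_left: "ip (bvec k) d = cnj (d k)"
proof -
  have "ip (bvec k) d = (\<Sum>n<Suc k. bvec k n * cnj (d n))"
    by (rule ip_eq_sum) (auto simp: bvec_def)
  also have "\<dots> = cnj (d k)" by (simp add: bvec_def)
  finally show ?thesis .
qed

lemma ip_bvec_right: "finsupp d \<Longrightarrow> ip d (bvec k) = d k"
  by (metis complex_cnj_cnj finsupp_bvec ip_cnj ip_bvec_left)

lemma finsupp_decomp:
  assumes "\<And>n. n \<ge> N \<Longrightarrow> c n = 0"
  shows "c = (\<lambda>n. \<Sum>k<N. c k * bvec k n)"
proof
  fix n
  have "(\<Sum>k<N. c k * bvec k n) = (\<Sum>k<N. if k = n then c k else 0)"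
    by (rule sum.cong) (auto simp: bvec_def)
  then show "c n = (\<Sum>k<N. c k * bvec k n)" using assms[of n] by (simp add: not_less)
qed

section \<open>Symmetric tridiagonal matrices\<close>

text \<open>The direct sums of 2 by 2 blocks below have their blocks at either the even or the odd positions.
  Writing them as tridiagonal matrices treats both cases, and the first row, alike.\<close>

definition tridiag :: "(nat \<Rightarrow> complex) \<Rightarrow> (nat \<Rightarrow> complex) \<Rightarrow> (nat \<Rightarrow> complex) \<Rightarrow> nat \<Rightarrow> complex" where
  "tridiag a b c n = a n * c n + b n * c (Suc n) + (if n = 0 then 0 else b (n - 1) * c (n - 1))"

lemma tridiag_bound: assumes "\<And>n. n \<ge> N \<Longrightarrow> c n = 0" "n \<ge> Suc N" shows "tridiag a b c n = 0"
  using assms by (auto simp: tridiag_def)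

lemma finsupp_tridiag [intro]: "finsupp c \<Longrightarrow> finsupp (tridiag a b c)"
  unfolding finsupp_def by (meson tridiag_bound)

lemma tridiag_add: "tridiag a b (\<lambda>n. c n + d n) = (\<lambda>n. tridiag a b c n + tridiag a b d n)"
  by (auto simp: tridiag_def algebra_simps)

lemma tridiag_scale: "tridiag a b (\<lambda>n. t * c n) = (\<lambda>n. t * tridiag a b c n)"
  by (auto simp: tridiag_def algebra_simps)

text \<open>Summation by parts: the upper diagonal of one side is the lower diagonal of the other.\<close>

lemma tridiag_symmetric:
  assumes c: "finsupp c"
  shows "(\<Sum>n. tridiag a b c n * d n) = (\<Sum>n. c n * tridiag a b d n)"
proof -
  have c': "finsupp (\<lambda>n. c (Suc n))" using c unfolding finsupp_def by (meson le_SucI)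
  let ?h = "\<lambda>n. if n = 0 then 0 else b (n - 1) * c (n - 1) * d n"
  let ?k = "\<lambda>n. if n = 0 then 0 else b (n - 1) * c n * d (n - 1)"
  have s1: "summable (\<lambda>n. c n * (a n * d n))" "summable (\<lambda>n. c (Suc n) * (b n * d n))"
    "summable (\<lambda>n. c n * (b n * d (Suc n)))"
    by (simp_all add: summable_finsupp c c')
  have h: "summable ?h" "(\<Sum>n. ?h n) = (\<Sum>n. c n * (b n * d (Suc n)))"
  proof -
    have "summable (\<lambda>n. ?h (Suc n))" using s1(3) by (simp add: mult_ac)
    then show s: "summable ?h" using summable_Suc_iff[of ?h] by simp
    show "(\<Sum>n. ?h n) = (\<Sum>n. c n * (b n * d (Suc n)))"
      using suminf_split_head[OF s] by (simp add: mult_ac)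
  qed
  have k: "summable ?k" "(\<Sum>n. ?k n) = (\<Sum>n. c (Suc n) * (b n * d n))"
  proof -
    have "summable (\<lambda>n. ?k (Suc n))" using s1(2) by (simp add: mult_ac)
    then show s: "summable ?k" using summable_Suc_iff[of ?k] by simp
    show "(\<Sum>n. ?k n) = (\<Sum>n. c (Suc n) * (b n * d n))"
      using suminf_split_head[OF s] by (simp add: mult_ac)
  qed
  have "(\<lambda>n. tridiag a b c n * d n) = (\<lambda>n. c n * (a n * d n) + c (Suc n) * (b n * d n) + ?h n)"
    by (auto simp: tridiag_def algebra_simps)
  then have L: "(\<Sum>n. tridiag a b c n * d n) = (\<Sum>n. c n * (a n * d n)) + (\<Sum>n. c (Suc n) * (b n * d n)) + (\<Sum>n. ?h n)"
    by (simp only: suminf_add[symmetric] s1 h(1) summable_add)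
  have "(\<lambda>n. c n * tridiag a b d n) = (\<lambda>n. c n * (a n * d n) + c n * (b n * d (Suc n)) + ?k n)"
    by (auto simp: tridiag_def algebra_simps)
  then have "(\<Sum>n. c n * tridiag a b d n) = (\<Sum>n. c n * (a n * d n)) + (\<Sum>n. c n * (b n * d (Suc n))) + (\<Sum>n. ?k n)"
    by (simp only: suminf_add[symmetric] s1 k(1) summable_add)
  with L h k show ?thesis by simp
qed

section \<open>CMV matrices\<close>

definition rho :: "complex \<Rightarrow> real" where "rho a = sqrt (1 - (cmod a)\<^sup>2)"

lemma rho_pos: "cmod a < 1 \<Longrightarrow> 0 < rho a"
  unfolding rho_def by (simp add: abs_square_less_1)

lemma rho_sq:
  assumes "cmod a < 1"
  shows "complex_of_real (rho a) * complex_of_real (rho a) = 1 - a * cnj a"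
proof -
  have "rho a * rho a = 1 - (cmod a)\<^sup>2"
    unfolding rho_def using assms by (simp add: abs_square_le_1 less_imp_le)
  then have "complex_of_real (rho a * rho a) = complex_of_real (1 - (cmod a)\<^sup>2)" by simp
  then show ?thesis unfolding complex_norm_square of_real_diff of_real_mult by simp
qed

text \<open>The factors of the CMV matrix. For \<open>s = True\<close> the blocks with rows \<open>(cnj \<alpha>_n, \<rho>_n)\<close> and
  \<open>(\<rho>_n, - \<alpha>_n)\<close> sit at the index pairs \<open>(n, n + 1)\<close> with \<open>n\<close> even, for \<open>s = False\<close> at those with
  \<open>n\<close> odd, where the index 0 is left alone. In the usual notation these are \<open>L\<close> and \<open>M\<close>.\<close>

definition dg :: "(nat \<Rightarrow> complex) \<Rightarrow> bool \<Rightarrow> nat \<Rightarrow> complex" where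
  "dg \<alpha> s n = (if even n = s then cnj (\<alpha> n) else if n = 0 then 1 else - \<alpha> (n - 1))"

definition od :: "(nat \<Rightarrow> complex) \<Rightarrow> bool \<Rightarrow> nat \<Rightarrow> complex" where
  "od \<alpha> s n = (if even n = s then complex_of_real (rho (\<alpha> n)) else 0)"

definition blk :: "(nat \<Rightarrow> complex) \<Rightarrow> bool \<Rightarrow> (nat \<Rightarrow> complex) \<Rightarrow> nat \<Rightarrow> complex" where
  "blk \<alpha> s = tridiag (dg \<alpha> s) (od \<alpha> s)"

text \<open>The factors are symmetric, so the adjoint is the entrywise conjugate.\<close>

definition blk_adj :: "(nat \<Rightarrow> complex) \<Rightarrow> bool \<Rightarrow> (nat \<Rightarrow> complex) \<Rightarrow> nat \<Rightarrow> complex" where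
  "blk_adj \<alpha> s = tridiag (\<lambda>n. cnj (dg \<alpha> s n)) (od \<alpha> s)"

lemma cnj_od [simp]: "cnj (od \<alpha> s n) = od \<alpha> s n"
  by (simp add: od_def)

lemma finsupp_blk [intro, simp]: "finsupp c \<Longrightarrow> finsupp (blk \<alpha> s c)"
  and finsupp_blk_adj [intro, simp]: "finsupp c \<Longrightarrow> finsupp (blk_adj \<alpha> s c)"
  by (auto simp: blk_def blk_adj_def)

lemma ip_blk: assumes "finsupp c" shows "ip (blk \<alpha> s c) d = ip c (blk_adj \<alpha> s d)"
proof -
  have "cnj (blk_adj \<alpha> s d n) = tridiag (dg \<alpha> s) (od \<alpha> s) (\<lambda>n. cnj (d n)) n" for n
    by (simp add: blk_adj_def tridiag_def)
  then show ?thesis unfolding ip_def by (simp add: blk_def tridiag_symmetric[OF assms])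
qed

lemma ip_blk_adj: assumes "finsupp c" shows "ip (blk_adj \<alpha> s c) d = ip c (blk \<alpha> s d)"
proof -
  have "cnj (blk \<alpha> s d n) = tridiag (\<lambda>n. cnj (dg \<alpha> s n)) (od \<alpha> s) (\<lambda>n. cnj (d n)) n" for n
    by (simp add: blk_def tridiag_def)
  then show ?thesis unfolding ip_def by (simp add: blk_adj_def tridiag_symmetric[OF assms])
qed

locale verblunsky =
  fixes \<alpha> :: "nat \<Rightarrow> complex"
  assumes disk: "cmod (\<alpha> n) < 1"
begin

text \<open>The blocks are unitary because \<open>\<bar>\<alpha>\<bar>\<^sup>2 + \<rho>\<^sup>2 = 1\<close>.\<close>

lemma blk_adj_blk: "blk_adj \<alpha> s (blk \<alpha> s c) = c"
proof
  fix n
  note r = rho_sq[OF disk]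
  show "blk_adj \<alpha> s (blk \<alpha> s c) n = c n"
  proof (cases "even n = s")
    case True
    have "blk_adj \<alpha> s (blk \<alpha> s c) n =
      \<alpha> n * (cnj (\<alpha> n) * c n + rho (\<alpha> n) * c (Suc n)) + rho (\<alpha> n) * (- \<alpha> n * c (Suc n) + rho (\<alpha> n) * c n)"
      using True by (cases n) (auto simp: blk_adj_def blk_def tridiag_def dg_def od_def)
    also have "\<dots> = (\<alpha> n * cnj (\<alpha> n) + rho (\<alpha> n) * rho (\<alpha> n)) * c n" by (simp add: algebra_simps)
    also have "\<dots> = c n" by (simp add: r)
    finally show ?thesis .
  next
    case F: False
    show ?thesis
    proof (cases n)
      case 0 then show ?thesis using F by (auto simp: blk_adj_def blk_def tridiag_def dg_def od_def)
    next
      case (Suc m)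
      have "blk_adj \<alpha> s (blk \<alpha> s c) n =
        - cnj (\<alpha> m) * (- \<alpha> m * c n + rho (\<alpha> m) * c m) + rho (\<alpha> m) * (cnj (\<alpha> m) * c m + rho (\<alpha> m) * c n)"
        using F Suc by (cases m) (auto simp: blk_adj_def blk_def tridiag_def dg_def od_def)
      also have "\<dots> = (\<alpha> m * cnj (\<alpha> m) + rho (\<alpha> m) * rho (\<alpha> m)) * c n" by (simp add: algebra_simps)
      also have "\<dots> = c n" by (simp add: r)
      finally show ?thesis .
    qed
  qed
qed

lemma blk_blk_adj: "blk \<alpha> s (blk_adj \<alpha> s c) = c"
proof
  fix n
  have 1: "blk \<alpha> s d n = cnj (blk_adj \<alpha> s (\<lambda>n. cnj (d n)) n)" for d n
    by (simp add: blk_adj_def blk_def tridiag_def)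
  have 2: "(\<lambda>n. cnj (blk_adj \<alpha> s c n)) = blk \<alpha> s (\<lambda>n. cnj (c n))"
    by (simp add: blk_adj_def blk_def tridiag_def fun_eq_iff)
  show "blk \<alpha> s (blk_adj \<alpha> s c) n = c n"
    by (subst 1, subst 2) (simp add: blk_adj_blk)
qed

lemma nsq_blk: assumes "finsupp c" shows "nsq (blk \<alpha> s c) = nsq c"
  using ip_self[of c] ip_self[of "blk \<alpha> s c"] ip_blk[OF assms, of \<alpha> s "blk \<alpha> s c"] assms by (simp add: blk_adj_blk)

lemma nsq_blk_adj: assumes "finsupp c" shows "nsq (blk_adj \<alpha> s c) = nsq c"
  using nsq_blk[of "blk_adj \<alpha> s c" s] assms by (simp add: blk_blk_adj)

end

definition cmv :: "(nat \<Rightarrow> complex) \<Rightarrow> (nat \<Rightarrow> complex) \<Rightarrow> nat \<Rightarrow> complex" where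
  "cmv \<alpha> c = blk \<alpha> True (blk \<alpha> False c)"

definition cmvi :: "(nat \<Rightarrow> complex) \<Rightarrow> (nat \<Rightarrow> complex) \<Rightarrow> nat \<Rightarrow> complex" where
  "cmvi \<alpha> c = blk_adj \<alpha> False (blk_adj \<alpha> True c)"

definition cpow :: "(nat \<Rightarrow> complex) \<Rightarrow> int \<Rightarrow> (nat \<Rightarrow> complex) \<Rightarrow> nat \<Rightarrow> complex" where
  "cpow \<alpha> j = (if j \<ge> 0 then cmv \<alpha> ^^ nat j else cmvi \<alpha> ^^ nat (- j))"

lemma finsupp_cmv [simp, intro]: "finsupp c \<Longrightarrow> finsupp (cmv \<alpha> c)"
  and finsupp_cmvi [simp, intro]: "finsupp c \<Longrightarrow> finsupp (cmvi \<alpha> c)"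
  by (simp_all add: cmv_def cmvi_def)

lemma blk_add: "blk \<alpha> s (\<lambda>n. c n + d n) = (\<lambda>n. blk \<alpha> s c n + blk \<alpha> s d n)"
  and blk_adj_add: "blk_adj \<alpha> s (\<lambda>n. c n + d n) = (\<lambda>n. blk_adj \<alpha> s c n + blk_adj \<alpha> s d n)"
  and blk_scale: "blk \<alpha> s (\<lambda>n. t * c n) = (\<lambda>n. t * blk \<alpha> s c n)"
  and blk_adj_scale: "blk_adj \<alpha> s (\<lambda>n. t * c n) = (\<lambda>n. t * blk_adj \<alpha> s c n)"
  by (simp_all add: blk_def blk_adj_def tridiag_add tridiag_scale)

lemma cmv_add: "cmv \<alpha> (\<lambda>n. c n + d n) = (\<lambda>n. cmv \<alpha> c n + cmv \<alpha> d n)"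
  and cmv_scale: "cmv \<alpha> (\<lambda>n. t * c n) = (\<lambda>n. t * cmv \<alpha> c n)"
  and cmvi_add: "cmvi \<alpha> (\<lambda>n. c n + d n) = (\<lambda>n. cmvi \<alpha> c n + cmvi \<alpha> d n)"
  and cmvi_scale: "cmvi \<alpha> (\<lambda>n. t * c n) = (\<lambda>n. t * cmvi \<alpha> c n)"
  by (simp_all add: cmv_def cmvi_def blk_add blk_adj_add blk_scale blk_adj_scale)

lemma funpow_add_scale:
  fixes F :: "(nat \<Rightarrow> complex) \<Rightarrow> nat \<Rightarrow> complex"
  assumes "\<And>c d. F (\<lambda>n. c n + d n) = (\<lambda>n. F c n + F d n)" "\<And>t c. F (\<lambda>n. t * c n) = (\<lambda>n. t * F c n)"
  shows "(F ^^ k) (\<lambda>n. c n + d n) = (\<lambda>n. (F ^^ k) c n + (F ^^ k) d n)"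
    "(F ^^ k) (\<lambda>n. t * c n) = (\<lambda>n. t * (F ^^ k) c n)"
  by (induction k) (simp_all add: assms)

lemma cpow_add_fun: "cpow \<alpha> j (\<lambda>n. c n + d n) = (\<lambda>n. cpow \<alpha> j c n + cpow \<alpha> j d n)"
  and cpow_scale: "cpow \<alpha> j (\<lambda>n. t * c n) = (\<lambda>n. t * cpow \<alpha> j c n)"
  unfolding cpow_def
  by (auto simp: funpow_add_scale[where F = "cmv \<alpha>", OF cmv_add cmv_scale]
      funpow_add_scale[where F = "cmvi \<alpha>", OF cmvi_add cmvi_scale])

lemma finsupp_cpow [simp, intro]: assumes "finsupp c" shows "finsupp (cpow \<alpha> j c)"
proof -
  have "finsupp ((cmv \<alpha> ^^ k) c)" "finsupp ((cmvi \<alpha> ^^ k) c)" for k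
    by (induction k) (auto simp: assms)
  then show ?thesis by (simp add: cpow_def)
qed

lemma cpow_0 [simp]: "cpow \<alpha> 0 c = c" by (simp add: cpow_def)

text \<open>Each of the two factors has bandwidth 1. This is the source of orthogonality of the Szego polynomials.\<close>

lemma cpow_bvec_bound: "n > 2 * nat \<bar>j\<bar> \<Longrightarrow> cpow \<alpha> j (bvec 0) n = 0"
proof -
  have b: "n > Suc (Suc N) \<Longrightarrow> (\<And>n. n > N \<Longrightarrow> c n = 0) \<Longrightarrow> tridiag a b (tridiag a' b' c) n = 0" for n N a b a' b' c
    by (rule tridiag_bound[of "Suc (Suc N)"], rule tridiag_bound[of "Suc N"]) auto
  have 1: "n > 2 * k \<Longrightarrow> (cmv \<alpha> ^^ k) (bvec 0) n = 0" for k n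
  proof (induction k arbitrary: n)
    case (Suc k) then show ?case by (auto simp: cmv_def blk_def intro!: b[of "2*k"])
  qed (simp add: bvec_def)
  have 2: "n > 2 * k \<Longrightarrow> (cmvi \<alpha> ^^ k) (bvec 0) n = 0" for k n
  proof (induction k arbitrary: n)
    case (Suc k) then show ?case by (auto simp: cmvi_def blk_adj_def intro!: b[of "2*k"])
  qed (simp add: bvec_def)
  show "n > 2 * nat \<bar>j\<bar> \<Longrightarrow> cpow \<alpha> j (bvec 0) n = 0"
    using 1[of "nat j" n] 2[of "nat (-j)" n] by (auto simp: cpow_def)
qed

context verblunsky
begin

lemma cmvi_cmv: "cmvi \<alpha> (cmv \<alpha> c) = c" by (simp add: cmvi_def cmv_def blk_adj_blk)
lemma cmv_cmvi: "cmv \<alpha> (cmvi \<alpha> c) = c" by (simp add: cmvi_def cmv_def blk_blk_adj)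

lemma cmv_cpow: "cmv \<alpha> (cpow \<alpha> j c) = cpow \<alpha> (j + 1) c"
proof (cases "j \<ge> 0")
  case True
  then have "nat (j + 1) = Suc (nat j)" by simp
  then show ?thesis using True by (simp add: cpow_def)
next
  case False
  then obtain k where k: "j = - int (Suc k)" by (metis not_le negD)
  then have "cpow \<alpha> j c = cmvi \<alpha> ((cmvi \<alpha> ^^ k) c)"
    by (simp add: cpow_def nat_add_distrib)
  moreover have "cpow \<alpha> (j + 1) c = (cmvi \<alpha> ^^ k) c"
    using k by (cases k) (simp_all add: cpow_def nat_add_distrib)
  ultimately show ?thesis by (simp add: cmv_cmvi)
qed

lemma cmvi_cpow: "cmvi \<alpha> (cpow \<alpha> j c) = cpow \<alpha> (j - 1) c"
  using cmvi_cmv[of "cpow \<alpha> (j - 1) c"] by (simp add: cmv_cpow)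

lemma cpow_cpow: "cpow \<alpha> i (cpow \<alpha> j c) = cpow \<alpha> (i + j) c"
proof (induction i rule: int_induct[where k = 0])
  case (step1 i)
  then show ?case using cmv_cpow[of i "cpow \<alpha> j c"] cmv_cpow[of "i + j" c] by (simp add: algebra_simps)
next
  case (step2 i)
  then show ?case using cmvi_cpow[of i "cpow \<alpha> j c"] cmvi_cpow[of "i + j" c] by (simp add: algebra_simps)
qed simp

lemma ip_cmv: "finsupp c \<Longrightarrow> ip (cmv \<alpha> c) d = ip c (cmvi \<alpha> d)"
  by (simp add: cmv_def cmvi_def ip_blk)

lemma ip_cmvi: "finsupp c \<Longrightarrow> ip (cmvi \<alpha> c) d = ip c (cmv \<alpha> d)"
  by (simp add: cmv_def cmvi_def ip_blk_adj)

lemma ip_cpow: "finsupp c \<Longrightarrow> ip (cpow \<alpha> i c) d = ip c (cpow \<alpha> (- i) d)"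
proof (induction i arbitrary: d rule: int_induct[where k = 0])
  case (step1 i)
  then have "ip (cpow \<alpha> (i + 1) c) d = ip (cpow \<alpha> i c) (cmvi \<alpha> d)"
    by (simp add: cmv_cpow[symmetric] ip_cmv)
  also have "\<dots> = ip c (cpow \<alpha> (- i) (cpow \<alpha> (-1) d))"
    using step1 cmvi_cpow[of 0 d] by simp
  finally show ?case by (simp add: cpow_cpow)
next
  case (step2 i)
  then have "ip (cpow \<alpha> (i - 1) c) d = ip (cpow \<alpha> i c) (cmv \<alpha> d)"
    by (simp add: cmvi_cpow[symmetric] ip_cmvi)
  also have "\<dots> = ip c (cpow \<alpha> (- i) (cpow \<alpha> 1 d))"
    using step2 cmv_cpow[of 0 d] by simp
  finally show ?case by (simp add: cpow_cpow)
qed simp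

definition moment :: "int \<Rightarrow> complex" where "moment j = ip (cpow \<alpha> j (bvec 0)) (bvec 0)"

text \<open>The CMV matrix is unitary, so the Gram matrix of the orbit of the first basis vector is a Toeplitz
  matrix; its positivity is what makes the Fejer densities nonnegative.\<close>

lemma ip_cpow_bvec: "ip (cpow \<alpha> i (bvec 0)) (cpow \<alpha> j (bvec 0)) = moment (i - j)"
  using ip_cpow[of "cpow \<alpha> i (bvec 0)" "-j" "bvec 0"] by (simp add: cpow_cpow moment_def)

lemma moment_0: "moment 0 = 1" by (simp add: moment_def ip_bvec_left bvec_def)

lemma moment_cnj: "cnj (moment j) = moment (- j)"
  unfolding moment_def by (simp add: ip_cnj) (metis cpow_0 diff_0 ip_cpow_bvec moment_def)

end

section \<open>Existence of the spectral measure\<close>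

lemma cis_integral:
  "has_bochner_integral lborel (\<lambda>x. indicator {0..2*pi} x *\<^sub>R cis (of_int m * x))
     (if m = 0 then complex_of_real (2 * pi) else 0)"
proof (cases "m = 0")
  case True
  have "has_bochner_integral lborel (\<lambda>x::real. indicator {0..2*pi} x *\<^sub>R (1::complex)) (complex_of_real (2*pi) - complex_of_real 0)"
    by (rule has_bochner_integral_FTC_Icc) (auto intro!: derivative_eq_intros simp: has_real_derivative_iff_has_vector_derivative[symmetric] has_vector_derivative_def has_derivative_of_real scaleR_conv_of_real)
  then show ?thesis using True by simp
next
  case False
  let ?F = "\<lambda>x. cis (of_int m * x) / (\<i> * of_int m)"
  have "has_bochner_integral lborel (\<lambda>x. indicator {0..2*pi} x *\<^sub>R cis (of_int m * x)) (?F (2*pi) - ?F 0)"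
  proof (rule has_bochner_integral_FTC_Icc)
    fix x :: real
    have "((\<lambda>z. exp (\<i> * of_int m * z) / (\<i> * of_int m)) has_field_derivative exp (\<i> * of_int m * of_real x)) (at (of_real x) within UNIV)"
      using False by (auto intro!: derivative_eq_intros)
    then have "((\<lambda>z. exp (\<i> * of_int m * z) / (\<i> * of_int m)) has_field_derivative exp (\<i> * of_int m * of_real x)) (at (of_real x))"
      by simp
    from has_vector_derivative_real_field[OF this, of "{0..2*pi}"]
    show "(?F has_vector_derivative cis (of_int m * x)) (at x within {0..2*pi})"
      by (simp add: cis_conv_exp mult.assoc)
  qed (auto intro!: continuous_intros)
  moreover have "cis (of_int m * (2 * pi)) = 1"
    by (simp add: cis.ctr complex_eq_iff mult.assoc[symmetric]) (metis cos_int_2pin mult.commute sin_int_2pin mult.assoc)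
  ultimately show ?thesis using False by simp
qed

lemma measurable_cis_circle: "cis \<in> borel \<rightarrow>\<^sub>M circle_borel"
  unfolding circle_borel_def
  by (intro measurable_restrict_space2 borel_measurable_continuous_onI continuous_intros) auto

context verblunsky
begin

text \<open>The squared norm of \<open>\<Sum>k<N. cis (- k x) C^k e_0\<close>, normalised. It is the \<open>N\<close>-th Fejer mean of the
  Fourier series whose coefficients are the moments, and it is nonnegative by its very form.\<close>

definition fejer :: "nat \<Rightarrow> real \<Rightarrow> real" where
  "fejer N x = nsq (\<lambda>n. \<Sum>k<N. cis (- (real k * x)) * cpow \<alpha> (int k) (bvec 0) n) / (2 * pi * real N)"

lemma fejer_expand:
  "complex_of_real (fejer N x) = (\<Sum>k<N. \<Sum>l<N. moment (int k - int l) / (2 * pi * real N) * cis (of_int (int l - int k) * x))"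
proof -
  let ?c = "\<lambda>n. \<Sum>k<N. cis (- (real k * x)) * cpow \<alpha> (int k) (bvec 0) n"
  have "finsupp ?c" by (intro finsupp_sum finsupp_scale finsupp_cpow finsupp_bvec)
  then have "complex_of_real (nsq ?c) = ip ?c ?c" by (simp add: ip_self)
  also have "\<dots> = (\<Sum>k<N. cis (- (real k * x)) * ip (cpow \<alpha> (int k) (bvec 0)) ?c)"
    by (subst ip_sum_left) (auto intro!: finsupp_scale sum.cong simp: ip_scale_left)
  also have "\<dots> = (\<Sum>k<N. cis (- (real k * x)) * (\<Sum>l<N. cis (real l * x) * moment (int k - int l)))"
    by (rule sum.cong[OF refl], subst ip_sum_right)
       (auto intro!: finsupp_scale simp: ip_scale_right ip_cpow_bvec cis_cnj)
  also have "\<dots> = (\<Sum>k<N. \<Sum>l<N. moment (int k - int l) * cis (of_int (int l - int k) * x))"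
    by (simp add: sum_distrib_left mult.assoc[symmetric] cis_mult algebra_simps)
  finally show ?thesis
    by (simp add: fejer_def sum_divide_distrib)
qed

lemma fejer_nonneg: "0 \<le> fejer N x"
  unfolding fejer_def by (intro divide_nonneg_nonneg nsq_nonneg finsupp_sum finsupp_scale finsupp_cpow finsupp_bvec) auto

text \<open>Of the \<open>N\<^sup>2\<close> terms of the expansion only the \<open>N - j\<close> pairs at distance \<open>j\<close> survive the integration.\<close>

lemma fejer_integral:
  assumes "j < N"
  shows "has_bochner_integral lborel (\<lambda>x. indicator {0..2*pi} x *\<^sub>R (complex_of_real (fejer N x) * cis (real j * x)))
    (of_real (real (N - j) / real N) * moment (int j))"
proof -
  have eq: "(\<lambda>x. indicator {0..2*pi} x *\<^sub>R (complex_of_real (fejer N x) * cis (real j * x))) =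
    (\<lambda>x. \<Sum>k<N. \<Sum>l<N. moment (int k - int l) / (2 * pi * real N) * (indicator {0..2*pi} x *\<^sub>R cis (of_int (int l - int k + int j) * x)))"
  proof
    fix x
    have c: "cis (of_int (int l - int k) * x) * cis (real j * x) = cis (of_int (int l - int k + int j) * x)" for k l
      by (simp add: cis_mult algebra_simps)
    show "indicator {0..2*pi} x *\<^sub>R (complex_of_real (fejer N x) * cis (real j * x)) =
      (\<Sum>k<N. \<Sum>l<N. moment (int k - int l) / (2 * pi * real N) * (indicator {0..2*pi} x *\<^sub>R cis (of_int (int l - int k + int j) * x)))"
      unfolding fejer_expand sum_distrib_right scaleR_sum_right
      by (intro sum.cong refl) (simp only: mult.assoc c mult_scaleR_right)
  qed
  have 1: "has_bochner_integral lborel (\<lambda>x. \<Sum>k<N. \<Sum>l<N. moment (int k - int l) / (2 * pi * real N) * (indicator {0..2*pi} x *\<^sub>R cis (of_int (int l - int k + int j) * x)))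
     (\<Sum>k<N. \<Sum>l<N. moment (int k - int l) / (2 * pi * real N) * (if int l - int k + int j = 0 then complex_of_real (2 * pi) else 0))"
    by (intro has_bochner_integral_sum has_bochner_integral_mult_right cis_integral)
  have "(\<Sum>k<N. \<Sum>l<N. moment (int k - int l) / (2 * pi * real N) * (if int l - int k + int j = 0 then complex_of_real (2 * pi) else 0))
    = (\<Sum>k<N. if j \<le> k then moment (int j) / real N else 0)"
  proof (rule sum.cong[OF refl])
    fix k assume k: "k \<in> {..<N}"
    have "(\<Sum>l<N. moment (int k - int l) / (2 * pi * real N) * (if int l - int k + int j = 0 then complex_of_real (2 * pi) else 0))
       = (\<Sum>l<N. if l + j = k then moment (int j) / real N else 0)"
    proof (rule sum.cong[OF refl])
      fix l
      have "l + j = k \<longleftrightarrow> int l - int k + int j = 0" "l + j = k \<Longrightarrow> int k - int l = int j" by linarith+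
      then show "moment (int k - int l) / (2 * pi * real N) * (if int l - int k + int j = 0 then complex_of_real (2 * pi) else 0)
        = (if l + j = k then moment (int j) / real N else 0)"
        by auto
    qed
    also have "\<dots> = (if j \<le> k then moment (int j) / real N else 0)"
    proof (cases "j \<le> k")
      case True
      then have "l + j = k \<longleftrightarrow> l = k - j" for l by auto
      then show ?thesis using k True by simp
    qed auto
    finally show "(\<Sum>l<N. moment (int k - int l) / (2 * pi * real N) * (if int l - int k + int j = 0 then complex_of_real (2 * pi) else 0))
       = (if j \<le> k then moment (int j) / real N else 0)" .
  qed
  also have "\<dots> = (\<Sum>k\<in>{j..<N}. moment (int j) / real N)"
    by (rule sum.mono_neutral_cong_right) auto
  also have "\<dots> = of_real (real (N - j) / real N) * moment (int j)" by simp
  finally show ?thesis using 1 unfolding eq by simp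
qed

definition fejer_measure :: "nat \<Rightarrow> real measure" where
  "fejer_measure n = density lborel (\<lambda>x. ennreal (fejer (Suc n) x * indicator {0..2*pi} x))"

lemma fejer_measurable: "(\<lambda>x. fejer (Suc n) x * indicator {0..2*pi} x) \<in> borel_measurable lborel"
proof -
  have "fejer (Suc n) = (\<lambda>x. Re (\<Sum>k<Suc n. \<Sum>l<Suc n. moment (int k - int l) / (2 * pi * real (Suc n)) * cis (of_int (int l - int k) * x)))"
    by (rule ext) (metis fejer_expand Re_complex_of_real)
  moreover have "continuous_on UNIV \<dots>"
    by (intro continuous_intros)
  ultimately have "fejer (Suc n) \<in> borel_measurable borel"
    by (simp add: borel_measurable_continuous_onI)
  then show ?thesis by simp
qed

lemma fejer_measurable':
  "(\<lambda>x. ennreal (fejer (Suc n) x * indicator {0..2*pi} x)) \<in> borel_measurable lborel"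
  using fejer_measurable by (rule measurable_compose) simp

lemma fejer_measure_nn_integral: "(\<integral>\<^sup>+x. ennreal (fejer (Suc n) x * indicator {0..2*pi} x) \<partial>lborel) = 1"
proof -
  have "has_bochner_integral lborel (\<lambda>x. complex_of_real (fejer (Suc n) x * indicator {0..2*pi} x)) 1"
    using fejer_integral[of 0 "Suc n"] by (simp add: scaleR_conv_of_real mult.commute moment_0)
  then have "integrable lborel (\<lambda>x. fejer (Suc n) x * indicator {0..2*pi} x)" "integral\<^sup>L lborel (\<lambda>x. fejer (Suc n) x * indicator {0..2*pi} x) = 1"
    unfolding has_bochner_integral_iff integral_complex_of_real complex_of_real_integrable_eq by auto
  then show ?thesis
    by (subst nn_integral_eq_integral) (auto simp: fejer_nonneg)
qed

lemma real_distribution_fejer_measure: "real_distribution (fejer_measure n)"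
proof (intro real_distribution.intro prob_spaceI real_distribution_axioms.intro)
  have "emeasure (fejer_measure n) UNIV = (\<integral>\<^sup>+x. ennreal (fejer (Suc n) x * indicator {0..2*pi} x) * indicator UNIV x \<partial>lborel)"
    unfolding fejer_measure_def by (rule emeasure_density[OF fejer_measurable']) simp
  then show "emeasure (fejer_measure n) (space (fejer_measure n)) = 1"
    by (simp only: indicator_UNIV mult_1_right fejer_measure_nn_integral) (simp add: fejer_measure_def fejer_measure_nn_integral)
qed (simp_all add: fejer_measure_def)

lemma char_fejer_measure:
  assumes "j \<le> n"
  shows "char (fejer_measure n) (real j) = of_real (real (Suc n - j) / real (Suc n)) * moment (int j)"
proof -
  have "char (fejer_measure n) (real j) = (LINT x|lborel. (fejer (Suc n) x * indicator {0..2*pi} x) *\<^sub>R iexp (real j * x))"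
    unfolding char_def fejer_measure_def
    by (subst integral_density) (auto simp: fejer_measurable[simplified] fejer_nonneg)
  also have "\<dots> = (LINT x|lborel. indicator {0..2*pi} x *\<^sub>R (complex_of_real (fejer (Suc n) x) * cis (real j * x)))"
    by (intro Bochner_Integration.integral_cong) (auto simp: cis_conv_exp indicator_def scaleR_conv_of_real mult_ac)
  finally show ?thesis
    using fejer_integral[of j "Suc n"] assms by (simp add: has_bochner_integral_iff)
qed

lemma tight_fejer_measure: "tight fejer_measure"
  unfolding tight_def
proof (intro conjI allI impI real_distribution_fejer_measure)
  fix e :: real assume e: "e > 0"
  have "emeasure (fejer_measure n) {-1<..2*pi} = 1" for n
  proof -
    have "emeasure (fejer_measure n) {-1<..2*pi} = (\<integral>\<^sup>+x. ennreal (fejer (Suc n) x * indicator {0..2*pi} x) * indicator {-1<..2*pi} x \<partial>lborel)"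
      unfolding fejer_measure_def by (rule emeasure_density[OF fejer_measurable']) simp
    also have "\<dots> = (\<integral>\<^sup>+x. ennreal (fejer (Suc n) x * indicator {0..2*pi} x) \<partial>lborel)"
      by (intro nn_integral_cong) (auto simp: indicator_def)
    finally show ?thesis by (simp only: fejer_measure_nn_integral)
  qed
  then have "measure (fejer_measure n) {-1<..2*pi} > 1 - e" for n using e by (simp add: measure_def)
  then show "\<exists>a b. a < b \<and> (\<forall>n. 1 - e < measure (fejer_measure n) {a<..b})"
    by (intro exI[of _ "-1"] exI[of _ "2*pi"]) (auto intro: less_trans[of _ 0])
qed

text \<open>The Fejer densities live on a fixed interval, so Helly selection gives a weak limit on the real
  line. Its characteristic function at integers has the right values, and winding the line around
  the circle turns these values into moments.\<close>

theorem spectral_measure_exists: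
  "\<exists>\<nu>. circle_prob_measure \<nu> \<and> (\<forall>j::nat. (LINT z|\<nu>. z ^ j) = moment (int j))"
proof -
  from tight_imp_convergent_subsubsequence[OF tight_fejer_measure strict_mono_id]
  obtain r M where r: "strict_mono (r :: nat \<Rightarrow> nat)" and M: "real_distribution M"
    and conv: "weak_conv_m (fejer_measure \<circ> id \<circ> r) M" by auto
  interpret M: real_distribution M by fact
  have char: "char M (real j) = moment (int j)" for j
  proof (rule LIMSEQ_unique)
    show "(\<lambda>n. char ((fejer_measure \<circ> id \<circ> r) n) (real j)) \<longlonglongrightarrow> char M (real j)"
      by (rule levy_continuity1[OF _ M conv]) (simp add: real_distribution_fejer_measure)
    have "(\<lambda>n. real (Suc n - j) / real (Suc n)) \<longlonglongrightarrow> 1"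
    proof (rule Lim_transform_eventually)
      have "(\<lambda>n. 1 - real j / real (Suc n)) \<longlonglongrightarrow> 1 - 0"
        by (intro tendsto_intros filterlim_compose[OF tendsto_divide_0[OF tendsto_const] filterlim_Suc] )
      then show "(\<lambda>n. 1 - real j / real (Suc n)) \<longlonglongrightarrow> 1" by simp
      show "\<forall>\<^sub>F n in sequentially. 1 - real j / real (Suc n) = real (Suc n - j) / real (Suc n)"
        using eventually_ge_at_top[of j] by eventually_elim (auto simp: of_nat_diff field_simps)
    qed
    then have "(\<lambda>n. of_real (real (Suc n - j) / real (Suc n)) * moment (int j)) \<longlonglongrightarrow> of_real 1 * moment (int j)"
      by (intro tendsto_intros)
    then have "(\<lambda>n. of_real (real (Suc n - j) / real (Suc n)) * moment (int j)) \<longlonglongrightarrow> moment (int j)" by simp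
    then have "(\<lambda>n. char (fejer_measure n) (real j)) \<longlonglongrightarrow> moment (int j)"
    proof (rule Lim_transform_eventually)
      show "\<forall>\<^sub>F n in sequentially. of_real (real (Suc n - j) / real (Suc n)) * moment (int j) = char (fejer_measure n) (real j)"
        using eventually_ge_at_top[of j] by eventually_elim (simp only: char_fejer_measure)
    qed
    from LIMSEQ_subseq_LIMSEQ[OF this r]
    show "(\<lambda>n. char ((fejer_measure \<circ> id \<circ> r) n) (real j)) \<longlonglongrightarrow> moment (int j)" by (simp add: o_def)
  qed
  have mc: "cis \<in> M \<rightarrow>\<^sub>M circle_borel" using measurable_cis_circle by simp
  show ?thesis
  proof (intro exI[of _ "distr M circle_borel cis"] conjI allI)
    show "circle_prob_measure (distr M circle_borel cis)"
      unfolding circle_prob_measure_def using M.prob_space_distr[OF mc] by simp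
    fix j :: nat
    have "(\<lambda>z. z ^ j) \<in> borel_measurable circle_borel"
      unfolding circle_borel_def by (intro measurable_restrict_space1) measurable
    then have "(LINT z|distr M circle_borel cis. z ^ j) = (LINT x|M. cis x ^ j)"
      by (subst integral_distr[OF mc]) auto
    also have "\<dots> = char M (real j)"
      unfolding char_def by (intro Bochner_Integration.integral_cong) (simp_all only: Complex.DeMoivre cis_conv_exp[symmetric])
    finally show "(LINT z|distr M circle_borel cis. z ^ j) = moment (int j)" by (simp add: char)
  qed
qed

end

lemma inverse_unit_circle: "cmod z = 1 \<Longrightarrow> inverse z = cnj z"
  by (rule inverse_unique) (simp add: complex_norm_square[symmetric])

section \<open>Laurent polynomials in the CMV matrix\<close>

text \<open>\<open>rep \<alpha> f c\<close> says that on the circle \<open>f\<close> is a Laurent polynomial and that \<open>c\<close> is its value at the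
  CMV matrix, applied to the first basis vector. The last rule makes values off the circle irrelevant;
  without it multiplication by \<open>z\<close> would fail at the origin.\<close>

inductive rep :: "(nat \<Rightarrow> complex) \<Rightarrow> (complex \<Rightarrow> complex) \<Rightarrow> (nat \<Rightarrow> complex) \<Rightarrow> bool" for \<alpha> where
  rep_powi: "rep \<alpha> (\<lambda>z. z powi j) (cpow \<alpha> j (bvec 0))"
| rep_add: "rep \<alpha> f c \<Longrightarrow> rep \<alpha> g d \<Longrightarrow> rep \<alpha> (\<lambda>z. f z + g z) (\<lambda>n. c n + d n)"
| rep_scale: "rep \<alpha> f c \<Longrightarrow> rep \<alpha> (\<lambda>z. t * f z) (\<lambda>n. t * c n)"
| rep_cong: "rep \<alpha> f c \<Longrightarrow> (\<And>z. cmod z = 1 \<Longrightarrow> f z = g z) \<Longrightarrow> rep \<alpha> g c"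

lemma rep_finsupp: "rep \<alpha> f c \<Longrightarrow> finsupp c"
  by (induction rule: rep.induct) auto

lemma rep_continuous: "rep \<alpha> f c \<Longrightarrow> continuous_on (sphere 0 1) f"
proof (induction rule: rep.induct)
  case (rep_powi j)
  show ?case by (intro continuous_intros) auto
next
  case (rep_cong f c g)
  have "continuous_on (sphere 0 1) f \<longleftrightarrow> continuous_on (sphere 0 1) g"
    by (rule continuous_on_cong) (use rep_cong.hyps in auto)
  then show ?case using rep_cong.IH by simp
qed (auto intro: continuous_intros)

lemma rep_1: "rep \<alpha> (\<lambda>z. 1) (bvec 0)"
  using rep_powi[of \<alpha> 0] by simp

lemma rep_0: "rep \<alpha> (\<lambda>z. 0) (\<lambda>n. 0)"
  using rep_scale[OF rep_1, of \<alpha> 0] by simp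

lemma rep_diff: "rep \<alpha> f c \<Longrightarrow> rep \<alpha> g d \<Longrightarrow> rep \<alpha> (\<lambda>z. f z - g z) (\<lambda>n. c n - d n)"
  using rep_add[OF _ rep_scale[of \<alpha> g d "-1"], of f c] by simp

lemma rep_sum: "(\<And>i. i \<in> I \<Longrightarrow> rep \<alpha> (f i) (c i)) \<Longrightarrow> rep \<alpha> (\<lambda>z. \<Sum>i\<in>I. f i z) (\<lambda>n. \<Sum>i\<in>I. c i n)"
  by (induction I rule: infinite_finite_induct) (auto simp: rep_0 intro: rep_add)

context verblunsky
begin

lemma rep_mult_powi: "rep \<alpha> f c \<Longrightarrow> rep \<alpha> (\<lambda>z. z powi i * f z) (cpow \<alpha> i c)"
proof (induction rule: rep.induct)
  case (rep_powi j)
  show ?case unfolding cpow_cpow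
    by (rule rep_cong[OF rep.rep_powi]) (auto intro!: power_int_add)
next
  case (rep_add f c g d)
  then show ?case by (simp add: cpow_add_fun distrib_left rep.rep_add)
next
  case (rep_scale f c t)
  then show ?case using rep.rep_scale[of \<alpha> "\<lambda>z. z powi i * f z" _ t] by (simp add: cpow_scale mult.left_commute)
next
  case (rep_cong f c g)
  show ?case by (rule rep.rep_cong[OF rep_cong.IH]) (use rep_cong.hyps in auto)
qed

lemma rep_mult_z: "rep \<alpha> f c \<Longrightarrow> rep \<alpha> (\<lambda>z. z * f z) (cmv \<alpha> c)"
  using rep_mult_powi[of f c 1] cmv_cpow[of 0 c] by simp

lemma rep_mult: "rep \<alpha> f c \<Longrightarrow> rep \<alpha> g d \<Longrightarrow> \<exists>e. rep \<alpha> (\<lambda>z. f z * g z) e"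
proof (induction rule: rep.induct)
  case (rep_powi j)
  then show ?case using rep_mult_powi by blast
next
  case (rep_add f c f' c')
  then obtain e e' where "rep \<alpha> (\<lambda>z. f z * g z) e" "rep \<alpha> (\<lambda>z. f' z * g z) e'" by blast
  from rep.rep_add[OF this] show ?case by (auto simp: distrib_right)
next
  case (rep_scale f c t)
  then obtain e where "rep \<alpha> (\<lambda>z. f z * g z) e" by blast
  from rep.rep_scale[OF this, of t] show ?case by (auto simp: mult.assoc)
next
  case (rep_cong f c f')
  then obtain e where "rep \<alpha> (\<lambda>z. f z * g z) e" by blast
  then have "rep \<alpha> (\<lambda>z. f' z * g z) e" by (rule rep.rep_cong) (use rep_cong.hyps in auto)
  then show ?case by blast
qed

lemma rep_Re: "\<exists>c. rep \<alpha> (\<lambda>z. of_real (Re z)) c"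
proof -
  have "rep \<alpha> (\<lambda>z. of_real (Re z)) (\<lambda>n. (1/2) * (cpow \<alpha> 1 (bvec 0) n + cpow \<alpha> (-1) (bvec 0) n))"
  proof (rule rep_cong[OF rep_scale[OF rep_add[OF rep_powi rep_powi]]])
    fix z :: complex assume "cmod z = 1"
    then have "inverse z = cnj z" by (rule inverse_unit_circle)
    then show "1 / 2 * (z powi 1 + z powi -1) = complex_of_real (Re z)"
      by (simp add: complex_eq_iff power_int_minus)
  qed
  then show ?thesis by blast
qed

lemma rep_Im: "\<exists>c. rep \<alpha> (\<lambda>z. of_real (Im z)) c"
proof -
  have "rep \<alpha> (\<lambda>z. of_real (Im z)) (\<lambda>n. (-\<i>/2) * (cpow \<alpha> 1 (bvec 0) n + (-1) * cpow \<alpha> (-1) (bvec 0) n))"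
  proof (rule rep_cong[OF rep_scale[OF rep_add[OF rep_powi rep_scale[OF rep_powi]]]])
    fix z :: complex assume "cmod z = 1"
    then have "inverse z = cnj z" by (rule inverse_unit_circle)
    then show "- \<i> / 2 * (z powi 1 + - 1 * z powi -1) = complex_of_real (Im z)"
      by (simp add: complex_eq_iff power_int_minus)
  qed
  then show ?thesis by blast
qed

lemma rep_real_polynomial:
  assumes "real_polynomial_function (h :: complex \<Rightarrow> real)"
  shows "\<exists>c. rep \<alpha> (\<lambda>z. of_real (h z)) c"
  using assms
proof (induction rule: real_polynomial_function.induct)
  case (linear h)
  interpret h: bounded_linear h by fact
  have h: "h z = h 1 * Re z + h \<i> * Im z" for z
  proof -
    have "z = Re z *\<^sub>R 1 + Im z *\<^sub>R \<i>" by (simp add: complex_eq_iff)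
    from arg_cong[OF this, of h] have "h z = h (Re z *\<^sub>R 1 + Im z *\<^sub>R \<i>)" .
    also have "\<dots> = Re z * h 1 + Im z * h \<i>" by (simp only: h.add h.scaleR real_scaleR_def)
    finally show ?thesis by (simp add: mult.commute)
  qed
  obtain c d where cd: "rep \<alpha> (\<lambda>z. of_real (Re z)) c" "rep \<alpha> (\<lambda>z. of_real (Im z)) d" using rep_Re rep_Im by blast
  have "rep \<alpha> (\<lambda>z. of_real (h z)) (\<lambda>n. of_real (h 1) * c n + of_real (h \<i>) * d n)"
    by (rule rep_cong[OF rep_add[OF rep_scale[OF cd(1)] rep_scale[OF cd(2)]]]) (subst h, simp)
  then show ?case by blast
next
  case (const r)
  then show ?case using rep_scale[OF rep_1, of \<alpha> "of_real r"] by auto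
next
  case (add f g)
  then obtain c d where "rep \<alpha> (\<lambda>z. of_real (f z)) c" "rep \<alpha> (\<lambda>z. of_real (g z)) d" by blast
  from rep_add[OF this] show ?case by auto
next
  case (mult f g)
  then obtain c d where "rep \<alpha> (\<lambda>z. of_real (f z)) c" "rep \<alpha> (\<lambda>z. of_real (g z)) d" by blast
  from rep_mult[OF this] show ?case by auto
qed

text \<open>Stone-Weierstrass: on the circle the real and the imaginary part of \<open>z\<close> are Laurent polynomials.\<close>

lemma rep_dense:
  assumes "continuous_on (sphere 0 1) (g :: complex \<Rightarrow> complex)" "0 < e"
  obtains f c where "rep \<alpha> f c" "\<And>z. cmod z = 1 \<Longrightarrow> cmod (f z - g z) < e"
proof -
  obtain p where p: "polynomial_function p" "\<And>z. z \<in> sphere 0 1 \<Longrightarrow> norm (g z - p z) < e"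
    using Stone_Weierstrass_polynomial_function[OF compact_sphere assms] by blast
  have "real_polynomial_function (Re \<circ> p)" "real_polynomial_function (Im \<circ> p)"
    using p(1) bounded_linear_Re bounded_linear_Im unfolding polynomial_function_def by auto
  from this[THEN rep_real_polynomial] obtain c d
    where "rep \<alpha> (\<lambda>z. of_real (Re (p z))) c" "rep \<alpha> (\<lambda>z. of_real (Im (p z))) d"
    unfolding comp_apply by blast
  then have "rep \<alpha> (\<lambda>z. of_real (Re (p z)) + \<i> * of_real (Im (p z))) (\<lambda>n. c n + \<i> * d n)"
    by (intro rep_add rep_scale)
  then have "rep \<alpha> p (\<lambda>n. c n + \<i> * d n)"
    by (rule rep_cong) (simp add: complex_eq_iff)
  moreover have "cmod (p z - g z) < e" if "cmod z = 1" for z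
    using p(2)[of z] that by (simp add: norm_minus_commute)
  ultimately show ?thesis using that by blast
qed

text \<open>Every basis vector is reached, both in the coordinates of \<open>C = L M\<close> and in those of \<open>M L\<close>: the
  factors carry one system of coordinates to the other, and each of them produces the next basis
  vector with the nonzero coefficient \<open>\<rho>\<close>.\<close>

lemma rep_bvec: "(\<exists>f. rep \<alpha> f (bvec n)) \<and> (\<exists>f. rep \<alpha> f (blk_adj \<alpha> False (bvec n)))"
proof -
  let ?R = "\<lambda>c. \<exists>f. rep \<alpha> f c"
  let ?R' = "\<lambda>c. \<exists>f. rep \<alpha> f (blk_adj \<alpha> False c)"
  have a: "?R c \<Longrightarrow> ?R d \<Longrightarrow> ?R (\<lambda>n. s * c n + t * d n)" for c d s t using rep_add rep_scale by meson
  have a': "?R' c \<Longrightarrow> ?R' d \<Longrightarrow> ?R' (\<lambda>n. s * c n + t * d n)" for c d s t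
    using a[of "blk_adj \<alpha> False c" "blk_adj \<alpha> False d" s t] by (simp add: blk_adj_add blk_adj_scale)
  have i1: "?R' c \<Longrightarrow> ?R (blk \<alpha> True c)" for c using rep_mult_z[of _ "blk_adj \<alpha> False c"] by (auto simp: cmv_def blk_blk_adj)
  have i2: "?R c \<Longrightarrow> ?R' (blk_adj \<alpha> True c)" for c
    using rep_mult_powi[of _ c "-1"] cmvi_cpow[of 0 c] by (auto simp: cmvi_def)
  have i3: "?R c \<Longrightarrow> ?R' (blk \<alpha> False c)" for c by (simp add: blk_adj_blk)
  have i4: "?R' c \<Longrightarrow> ?R (blk_adj \<alpha> False c)" for c by simp
  have r: "rho (\<alpha> n) \<noteq> 0" for n using rho_pos[OF disk, of n] by simp
  have up: "bvec (Suc n) = (\<lambda>k. (1 / rho (\<alpha> n)) * blk \<alpha> s (bvec n) k + (- cnj (\<alpha> n) / rho (\<alpha> n)) * bvec n k)" 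
    "bvec (Suc n) = (\<lambda>k. (1 / rho (\<alpha> n)) * blk_adj \<alpha> s (bvec n) k + (- \<alpha> n / rho (\<alpha> n)) * bvec n k)" if "even n = s" for n s
    using that r[of n] by (auto simp: fun_eq_iff bvec_def blk_def blk_adj_def tridiag_def dg_def od_def)
  have "?R (bvec n) \<and> ?R' (bvec n)"
  proof (induction n)
    case 0
    have "blk \<alpha> False (bvec 0) = bvec 0"
      by (auto simp: fun_eq_iff bvec_def blk_def tridiag_def dg_def od_def)
    then have "?R' (bvec 0)" using i3[of "bvec 0"] rep_1 by auto
    then show ?case using rep_1 by blast
  next
    case (Suc n)
    then have s: "?R (bvec n)" "?R' (bvec n)" by blast+
    show ?case
    proof (cases "even n")
      case True
      then have e: "even n = True" by simp
      have "?R (bvec (Suc n))" unfolding up(1)[OF e] by (rule a[OF i1[OF s(2)] s(1)])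
      moreover have "?R' (bvec (Suc n))" unfolding up(2)[OF e] by (rule a'[OF i2[OF s(1)] s(2)])
      ultimately show ?thesis by blast
    next
      case False
      then have e: "even n = False" by simp
      have "?R (bvec (Suc n))" unfolding up(2)[OF e] by (rule a[OF i4[OF s(2)] s(1)])
      moreover have "?R' (bvec (Suc n))" unfolding up(1)[OF e] by (rule a'[OF i3[OF s(1)] s(2)])
      ultimately show ?thesis by blast
    qed
  qed
  then show ?thesis by simp
qed

lemma rep_surj: assumes "finsupp c" obtains f where "rep \<alpha> f c"
proof -
  obtain N where N: "\<forall>n\<ge>N. c n = 0" using assms by (auto simp: finsupp_def)
  obtain g where g: "\<And>n. rep \<alpha> (g n) (bvec n)" using rep_bvec by metis
  have "rep \<alpha> (\<lambda>z. \<Sum>k<N. c k * g k z) (\<lambda>n. \<Sum>k<N. c k * bvec k n)"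
    by (intro rep_sum rep_scale g)
  then show ?thesis using that finsupp_decomp[of N c] N by auto
qed

end

section \<open>The spectral representation\<close>

locale spectral = verblunsky +
  fixes \<nu> :: "complex measure"
  assumes circle: "circle_prob_measure \<nu>"
    and moments: "\<And>j::nat. (LINT z|\<nu>. z ^ j) = moment (int j)"
begin

sublocale prob_space \<nu> using circle by (simp add: circle_prob_measure_def)

lemma sets_nu: "sets \<nu> = sets circle_borel" using circle by (simp add: circle_prob_measure_def)

lemma space_nu [simp]: "space \<nu> = sphere 0 1"
  using sets_eq_imp_space_eq[OF sets_nu] by (simp add: circle_borel_def space_restrict_space)

lemma measurable_continuous: 
  fixes f :: "complex \<Rightarrow> 'b :: topological_space"
  assumes "continuous_on (sphere 0 1) f" shows "f \<in> borel_measurable \<nu>"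
  using borel_measurable_continuous_on_restrict[OF assms]
  by (simp add: circle_borel_def measurable_cong_sets[OF sets_nu refl])

lemma integrable_continuous:
  fixes f :: "complex \<Rightarrow> 'b :: {banach, second_countable_topology}"
  assumes "continuous_on (sphere 0 1) f" shows "integrable \<nu> f"
proof -
  have "bounded (f ` sphere 0 1)"
    by (intro compact_imp_bounded compact_continuous_image assms compact_sphere)
  then obtain b where "\<And>z. z \<in> sphere 0 1 \<Longrightarrow> norm (f z) \<le> b" by (meson bounded_iff imageI)
  then show ?thesis
    by (intro integrable_const_bound[of _ b] measurable_continuous assms) auto
qed

lemma integral_powi: "(LINT z|\<nu>. z powi j) = moment j"
proof (cases "j \<ge> 0")
  case True
  then obtain k where "j = int k" by (metis nonneg_eq_int)
  then show ?thesis by (simp add: moments)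
next
  case False
  then obtain k where k: "j = - int k" using False by (metis not_le negD)
  have "(LINT z|\<nu>. z powi j) = (LINT z|\<nu>. cnj (z ^ k))"
  proof (rule Bochner_Integration.integral_cong[OF refl])
    fix z assume "z \<in> space \<nu>"
    then have "inverse z = cnj z" by (simp add: inverse_unit_circle)
    then show "z powi j = cnj (z ^ k)" by (simp add: k power_int_minus power_inverse[symmetric])
  qed
  also have "\<dots> = cnj (moment (int k))" by (simp only: Bochner_Integration.integral_cnj moments)
  finally show ?thesis by (simp add: moment_cnj k)
qed

lemma rep_ip_powi:
  assumes "rep \<alpha> g d"
  shows "(LINT z|\<nu>. z powi i * cnj (g z)) = ip (cpow \<alpha> i (bvec 0)) d"
  using assms
proof (induction)
  case (rep_powi j)
  have "(LINT z|\<nu>. z powi i * cnj (z powi j)) = (LINT z|\<nu>. z powi (i - j))"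
  proof (rule Bochner_Integration.integral_cong[OF refl])
    fix z assume z: "z \<in> space \<nu>"
    then have "cnj z = inverse z" by (simp add: inverse_unit_circle)
    then show "z powi i * cnj (z powi j) = z powi (i - j)"
      using z by (subst power_int_diff) (auto simp: power_int_inverse divide_inverse)
  qed
  then show ?case by (simp add: integral_powi ip_cpow_bvec)
next
  case (rep_add f c g d)
  have "integrable \<nu> (\<lambda>z. z powi i * cnj (f z))" "integrable \<nu> (\<lambda>z. z powi i * cnj (g z))"
    by (intro integrable_continuous continuous_intros rep_continuous[OF rep_add.hyps(1)] rep_continuous[OF rep_add.hyps(2)]; force)+
  then show ?case using rep_add rep_finsupp by (simp add: distrib_left ip_add_right)
next
  case (rep_scale f c t)
  then show ?case using rep_finsupp[OF rep_scale.hyps] by (simp add: ip_scale_right mult.left_commute)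
next
  case (rep_cong f c g)
  have "(LINT z|\<nu>. z powi i * cnj (g z)) = (LINT z|\<nu>. z powi i * cnj (f z))"
    by (rule Bochner_Integration.integral_cong) (use rep_cong.hyps in auto)
  then show ?case using rep_cong.IH by simp
qed

text \<open>The spectral theorem in the form needed here: a Laurent polynomial has in \<open>L^2(\<nu>)\<close> the norm of its
  coordinate vector.\<close>

lemma rep_ip:
  assumes "rep \<alpha> f c" "rep \<alpha> g d"
  shows "(LINT z|\<nu>. f z * cnj (g z)) = ip c d"
  using assms
proof (induction)
  case (rep_powi j)
  then show ?case by (rule rep_ip_powi)
next
  case (rep_add f c f' c')
  have "integrable \<nu> (\<lambda>z. f z * cnj (g z))" "integrable \<nu> (\<lambda>z. f' z * cnj (g z))"
    by (intro integrable_continuous continuous_intros rep_continuous[OF rep_add.hyps(1)] rep_continuous[OF rep_add.hyps(2)] rep_continuous[OF rep_add.prems])+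
  then show ?case using rep_add rep_finsupp by (simp add: distrib_right ip_add_left)
next
  case (rep_scale f c t)
  then show ?case using rep_finsupp[OF rep_scale.hyps] by (simp add: ip_scale_left mult.assoc)
next
  case (rep_cong f c f')
  have "(LINT z|\<nu>. f' z * cnj (g z)) = (LINT z|\<nu>. f z * cnj (g z))"
    by (rule Bochner_Integration.integral_cong) (use rep_cong.hyps in auto)
  then show ?case using rep_cong.IH rep_cong.prems by simp
qed

lemma rep_nsq:
  assumes "rep \<alpha> f c" shows "(LINT z|\<nu>. (cmod (f z))\<^sup>2) = nsq c"
proof -
  have "complex_of_real (LINT z|\<nu>. (cmod (f z))\<^sup>2) = (LINT z|\<nu>. f z * cnj (f z))"
    by (simp only: integral_complex_of_real[symmetric] complex_norm_square)
  then show ?thesis using rep_ip[OF assms assms] ip_self[OF rep_finsupp[OF assms]] by simp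
qed

end

text \<open>The combination obtained from a homogeneous system with more unknowns than equations: among more
  than \<open>card S\<close> functions some nontrivial combination vanishes on \<open>S\<close>. It is what turns many
  orthogonal functions into a contradiction with a finite support.\<close>

lemma linear_dependence:
  fixes f :: "'i \<Rightarrow> 'z \<Rightarrow> 'a :: field"
  assumes "finite S" "finite I" "card S < card I"
  shows "\<exists>t. (\<exists>i\<in>I. t i \<noteq> 0) \<and> (\<forall>z\<in>S. (\<Sum>i\<in>I. t i * f i z) = 0)"
  using assms
proof (induction S arbitrary: I f rule: finite_induct)
  case empty
  then obtain i where "i \<in> I" by fastforce
  then show ?case by (intro exI[of _ "\<lambda>_. 1"]) auto
next
  case (insert s S)
  show ?case
  proof (cases "\<forall>i\<in>I. f i s = 0")
    case True
    have "card S < card I" using insert by simp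
    then obtain t where t: "\<exists>i\<in>I. t i \<noteq> 0" "\<forall>z\<in>S. (\<Sum>i\<in>I. t i * f i z) = 0"
      using insert.IH[OF insert.prems(1), of f] by blast
    have "(\<Sum>i\<in>I. t i * f i s) = 0" using True by simp
    with t show ?thesis by blast
  next
    case False
    then obtain p where p: "p \<in> I" "f p s \<noteq> 0" by blast
    define g where "g i z = f i z - f i s / f p s * f p z" for i z
    have "card S < card (I - {p})" using insert p by simp
    then obtain t where t: "\<exists>i\<in>I - {p}. t i \<noteq> 0" "\<forall>z\<in>S. (\<Sum>i\<in>I - {p}. t i * g i z) = 0"
      using insert.IH[of "I - {p}" g] insert.prems(1) by blast
    define t' where "t' i = (if i = p then - (\<Sum>i\<in>I - {p}. t i * (f i s / f p s)) else t i)" for i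
    have eq: "(\<Sum>i\<in>I. t' i * f i z) = (\<Sum>i\<in>I - {p}. t i * g i z)" for z
    proof -
      have "(\<Sum>i\<in>I. t' i * f i z) = t' p * f p z + (\<Sum>i\<in>I - {p}. t' i * f i z)"
        using p insert.prems(1) by (simp add: sum.remove)
      also have "(\<Sum>i\<in>I - {p}. t' i * f i z) = (\<Sum>i\<in>I - {p}. t i * f i z)"
        by (rule sum.cong) (auto simp: t'_def)
      finally show ?thesis
        by (simp add: t'_def g_def right_diff_distrib sum_subtractf sum_distrib_right mult.assoc)
    qed
    have "(\<Sum>i\<in>I. t' i * f i s) = 0" unfolding eq using p by (simp add: g_def)
    moreover have "\<exists>i\<in>I. t' i \<noteq> 0" using t(1) by (auto simp: t'_def)
    ultimately show ?thesis using t(2) by (intro exI[of _ t']) (auto simp: eq)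
  qed
qed

section \<open>The support of the spectral measure\<close>

lemma closed_circle_support: "closed (circle_support \<nu>)"
proof -
  have "\<exists>T. open T \<and> x \<in> T \<and> T \<subseteq> - circle_support \<nu>" if x: "x \<notin> circle_support \<nu>" for x
  proof (cases "x \<in> sphere 0 1")
    case False
    then have "open (- sphere 0 1 :: complex set)" "x \<in> - sphere 0 1" "- sphere 0 1 \<subseteq> - circle_support \<nu>"
      by (auto simp: circle_support_def open_Compl)
    then show ?thesis by blast
  next
    case True
    then obtain U where "open U" "x \<in> U" "emeasure \<nu> (U \<inter> sphere 0 1) = 0"
      using x by (auto simp: circle_support_def zero_less_iff_neq_zero)
    then show ?thesis by (intro exI[of _ U]) (auto simp: circle_support_def)
  qed
  then show ?thesis unfolding closed_def by (subst open_subopen) blast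
qed

lemma circle_support_sphere: "circle_support \<nu> \<subseteq> sphere 0 1"
  by (auto simp: circle_support_def)

context spectral
begin

lemma open_sets_nu: "open U \<Longrightarrow> U \<inter> sphere 0 1 \<in> sets \<nu>"
  unfolding sets_nu circle_borel_def sets_restrict_space by auto

text \<open>The complement of the support is covered by null sets; by Lindelof countably many suffice.\<close>

lemma AE_support: "AE z in \<nu>. z \<in> circle_support \<nu>"
proof -
  define F where "F = {U. open U \<and> emeasure \<nu> (U \<inter> sphere 0 1) = 0}"
  obtain F' where F': "F' \<subseteq> F" "countable F'" "\<Union>F' = \<Union>F"
    using Lindelof[of F] by (auto simp: F_def)
  have "(\<Union>U\<in>F'. U \<inter> sphere 0 1) \<in> null_sets \<nu>"
    by (rule null_sets_UN'[OF F'(2)]) (use F'(1) in \<open>auto simp: F_def null_sets_def open_sets_nu\<close>)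
  moreover have "{z \<in> space \<nu>. z \<notin> circle_support \<nu>} \<subseteq> (\<Union>U\<in>F'. U \<inter> sphere 0 1)"
  proof
    fix z assume z: "z \<in> {z \<in> space \<nu>. z \<notin> circle_support \<nu>}"
    then obtain U where "open U" "z \<in> U" "\<not> emeasure \<nu> (U \<inter> sphere 0 1) > 0"
      by (auto simp: circle_support_def)
    then have "z \<in> \<Union>F" by (auto simp: F_def)
    then have "z \<in> \<Union>F'" using F' by simp
    with z show "z \<in> (\<Union>U\<in>F'. U \<inter> sphere 0 1)" by auto
  qed
  ultimately show ?thesis by (rule AE_I')
qed

lemma integral_zero_on_support:
  fixes h :: "complex \<Rightarrow> real"
  assumes "\<And>z. z \<in> circle_support \<nu> \<Longrightarrow> h z = 0"
  shows "(LINT z|\<nu>. h z) = 0"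
proof -
  have "AE z in \<nu>. h z = 0" using AE_support by eventually_elim (rule assms)
  then show ?thesis by (rule integral_eq_zero_AE)
qed

text \<open>Infinitely many orthonormal functions do not fit on a finite set.\<close>

lemma infinite_support: "infinite (circle_support \<nu>)"
proof
  assume fin: "finite (circle_support \<nu>)"
  let ?N = "card (circle_support \<nu>)"
  obtain g where g: "\<And>n. rep \<alpha> (g n) (bvec n)" using rep_bvec choice[of "\<lambda>n f. rep \<alpha> f (bvec n)"] by blast
  obtain t where t: "\<exists>i\<in>{..?N}. t i \<noteq> 0" "\<forall>z\<in>circle_support \<nu>. (\<Sum>i\<in>{..?N}. t i * g i z) = 0"
    using linear_dependence[OF fin, of "{..?N}" g] by auto
  have r: "rep \<alpha> (\<lambda>z. \<Sum>i\<in>{..?N}. t i * g i z) (\<lambda>n. \<Sum>i\<in>{..?N}. t i * bvec i n)"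
    by (intro rep_sum rep_scale g)
  obtain k where k: "k \<le> ?N" "t k \<noteq> 0" using t(1) by auto
  have "(\<Sum>i\<in>{..?N}. t i * bvec i k) = (\<Sum>i\<in>{..?N}. if i = k then t i else 0)"
    by (rule sum.cong) (auto simp: bvec_def)
  then have "(\<Sum>i\<in>{..?N}. t i * bvec i k) \<noteq> 0" using k by simp
  then have "0 < nsq (\<lambda>n. \<Sum>i\<in>{..?N}. t i * bvec i n)"
    by (rule nsq_pos[OF rep_finsupp[OF r]])
  moreover have "(LINT z|\<nu>. (cmod (\<Sum>i\<in>{..?N}. t i * g i z))\<^sup>2) = 0"
    by (rule integral_zero_on_support) (use t(2) in simp)
  ultimately show False using rep_nsq[OF r] by simp
qed

end

section \<open>Szego recursion\<close>

fun szego_poly :: "(nat \<Rightarrow> complex) \<Rightarrow> nat \<Rightarrow> complex poly" where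
  "szego_poly \<alpha> 0 = 1"
| "szego_poly \<alpha> (Suc n) = [:0, 1:] * szego_poly \<alpha> n - smult (cnj (\<alpha> n)) (reversed_poly (szego_poly \<alpha> n))"

lemma degree_reversed_le: "degree (reversed_poly p) \<le> degree p"
proof -
  have "degree (map_poly cnj p) = degree p" by (rule degree_map_poly) auto
  then show ?thesis unfolding reversed_poly_def using degree_reflect_poly_le[of "map_poly cnj p"] by simp
qed

lemma degree_szego_poly: "degree (szego_poly \<alpha> n) = n" "lead_coeff (szego_poly \<alpha> n) = 1"
proof -
  have "degree (szego_poly \<alpha> n) = n \<and> lead_coeff (szego_poly \<alpha> n) = 1"
  proof (induction n)
    case (Suc n)
    let ?p = "[:0, 1:] * szego_poly \<alpha> n" and ?q = "- smult (cnj (\<alpha> n)) (reversed_poly (szego_poly \<alpha> n))"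
    have nz: "szego_poly \<alpha> n \<noteq> 0" using Suc by auto
    have p: "degree ?p = Suc n" using Suc nz by (simp add: degree_mult_eq)
    have q: "degree ?q < Suc n" using degree_smult_le[of "cnj (\<alpha> n)" "reversed_poly (szego_poly \<alpha> n)"] degree_reversed_le[of "szego_poly \<alpha> n"] Suc by simp
    have "degree (?p + ?q) = Suc n" "lead_coeff (?p + ?q) = lead_coeff ?p"
      using p q degree_add_eq_left[of ?q ?p] lead_coeff_add_le[of ?q ?p] by (auto simp: coeff_eq_0)
    moreover have "lead_coeff ?p = 1" using Suc by (auto simp: lead_coeff_mult simp del: mult_pCons_left)
    ultimately show ?case by simp
  qed simp
  then show "degree (szego_poly \<alpha> n) = n" "lead_coeff (szego_poly \<alpha> n) = 1" by auto
qed

lemma poly_reversed_circle: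
  assumes "cmod z = 1" shows "poly (reversed_poly p) z = z ^ degree p * cnj (poly p z)"
proof -
  have "z \<noteq> 0" using assms by auto
  moreover have "1 / cnj z = z" using inverse_unit_circle[of "cnj z"] assms by (simp add: inverse_eq_divide)
  ultimately show ?thesis by (simp add: poly_reversed_poly)
qed

lemma reversed_szego_poly_rec:
  assumes z: "cmod z = 1"
  shows "poly (reversed_poly (szego_poly \<alpha> (Suc n))) z
    = poly (reversed_poly (szego_poly \<alpha> n)) z - \<alpha> n * (z * poly (szego_poly \<alpha> n) z)"
proof -
  have zz: "z * cnj z = 1" using z by (simp add: complex_norm_square[symmetric])
  then have zn: "z ^ n * cnj z ^ n = 1" by (simp add: power_mult_distrib[symmetric])
  have "poly (reversed_poly (szego_poly \<alpha> (Suc n))) z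
    = z ^ n * (z * cnj z) * cnj (poly (szego_poly \<alpha> n) z) - \<alpha> n * z * (z ^ n * cnj z ^ n) * poly (szego_poly \<alpha> n) z"
    unfolding poly_reversed_circle[OF z] degree_szego_poly by (simp add: poly_reversed_circle[OF z] degree_szego_poly algebra_simps)
  then show ?thesis by (simp add: zz zn poly_reversed_circle[OF z] degree_szego_poly algebra_simps)
qed

context verblunsky
begin

lemma cmv_cpow_commute: "cpow \<alpha> j (cmv \<alpha> c) = cpow \<alpha> (j + 1) c"
  using cmv_cpow[of 0 c] cpow_cpow[of j 1 c] by simp

lemma cpow_lin: "cpow \<alpha> j (\<lambda>n. c n - t * d n) = (\<lambda>n. cpow \<alpha> j c n - t * cpow \<alpha> j d n)"
  using cpow_add_fun[of \<alpha> j c "\<lambda>n. (-t) * d n"] cpow_scale[of \<alpha> j "-t" d] by simp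

definition rho_prod :: "nat \<Rightarrow> real" where "rho_prod n = (\<Prod>j<n. rho (\<alpha> j))"

lemma rho_prod_Suc: "rho_prod (Suc n) = rho_prod n * rho (\<alpha> n)" by (simp add: rho_prod_def)

lemma blk_bvec:
  assumes "even n = s"
  shows "blk \<alpha> s (bvec n) = (\<lambda>k. cnj (\<alpha> n) * bvec n k + rho (\<alpha> n) * bvec (Suc n) k)"
    and "blk \<alpha> s (bvec (Suc n)) = (\<lambda>k. rho (\<alpha> n) * bvec n k - \<alpha> n * bvec (Suc n) k)"
    and "blk_adj \<alpha> s (bvec n) = (\<lambda>k. \<alpha> n * bvec n k + rho (\<alpha> n) * bvec (Suc n) k)"
    and "blk_adj \<alpha> s (bvec (Suc n)) = (\<lambda>k. rho (\<alpha> n) * bvec n k - cnj (\<alpha> n) * bvec (Suc n) k)"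
proof -
  have "blk \<alpha> s (bvec n) k = cnj (\<alpha> n) * bvec n k + rho (\<alpha> n) * bvec (Suc n) k \<and>
    blk \<alpha> s (bvec (Suc n)) k = rho (\<alpha> n) * bvec n k - \<alpha> n * bvec (Suc n) k \<and>
    blk_adj \<alpha> s (bvec n) k = \<alpha> n * bvec n k + rho (\<alpha> n) * bvec (Suc n) k \<and>
    blk_adj \<alpha> s (bvec (Suc n)) k = rho (\<alpha> n) * bvec n k - cnj (\<alpha> n) * bvec (Suc n) k" for k
    using assms by (cases k) (auto simp: bvec_def blk_def blk_adj_def tridiag_def dg_def od_def)
  then show "blk \<alpha> s (bvec n) = (\<lambda>k. cnj (\<alpha> n) * bvec n k + rho (\<alpha> n) * bvec (Suc n) k)"
    and "blk \<alpha> s (bvec (Suc n)) = (\<lambda>k. rho (\<alpha> n) * bvec n k - \<alpha> n * bvec (Suc n) k)"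
    and "blk_adj \<alpha> s (bvec n) = (\<lambda>k. \<alpha> n * bvec n k + rho (\<alpha> n) * bvec (Suc n) k)"
    and "blk_adj \<alpha> s (bvec (Suc n)) = (\<lambda>k. rho (\<alpha> n) * bvec n k - cnj (\<alpha> n) * bvec (Suc n) k)"
    by auto
qed

text \<open>The Szego recursion for the pair of a polynomial and its reverse, read in coordinates.\<close>

lemma bvec_relations:
  "even n \<Longrightarrow> (\<lambda>k. blk \<alpha> True (bvec n) k - cnj (\<alpha> n) * bvec n k) = (\<lambda>k. rho (\<alpha> n) * bvec (Suc n) k)"
  "even n \<Longrightarrow> (\<lambda>k. bvec n k - \<alpha> n * blk \<alpha> True (bvec n) k) = (\<lambda>k. rho (\<alpha> n) * blk \<alpha> True (bvec (Suc n)) k)"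
  "odd n \<Longrightarrow> (\<lambda>k. bvec n k - cnj (\<alpha> n) * blk_adj \<alpha> False (bvec n) k) = (\<lambda>k. rho (\<alpha> n) * blk_adj \<alpha> False (bvec (Suc n)) k)"
  "odd n \<Longrightarrow> (\<lambda>k. blk_adj \<alpha> False (bvec n) k - \<alpha> n * bvec n k) = (\<lambda>k. rho (\<alpha> n) * bvec (Suc n) k)"
proof -
  note r = rho_sq[OF disk, of n]
  have r': "complex_of_real (rho (\<alpha> n)) * (complex_of_real (rho (\<alpha> n)) * x) = x - \<alpha> n * (cnj (\<alpha> n) * x)" for x
    using arg_cong[OF r, of "\<lambda>y. y * x"] by (simp add: algebra_simps)
  show "even n \<Longrightarrow> (\<lambda>k. blk \<alpha> True (bvec n) k - cnj (\<alpha> n) * bvec n k) = (\<lambda>k. rho (\<alpha> n) * bvec (Suc n) k)"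
    "odd n \<Longrightarrow> (\<lambda>k. blk_adj \<alpha> False (bvec n) k - \<alpha> n * bvec n k) = (\<lambda>k. rho (\<alpha> n) * bvec (Suc n) k)"
    by (simp_all add: blk_bvec)
  show "even n \<Longrightarrow> (\<lambda>k. bvec n k - \<alpha> n * blk \<alpha> True (bvec n) k) = (\<lambda>k. rho (\<alpha> n) * blk \<alpha> True (bvec (Suc n)) k)"
    "odd n \<Longrightarrow> (\<lambda>k. bvec n k - cnj (\<alpha> n) * blk_adj \<alpha> False (bvec n) k) = (\<lambda>k. rho (\<alpha> n) * blk_adj \<alpha> False (bvec (Suc n)) k)"
    by (simp_all add: blk_bvec fun_eq_iff ring_distribs r r' mult_ac)
qed

lemma cmv_cpow_swap: "cmv \<alpha> (cpow \<alpha> j c) = cpow \<alpha> j (cmv \<alpha> c)"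
  by (simp only: cmv_cpow cmv_cpow_commute)

lemma cmv_blk_adj: "cmv \<alpha> (blk_adj \<alpha> False c) = blk \<alpha> True c"
  by (simp add: cmv_def blk_blk_adj)

lemma cpow_scaled_relation:
  assumes "(\<lambda>k. a k - t * b k) = (\<lambda>k. r * c k)"
  shows "(\<lambda>k. K * cpow \<alpha> j a k - t * (K * cpow \<alpha> j b k)) = (\<lambda>k. K * r * cpow \<alpha> j c k)"
proof
  fix k
  have "cpow \<alpha> j a k - t * cpow \<alpha> j b k = r * cpow \<alpha> j c k"
    using arg_cong[OF assms, of "\<lambda>f. cpow \<alpha> j f k"] by (simp only: cpow_lin cpow_scale)
  then have "K * (cpow \<alpha> j a k - t * cpow \<alpha> j b k) = K * (r * cpow \<alpha> j c k)" by simp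
  then show "K * cpow \<alpha> j a k - t * (K * cpow \<alpha> j b k) = K * r * cpow \<alpha> j c k"
    by (simp add: algebra_simps)
qed

text \<open>Up to a power of \<open>z\<close> and a constant, the Szego polynomial and its reverse are the \<open>n\<close>-th basis
  vectors of the two systems of coordinates; which is which depends on the parity of \<open>n\<close>.\<close>

lemma rep_szego_poly:
  "if even n then
     rep \<alpha> (poly (szego_poly \<alpha> n)) (\<lambda>k. rho_prod n * cpow \<alpha> (int (n div 2)) (blk_adj \<alpha> False (bvec n)) k) \<and>
     rep \<alpha> (poly (reversed_poly (szego_poly \<alpha> n))) (\<lambda>k. rho_prod n * cpow \<alpha> (int (n div 2)) (bvec n) k)
   else
     rep \<alpha> (poly (szego_poly \<alpha> n)) (\<lambda>k. rho_prod n * cpow \<alpha> (int (n div 2)) (bvec n) k) \<and>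
     rep \<alpha> (poly (reversed_poly (szego_poly \<alpha> n))) (\<lambda>k. rho_prod n * cpow \<alpha> (int (n div 2) + 1) (blk_adj \<alpha> False (bvec n)) k)"
proof (induction n)
  case 0
  have "blk_adj \<alpha> False (bvec 0) = bvec 0"
    by (auto simp: fun_eq_iff bvec_def blk_adj_def tridiag_def dg_def od_def)
  moreover have "poly (reversed_poly 1) = (\<lambda>z::complex. 1)" by (auto simp: reversed_poly_def fun_eq_iff)
  moreover have "poly (1 :: complex poly) = (\<lambda>z. 1)" by auto
  ultimately show ?case using rep_1 by (simp add: rho_prod_def)
next
  case (Suc n)
  let ?p = "poly (szego_poly \<alpha> n)" and ?q = "poly (reversed_poly (szego_poly \<alpha> n))"
  have P: "poly (szego_poly \<alpha> (Suc n)) = (\<lambda>z. z * ?p z - cnj (\<alpha> n) * ?q z)" by auto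
  have Q: "rep \<alpha> (poly (reversed_poly (szego_poly \<alpha> (Suc n)))) c" if "rep \<alpha> (\<lambda>z. ?q z - \<alpha> n * (z * ?p z)) c" for c
    using that by (rule rep_cong) (simp only: reversed_szego_poly_rec)
  show ?case
  proof (cases "even n")
    case True
    let ?k = "int (n div 2)"
    from True Suc have p: "rep \<alpha> ?p (\<lambda>k. rho_prod n * cpow \<alpha> ?k (blk_adj \<alpha> False (bvec n)) k)"
      and q: "rep \<alpha> ?q (\<lambda>k. rho_prod n * cpow \<alpha> ?k (bvec n) k)" by auto
    have zp: "rep \<alpha> (\<lambda>z. z * ?p z) (\<lambda>k. rho_prod n * cpow \<alpha> ?k (blk \<alpha> True (bvec n)) k)"
      using rep_mult_z[OF p] by (simp only: cmv_scale cmv_cpow_swap cmv_blk_adj)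
    have e1: "(\<lambda>k. rho_prod n * cpow \<alpha> ?k (blk \<alpha> True (bvec n)) k - cnj (\<alpha> n) * (rho_prod n * cpow \<alpha> ?k (bvec n) k))
      = (\<lambda>k. rho_prod (Suc n) * cpow \<alpha> ?k (bvec (Suc n)) k)"
      using cpow_scaled_relation[OF bvec_relations(1)[OF True]] by (simp add: rho_prod_Suc)
    have e2: "(\<lambda>k. rho_prod n * cpow \<alpha> ?k (bvec n) k - \<alpha> n * (rho_prod n * cpow \<alpha> ?k (blk \<alpha> True (bvec n)) k))
      = (\<lambda>k. rho_prod (Suc n) * cpow \<alpha> (?k + 1) (blk_adj \<alpha> False (bvec (Suc n))) k)"
      using cpow_scaled_relation[OF bvec_relations(2)[OF True]]
      by (simp add: rho_prod_Suc cmv_blk_adj[symmetric] cmv_cpow_commute)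
    have "rep \<alpha> (poly (szego_poly \<alpha> (Suc n))) (\<lambda>k. rho_prod (Suc n) * cpow \<alpha> ?k (bvec (Suc n)) k)"
      unfolding P e1[symmetric] by (intro rep_diff zp rep_scale q)
    moreover have "rep \<alpha> (poly (reversed_poly (szego_poly \<alpha> (Suc n)))) (\<lambda>k. rho_prod (Suc n) * cpow \<alpha> (?k + 1) (blk_adj \<alpha> False (bvec (Suc n))) k)"
      unfolding e2[symmetric] by (intro Q rep_diff rep_scale[of _ "\<lambda>z. z * ?p z"] zp q)
    moreover have eq: "int (Suc n div 2) = ?k" using True by (auto elim: evenE)
    ultimately show ?thesis unfolding eq using True by (simp del: szego_poly.simps)
  next
    case False
    let ?k = "int (n div 2)"
    from False Suc have p: "rep \<alpha> ?p (\<lambda>k. rho_prod n * cpow \<alpha> ?k (bvec n) k)"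
      and q: "rep \<alpha> ?q (\<lambda>k. rho_prod n * cpow \<alpha> (?k + 1) (blk_adj \<alpha> False (bvec n)) k)" by auto
    have zp: "rep \<alpha> (\<lambda>z. z * ?p z) (\<lambda>k. rho_prod n * cpow \<alpha> (?k + 1) (bvec n) k)"
      using rep_mult_z[OF p] by (simp add: cmv_scale cmv_cpow)
    have e1: "(\<lambda>k. rho_prod n * cpow \<alpha> (?k + 1) (bvec n) k - cnj (\<alpha> n) * (rho_prod n * cpow \<alpha> (?k + 1) (blk_adj \<alpha> False (bvec n)) k))
      = (\<lambda>k. rho_prod (Suc n) * cpow \<alpha> (?k + 1) (blk_adj \<alpha> False (bvec (Suc n))) k)"
      using cpow_scaled_relation[OF bvec_relations(3)[OF False]] by (simp add: rho_prod_Suc)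
    have e2: "(\<lambda>k. rho_prod n * cpow \<alpha> (?k + 1) (blk_adj \<alpha> False (bvec n)) k - \<alpha> n * (rho_prod n * cpow \<alpha> (?k + 1) (bvec n) k))
      = (\<lambda>k. rho_prod (Suc n) * cpow \<alpha> (?k + 1) (bvec (Suc n)) k)"
      using cpow_scaled_relation[OF bvec_relations(4)[OF False]] by (simp add: rho_prod_Suc)
    have "rep \<alpha> (poly (szego_poly \<alpha> (Suc n))) (\<lambda>k. rho_prod (Suc n) * cpow \<alpha> (?k + 1) (blk_adj \<alpha> False (bvec (Suc n))) k)"
      unfolding P e1[symmetric] by (intro rep_diff zp rep_scale q)
    moreover have "rep \<alpha> (poly (reversed_poly (szego_poly \<alpha> (Suc n)))) (\<lambda>k. rho_prod (Suc n) * cpow \<alpha> (?k + 1) (bvec (Suc n)) k)"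
      unfolding e2[symmetric] by (intro Q rep_diff rep_scale[of _ "\<lambda>z. z * ?p z"] zp q)
    moreover have eq: "int (Suc n div 2) = ?k + 1" using False by (auto elim: oddE)
    ultimately show ?thesis unfolding eq using False by (simp del: szego_poly.simps)
  qed
qed

lemma tridiag_cpow_bound: 
  assumes "n > 2 * nat \<bar>j\<bar> + 1" shows "tridiag a b (cpow \<alpha> j (bvec 0)) n = 0"
  by (rule tridiag_bound[of "2 * nat \<bar>j\<bar> + 1"]) (use assms in \<open>auto intro!: cpow_bvec_bound\<close>)

text \<open>By the bandwidth, \<open>C^i e_0\<close> with small \<open>\<bar>i\<bar>\<close> does not reach the \<open>n\<close>-th coordinate. For even \<open>n\<close>
  and negative \<open>i\<close> one factor of \<open>C^i\<close> has to be cancelled first to save one position.\<close>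

lemma rep_szego_poly_orth:
  assumes "j < n"
  shows "\<exists>c. rep \<alpha> (poly (szego_poly \<alpha> n)) c \<and> ip c (cpow \<alpha> (int j) (bvec 0)) = 0"
proof (cases "even n")
  case False
  let ?k = "int (n div 2)"
  have "rep \<alpha> (poly (szego_poly \<alpha> n)) (\<lambda>k. rho_prod n * cpow \<alpha> ?k (bvec n) k)" using rep_szego_poly[of n] False by auto
  moreover have "cpow \<alpha> (int j - ?k) (bvec 0) n = 0"
    by (rule cpow_bvec_bound) (use False assms in \<open>auto elim!: oddE\<close>)
  then have "ip (\<lambda>k. rho_prod n * cpow \<alpha> ?k (bvec n) k) (cpow \<alpha> (int j) (bvec 0)) = 0"
    by (simp add: ip_scale_left ip_cpow cpow_cpow ip_bvec_left)
  ultimately show ?thesis by blast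
next
  case True
  let ?k = "int (n div 2)"
  let ?i = "int j - ?k"
  have "rep \<alpha> (poly (szego_poly \<alpha> n)) (\<lambda>k. rho_prod n * cpow \<alpha> ?k (blk_adj \<alpha> False (bvec n)) k)" using rep_szego_poly[of n] True by auto
  moreover have "blk \<alpha> False (cpow \<alpha> ?i (bvec 0)) n = 0"
  proof (cases "?i \<ge> 0")
    case p: True
    show ?thesis unfolding blk_def
      by (rule tridiag_cpow_bound) (use p True assms in \<open>auto elim!: evenE\<close>)
  next
    case m: False
    have "cpow \<alpha> ?i (bvec 0) = blk_adj \<alpha> False (blk_adj \<alpha> True (cpow \<alpha> (?i + 1) (bvec 0)))"
      using cmvi_cpow[of "?i + 1" "bvec 0"] by (simp add: cmvi_def)
    then have "blk \<alpha> False (cpow \<alpha> ?i (bvec 0)) = blk_adj \<alpha> True (cpow \<alpha> (?i + 1) (bvec 0))"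
      by (simp only: blk_blk_adj)
    then have "blk \<alpha> False (cpow \<alpha> ?i (bvec 0)) n = blk_adj \<alpha> True (cpow \<alpha> (?i + 1) (bvec 0)) n" by simp
    also have "\<dots> = 0" unfolding blk_adj_def
      by (rule tridiag_cpow_bound) (use m True assms in \<open>auto elim!: evenE\<close>)
    finally show ?thesis .
  qed
  then have "ip (\<lambda>k. rho_prod n * cpow \<alpha> ?k (blk_adj \<alpha> False (bvec n)) k) (cpow \<alpha> (int j) (bvec 0)) = 0"
    by (simp add: ip_scale_left ip_cpow cpow_cpow ip_blk_adj ip_bvec_left)
  ultimately show ?thesis by blast
qed

end

context spectral
begin

lemma szego_poly_orth_power: assumes "j < n" shows "(LINT z|\<nu>. poly (szego_poly \<alpha> n) z * cnj (z ^ j)) = 0"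
  using rep_szego_poly_orth[OF assms] rep_ip[OF _ rep_powi[of \<alpha> "int j"], of "poly (szego_poly \<alpha> n)"] by auto

lemma szego_poly_orth: assumes "m < n" shows "(LINT z|\<nu>. poly (szego_poly \<alpha> n) z * cnj (poly (szego_poly \<alpha> m) z)) = 0"
proof -
  have "(LINT z|\<nu>. poly (szego_poly \<alpha> n) z * cnj (poly (szego_poly \<alpha> m) z))
    = (LINT z|\<nu>. (\<Sum>i\<le>m. cnj (coeff (szego_poly \<alpha> m) i) * (poly (szego_poly \<alpha> n) z * cnj (z ^ i))))"
    by (simp add: poly_altdef[of "szego_poly \<alpha> m"] degree_szego_poly sum_distrib_left mult_ac)
  also have "\<dots> = (\<Sum>i\<le>m. (LINT z|\<nu>. cnj (coeff (szego_poly \<alpha> m) i) * (poly (szego_poly \<alpha> n) z * cnj (z ^ i))))"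
    by (rule Bochner_Integration.integral_sum) (intro integrable_continuous continuous_intros)
  also have "\<dots> = 0" using assms
    by (intro sum.neutral) (auto simp: szego_poly_orth_power simp del: complex_cnj_power)
  finally show ?thesis .
qed

lemma has_verblunsky: "has_verblunsky_coeffs \<nu> \<alpha>"
proof -
  have "(LINT z|\<nu>. cnj (poly (szego_poly \<alpha> m) z) * poly (szego_poly \<alpha> n) z) = 0" if "m \<noteq> n" for m n
  proof (cases "m < n")
    case True
    then show ?thesis using szego_poly_orth[OF True] by (simp add: mult.commute)
  next
    case False
    then have "n < m" using that by simp
    have "(LINT z|\<nu>. cnj (poly (szego_poly \<alpha> m) z) * poly (szego_poly \<alpha> n) z) = (LINT z|\<nu>. cnj (poly (szego_poly \<alpha> m) z * cnj (poly (szego_poly \<alpha> n) z)))"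
      by simp
    also have "\<dots> = 0" using szego_poly_orth[OF \<open>n < m\<close>] by (simp only: Bochner_Integration.integral_cnj) simp
    finally show ?thesis .
  qed
  then have "monic_orthogonal_polys \<nu> (szego_poly \<alpha>)" unfolding monic_orthogonal_polys_def using degree_szego_poly by blast
  then show ?thesis unfolding has_verblunsky_coeffs_def using circle infinite_support
    by (intro conjI exI[of _ "szego_poly \<alpha>"]) auto
qed

end

section \<open>Uniqueness of the spectral measure\<close>

lemma spectral_continuous_eq:
  assumes "spectral \<alpha> \<mu>" "spectral \<alpha> \<nu>" and g: "continuous_on (sphere 0 1) (g :: complex \<Rightarrow> complex)"
  shows "(LINT z|\<mu>. g z) = (LINT z|\<nu>. g z)"
proof (rule ccontr)
  interpret m: spectral \<alpha> \<mu> by fact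
  interpret n: spectral \<alpha> \<nu> by fact
  assume "(LINT z|\<mu>. g z) \<noteq> (LINT z|\<nu>. g z)"
  then have e: "0 < cmod ((LINT z|\<mu>. g z) - (LINT z|\<nu>. g z)) / 3" (is "0 < ?e") by simp
  obtain f c where f: "rep \<alpha> f c" "\<And>z. cmod z = 1 \<Longrightarrow> cmod (f z - g z) < ?e"
    using m.rep_dense[OF g e] by blast
  have cf: "continuous_on (sphere 0 1) f" by (rule rep_continuous[OF f(1)])
  have eqf: "(LINT z|\<mu>. f z) = (LINT z|\<nu>. f z)"
    using m.rep_ip[OF f(1) rep_1] n.rep_ip[OF f(1) rep_1] by simp
  have close: "cmod ((LINT z|M. f z) - (LINT z|M. g z)) \<le> ?e" if "spectral \<alpha> M" for M
  proof -
    interpret M: spectral \<alpha> M by fact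
    have i: "integrable M f" "integrable M g" by (intro M.integrable_continuous cf g)+
    have "cmod ((LINT z|M. f z) - (LINT z|M. g z)) = cmod (LINT z|M. f z - g z)"
      using i by simp
    also have "\<dots> \<le> (LINT z|M. cmod (f z - g z))" by (rule integral_norm_bound)
    also have "\<dots> \<le> ?e"
    proof (rule M.integral_le_const)
      show "integrable M (\<lambda>z. cmod (f z - g z))" using i by auto
      show "AE x in M. cmod (f x - g x) \<le> ?e" using f(2) by (intro AE_I2) (simp add: less_imp_le)
    qed
    finally show ?thesis .
  qed
  note b = close[OF assms(1)] close[OF assms(2)]
  have eq: "(LINT z|\<mu>. g z) - (LINT z|\<nu>. g z) = ((LINT z|\<nu>. f z) - (LINT z|\<nu>. g z)) - ((LINT z|\<mu>. f z) - (LINT z|\<mu>. g z))"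
    by (simp add: eqf)
  have "cmod ((LINT z|\<mu>. g z) - (LINT z|\<nu>. g z)) \<le> cmod ((LINT z|\<nu>. f z) - (LINT z|\<nu>. g z)) + cmod ((LINT z|\<mu>. f z) - (LINT z|\<mu>. g z))"
    unfolding eq by (rule norm_triangle_ineq4)
  then show False using e b by linarith
qed

text \<open>The measure of a closed set is recovered from continuous functions.\<close>

lemma (in spectral) measure_closed_limit:
  assumes "closed F" "F \<noteq> {}"
  shows "(\<lambda>n. LINT z|\<nu>. max 0 (1 - real n * setdist {z} F)) \<longlonglongrightarrow> measure \<nu> (F \<inter> sphere 0 1)"
proof -
  have F: "F \<inter> sphere 0 1 \<in> sets \<nu>"
    unfolding sets_nu circle_borel_def sets_restrict_space using assms by auto
  have "(\<lambda>n. LINT z|\<nu>. max 0 (1 - real n * setdist {z} F)) \<longlonglongrightarrow> (LINT z|\<nu>. indicator (F \<inter> sphere 0 1) z)"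
  proof (rule integral_dominated_convergence)
    show "(\<lambda>z. max 0 (1 - real n * setdist {z} F)) \<in> borel_measurable \<nu>" for n
      by (intro measurable_continuous continuous_intros continuous_on_setdist)
    show "AE z in \<nu>. (\<lambda>n. max 0 (1 - real n * setdist {z} F)) \<longlonglongrightarrow> indicator (F \<inter> sphere 0 1) z"
    proof (intro AE_I2)
      fix z assume z: "z \<in> space \<nu>"
      show "(\<lambda>n. max 0 (1 - real n * setdist {z} F)) \<longlonglongrightarrow> indicator (F \<inter> sphere 0 1) z"
      proof (cases "z \<in> F")
        case True
        then have "setdist {z} F = 0" by (intro setdist_sing_in_set)
        then show ?thesis using True z by simp
      next
        case False
        then have p: "setdist {z} F > 0"
          using assms setdist_eq_0_closed[OF assms(1), of z] setdist_pos_le[of "{z}" F] by (simp add: order_le_less)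
        obtain N where N: "real N * setdist {z} F > 1" using reals_Archimedean3[OF p] by blast
        have "\<forall>\<^sub>F n in sequentially. max 0 (1 - real n * setdist {z} F) = 0"
          using eventually_ge_at_top[of N]
        proof eventually_elim
          case (elim n)
          then have "real N * setdist {z} F \<le> real n * setdist {z} F" using p by (intro mult_right_mono) auto
          then show ?case using N by simp
        qed
        then show ?thesis using False by (simp add: tendsto_eventually)
      qed
    qed
    show "AE z in \<nu>. norm (max 0 (1 - real n * setdist {z} F)) \<le> 1" for n
      by (intro AE_I2) (auto simp: setdist_pos_le)
  qed (use F in auto)
  then show ?thesis using F by simp
qed

lemma spectral_unique:
  assumes "spectral \<alpha> \<mu>" "spectral \<alpha> \<nu>" shows "\<mu> = \<nu>"
proof -
  interpret m: spectral \<alpha> \<mu> by fact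
  interpret n: spectral \<alpha> \<nu> by fact
  have cl: "measure \<mu> (F \<inter> sphere 0 1) = measure \<nu> (F \<inter> sphere 0 1)" if F: "closed F" for F
  proof (cases "F = {}")
    case False
    have "(LINT z|\<mu>. max 0 (1 - real n * setdist {z} F)) = (LINT z|\<nu>. max 0 (1 - real n * setdist {z} F))" for n
    proof -
      have "(LINT z|\<mu>. complex_of_real (max 0 (1 - real n * setdist {z} F))) = (LINT z|\<nu>. complex_of_real (max 0 (1 - real n * setdist {z} F)))"
        by (intro spectral_continuous_eq[OF assms] continuous_intros continuous_on_setdist)
      then show ?thesis by (simp only: integral_complex_of_real of_real_eq_iff)
    qed
    then show ?thesis using m.measure_closed_limit[OF F False] n.measure_closed_limit[OF F False] LIMSEQ_unique by auto
  qed simp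
  have id: "(\<lambda>z. z) \<in> \<mu> \<rightarrow>\<^sub>M borel" "(\<lambda>z. z) \<in> \<nu> \<rightarrow>\<^sub>M borel"
    by (intro m.measurable_continuous n.measurable_continuous continuous_intros)+
  have em: "emeasure (distr M borel (\<lambda>z. z)) X = emeasure M (X \<inter> sphere 0 1)" if "X \<in> sets borel" "M = \<mu> \<or> M = \<nu>" for X M
    using that id by (auto simp: emeasure_distr)
  have "distr \<mu> borel (\<lambda>z. z) = distr \<nu> borel (\<lambda>z. z)"
  proof (rule measure_eqI_generator_eq[where E = "Collect closed" and \<Omega> = UNIV and A = "\<lambda>_. UNIV"])
    show "sets (distr \<mu> borel (\<lambda>z. z)) = sigma_sets UNIV (Collect closed)"
      "sets (distr \<nu> borel (\<lambda>z. z)) = sigma_sets UNIV (Collect closed)"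
      by (simp_all add: borel_eq_closed)
    show "emeasure (distr \<mu> borel (\<lambda>z. z)) X = emeasure (distr \<nu> borel (\<lambda>z. z)) X" if "X \<in> Collect closed" for X
      using that cl[of X] by (simp add: em m.emeasure_eq_measure n.emeasure_eq_measure)
    show "emeasure (distr \<mu> borel (\<lambda>z. z)) UNIV \<noteq> \<infinity>" by (simp add: em m.emeasure_eq_measure)
  qed (auto simp: Int_stable_def)
  then have eq: "emeasure \<mu> (X \<inter> sphere 0 1) = emeasure \<nu> (X \<inter> sphere 0 1)" if "X \<in> sets borel" for X
    using em[OF that, of \<mu>] em[OF that, of \<nu>] \<open>distr \<mu> borel (\<lambda>z. z) = distr \<nu> borel (\<lambda>z. z)\<close> by auto
  show ?thesis
  proof (rule measure_eqI)
    show "sets \<mu> = sets \<nu>" by (simp add: m.sets_nu n.sets_nu)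
    fix A assume "A \<in> sets \<mu>"
    then obtain X where "X \<in> sets borel" "A = X \<inter> sphere 0 1"
      unfolding m.sets_nu circle_borel_def sets_restrict_space by auto
    then show "emeasure \<mu> A = emeasure \<nu> A" using eq by simp
  qed
qed

text \<open>The \<open>n\<close>-th monic orthogonal polynomial is orthogonal to 1, and this determines the \<open>n\<close>-th moment
  from the lower ones. The measure with the moments of the CMV matrix satisfies the same relations.\<close>

lemma (in verblunsky) spectral_of_verblunsky:
  assumes "has_verblunsky_coeffs \<mu> \<alpha>" shows "spectral \<alpha> \<mu>"
proof -
  obtain P where P: "monic_orthogonal_polys \<mu> P" "P 0 = 1"
    "\<And>n. P (Suc n) = [:0, 1:] * P n - smult (cnj (\<alpha> n)) (reversed_poly (P n))"
    and circ: "circle_prob_measure \<mu>" using assms by (auto simp: has_verblunsky_coeffs_def)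
  have eq: "P n = szego_poly \<alpha> n" for n by (induction n) (simp_all add: P)
  obtain \<nu> where nu: "circle_prob_measure \<nu>" "\<forall>j::nat. (LINT z|\<nu>. z ^ j) = moment (int j)"
    using spectral_measure_exists by blast
  interpret n: spectral \<alpha> \<nu>
    by (rule spectral.intro[OF verblunsky_axioms spectral_axioms.intro[OF nu(1) nu(2)[rule_format]]])
  have int: "integrable M (\<lambda>z. z ^ j)" if "circle_prob_measure M" for M and j :: nat
  proof -
    interpret prob_space M using that by (simp add: circle_prob_measure_def)
    have s: "sets M = sets circle_borel" using that by (simp add: circle_prob_measure_def)
    then have sp: "space M = sphere 0 1" using sets_eq_imp_space_eq[OF s] by (simp add: circle_borel_def space_restrict_space)
    have "(\<lambda>z. z ^ j) \<in> borel_measurable circle_borel"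
      unfolding circle_borel_def by (intro measurable_restrict_space1) measurable
    then have "(\<lambda>z. z ^ j) \<in> borel_measurable M" by (simp add: measurable_cong_sets[OF s refl])
    then show ?thesis
      by (intro integrable_const_bound[of _ 1]) (auto simp: sp norm_power)
  qed
  have rec: "(\<Sum>i\<le>n. coeff (szego_poly \<alpha> n) i * (LINT z|M. z ^ i)) = 0"
    if "0 < n" "circle_prob_measure M" "(LINT z|M. poly (szego_poly \<alpha> n) z) = 0" for M n
  proof -
    have "(LINT z|M. poly (szego_poly \<alpha> n) z) = (\<Sum>i\<le>n. (LINT z|M. coeff (szego_poly \<alpha> n) i * z ^ i))"
      unfolding poly_altdef degree_szego_poly
      by (rule Bochner_Integration.integral_sum) (intro integrable_mult_right int that)
    then show ?thesis using that by simp
  qed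
  have zero: "(LINT z|\<mu>. poly (szego_poly \<alpha> n) z) = 0" if "n > 0" for n
  proof -
    have "(LINT z|\<mu>. cnj (poly (P 0) z) * poly (P n) z) = 0"
      by (rule P(1)[unfolded monic_orthogonal_polys_def, THEN conjunct2, rule_format]) (use that in simp)
    then show ?thesis unfolding P(2) by (simp add: eq)
  qed
  have zero': "(LINT z|\<nu>. poly (szego_poly \<alpha> n) z) = 0" if "n > 0" for n
    using n.szego_poly_orth_power[OF that] by simp
  have "(LINT z|\<mu>. z ^ n) = (LINT z|\<nu>. z ^ n)" for n :: nat
  proof (induction n rule: less_induct)
    case (less n)
    show ?case
    proof (cases "n = 0")
      case True
      interpret prob_space \<mu> using circ by (simp add: circle_prob_measure_def)
      show ?thesis using True prob_space n.prob_space by simp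
    next
      case False
      have split: "(\<Sum>i\<le>n. coeff (szego_poly \<alpha> n) i * (LINT z|M. z ^ i)) = (\<Sum>i<n. coeff (szego_poly \<alpha> n) i * (LINT z|M. z ^ i)) + (LINT z|M. z ^ n)" for M
        using degree_szego_poly[of \<alpha> n] by (simp add: lessThan_Suc_atMost[symmetric])
      have "(\<Sum>i<n. coeff (szego_poly \<alpha> n) i * (LINT z|\<mu>. z ^ i)) = (\<Sum>i<n. coeff (szego_poly \<alpha> n) i * (LINT z|\<nu>. z ^ i))"
        by (rule sum.cong) (use less in auto)
      then show ?thesis
        using rec[of n \<mu>, OF _ circ zero] rec[of n \<nu>, OF _ nu(1) zero'] False
        unfolding split by (simp add: add_eq_0_iff)
    qed
  qed
  then show ?thesis
    by (intro spectral.intro[OF verblunsky_axioms spectral_axioms.intro[OF circ]]) (simp only: nu(2))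
qed

theorem (in verblunsky) spectral_verblunsky_measure: "spectral \<alpha> (verblunsky_measure \<alpha>)"
proof -
  obtain \<nu> where nu: "circle_prob_measure \<nu>" "\<forall>j::nat. (LINT z|\<nu>. z ^ j) = moment (int j)"
    using spectral_measure_exists by blast
  have s: "spectral \<alpha> \<nu>"
    by (rule spectral.intro[OF verblunsky_axioms spectral_axioms.intro[OF nu(1) nu(2)[rule_format]]])
  interpret n: spectral \<alpha> \<nu> by (rule s)
  have h: "has_verblunsky_coeffs \<nu> \<alpha>" by (rule n.has_verblunsky)
  have u: "\<mu> = \<nu>" if h: "has_verblunsky_coeffs \<mu> \<alpha>" for \<mu>
    by (rule spectral_unique[OF spectral_of_verblunsky[OF h] s])
  have "verblunsky_measure \<alpha> = \<nu>" unfolding verblunsky_measure_def by (rule the_equality, rule h, rule u)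
  then show ?thesis using s by simp
qed

section \<open>Local test vectors and non-isolated points of the support\<close>

definition ess :: "complex set \<Rightarrow> complex set" where
  "ess S = S - {z. z isolated_in S}"

lemma ess_closed_iff: "closed S \<Longrightarrow> z \<in> ess S \<longleftrightarrow> z islimpt S"
  by (auto simp: ess_def isolated_in_islimpt_iff closed_limpt)

lemma closed_ess: assumes "closed S" shows "closed (ess S)"
proof -
  have "ess S = {z. z islimpt S}" using ess_closed_iff[OF assms] by blast
  then show ?thesis by (simp add: closed_limpts)
qed

text \<open>The coordinates of \<open>(z' - z) f(z')\<close> if \<open>f\<close> has the coordinates \<open>c\<close>, up to a unitary factor: for
  \<open>s = True\<close> one factor of \<open>L M c - z c\<close> has been moved to the other side, so that what is left is as
  local as possible; \<open>s = False\<close> is the same with \<open>L\<close> and \<open>M\<close> exchanged.\<close>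

definition defect :: "(nat \<Rightarrow> complex) \<Rightarrow> bool \<Rightarrow> complex \<Rightarrow> (nat \<Rightarrow> complex) \<Rightarrow> nat \<Rightarrow> complex" where
  "defect \<alpha> s z c = (\<lambda>n. blk \<alpha> (\<not> s) c n - z * blk_adj \<alpha> s c n)"

text \<open>A test vector that lives on the first \<open>l\<close> coefficients of \<open>\<beta>\<close> and certifies spectrum within
  distance \<open>d\<close> of \<open>z\<close>. The condition \<open>c 0 = 0\<close> makes the certificate blind to what precedes the
  window, so that it can be moved to any place.\<close>

definition detects :: "nat \<Rightarrow> (nat \<Rightarrow> complex) \<Rightarrow> complex \<Rightarrow> real \<Rightarrow> bool" where
  "detects l \<beta> z d \<longleftrightarrow> (\<exists>s c. c 0 = 0 \<and> (\<forall>n\<ge>l. c n = 0) \<and> nsq (defect \<beta> s z c) < d\<^sup>2 * nsq c)"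

lemma detect_mono: "detects l \<beta> z d \<Longrightarrow> l \<le> l' \<Longrightarrow> detects l' \<beta> z d"
  unfolding detects_def by (meson order_trans)

definition translate :: "nat \<Rightarrow> (nat \<Rightarrow> complex) \<Rightarrow> nat \<Rightarrow> complex" where
  "translate m c n = (if n < m then 0 else c (n - m))"

lemma finsupp_translate [simp, intro]: "finsupp c \<Longrightarrow> finsupp (translate m c)"
  unfolding finsupp_def translate_def by (metis diff_le_mono le_add_diff_inverse2 less_or_eq_imp_le nle_le add_diff_cancel_right' le_add1 trans_le_add2)

lemma nsq_translate: assumes "finsupp c" shows "nsq (translate m c) = nsq c"
proof (induction m)
  case 0
  then show ?case by (simp add: translate_def fun_eq_iff[symmetric] nsq_def)
next
  case (Suc m)
  have "nsq (translate (Suc m) c) = (\<Sum>n. (cmod (translate (Suc m) c (Suc n)))\<^sup>2)"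
    using suminf_split_head[OF summable_norm_finsupp[OF finsupp_translate[OF assms, of "Suc m"]]]
    by (simp add: nsq_def translate_def)
  also have "\<dots> = nsq (translate m c)"
  proof -
    have "translate (Suc m) c (Suc n) = translate m c n" for n by (auto simp: translate_def)
    then show ?thesis by (simp only: nsq_def)
  qed
  finally show ?case using Suc by simp
qed

lemma tridiag_translate:
  assumes c: "c 0 = 0"
    and a: "\<And>i. c i \<noteq> 0 \<Longrightarrow> a (m + i) = a' i"
    and b: "\<And>i. c i \<noteq> 0 \<or> c (Suc i) \<noteq> 0 \<Longrightarrow> b (m + i) = b' i"
  shows "tridiag a b (translate m c) = translate m (tridiag a' b' c)"
proof
  fix n
  show "tridiag a b (translate m c) n = translate m (tridiag a' b' c) n"
  proof (cases "n < m")
    case True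
    then have "Suc n < m \<or> Suc n = m" by linarith
    then show ?thesis using True c by (auto simp: tridiag_def translate_def)
  next
    case False
    then obtain i where n: "n = m + i" by (metis le_Suc_ex not_less)
    have 1: "a n * translate m c n = a' i * c i" using a[of i] by (cases "c i = 0") (auto simp: n translate_def)
    have 2: "b n * translate m c (Suc n) = b' i * c (Suc i)" using b[of i] by (cases "c (Suc i) = 0") (auto simp: n translate_def)
    have 3: "(if n = 0 then 0 else b (n - 1) * translate m c (n - 1)) = (if i = 0 then 0 else b' (i - 1) * c (i - 1))"
    proof (cases i)
      case 0
      then show ?thesis by (auto simp: n translate_def)
    next
      case (Suc k)
      then show ?thesis using b[of k] by (cases "c k = 0") (auto simp: n translate_def)
    qed
    show ?thesis unfolding tridiag_def 1 2 3 by (simp add: translate_def n tridiag_def)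
  qed
qed

text \<open>Locality: moving the window by \<open>m\<close> moves the defect, with \<open>L\<close> and \<open>M\<close> exchanged if \<open>m\<close> is odd.\<close>

lemma defect_translate:
  assumes "\<And>i. i < l \<Longrightarrow> \<alpha> (m + i) = \<beta> i" "c 0 = 0" "\<And>n. n \<ge> l \<Longrightarrow> c n = 0"
  shows "defect \<alpha> (s = even m) z (translate m c) = translate m (defect \<beta> s z c)"
proof -
  have l: "c i \<noteq> 0 \<Longrightarrow> i < l" for i using assms(3) not_less by blast
  have d: "dg \<alpha> (s = even m) (m + i) = dg \<beta> s i" if "c i \<noteq> 0" for i s
  proof -
    have "i \<noteq> 0" using that assms(2) by (cases i) auto
    then obtain k where "i = Suc k" by (cases i) auto
    then show ?thesis using l[OF that] assms(1)[of k] assms(1)[of "Suc k"] by (auto simp: dg_def)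
  qed
  have o: "od \<alpha> (s = even m) (m + i) = od \<beta> s i" if "c i \<noteq> 0 \<or> c (Suc i) \<noteq> 0" for i s
  proof -
    have "i < l" using that l Suc_lessD by blast
    then show ?thesis using assms(1)[of i] by (auto simp: od_def)
  qed
  have bl: "blk \<alpha> (s = even m) (translate m c) = translate m (blk \<beta> s c)" for s
    unfolding blk_def by (rule tridiag_translate) (use assms(2) d o in auto)
  have blk_adj: "blk_adj \<alpha> (s = even m) (translate m c) = translate m (blk_adj \<beta> s c)" for s
    unfolding blk_adj_def by (rule tridiag_translate) (use assms(2) d o in auto)
  have ns: "(\<not> (s = even m)) = ((\<not> s) = even m)" by auto
  show ?thesis unfolding defect_def ns bl blk_adj by (auto simp: translate_def)
qed

lemma finsupp_defect [simp]: "finsupp c \<Longrightarrow> finsupp (defect \<alpha> s z c)"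
  unfolding defect_def by (intro finsupp_diff finsupp_scale finsupp_blk finsupp_blk_adj)

lemma defect_bound: "(\<And>n. n \<ge> l \<Longrightarrow> c n = 0) \<Longrightarrow> n \<ge> Suc l \<Longrightarrow> defect \<alpha> s z c n = 0"
  unfolding defect_def blk_def blk_adj_def by (simp add: tridiag_bound[of l c])

lemma blk_sum: "blk \<alpha> s (\<lambda>n. \<Sum>i\<in>I. c i n) = (\<lambda>n. \<Sum>i\<in>I. blk \<alpha> s (c i) n)"
  and blk_adj_sum: "blk_adj \<alpha> s (\<lambda>n. \<Sum>i\<in>I. c i n) = (\<lambda>n. \<Sum>i\<in>I. blk_adj \<alpha> s (c i) n)"
  by (auto simp: fun_eq_iff blk_def blk_adj_def tridiag_def sum_distrib_left sum.distrib)

lemma defect_sum: "defect \<alpha> s z (\<lambda>n. \<Sum>i\<in>I. t i * c i n) = (\<lambda>n. \<Sum>i\<in>I. t i * defect \<alpha> s z (c i) n)"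
  unfolding defect_def blk_sum blk_adj_sum blk_scale blk_adj_scale
  by (simp add: sum_distrib_left sum_subtractf[symmetric] algebra_simps)

lemma nsq_separated:
  assumes fin: "finite I" and v: "\<And>n. n > l \<Longrightarrow> v n = 0"
    and sep: "\<And>i j. i \<in> I \<Longrightarrow> j \<in> I \<Longrightarrow> i \<noteq> j \<Longrightarrow> m i + l < m j \<or> m j + l < m i"
  shows "nsq (\<lambda>n. \<Sum>i\<in>I. t i * translate (m i) v n) = (\<Sum>i\<in>I. (cmod (t i))\<^sup>2) * nsq v"
proof -
  have fv: "finsupp v" unfolding finsupp_def using v by (intro exI[of _ "Suc l"]) auto
  have f: "finsupp (\<lambda>n. \<Sum>i\<in>I. t i * translate (m i) v n)" by (intro finsupp_sum finsupp_scale finsupp_translate fv)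
  have orth: "ip (translate (m i) v) (translate (m j) v) = (if i = j then of_real (nsq v) else 0)" if "i \<in> I" "j \<in> I" for i j
  proof (cases "i = j")
    case True
    then show ?thesis using fv by (simp add: ip_self nsq_translate)
  next
    case False
    have "translate (m i) v n * cnj (translate (m j) v n) = 0" for n
    proof -
      have "n < m i \<or> n < m j \<or> l < n - m i \<or> l < n - m j" using sep[OF that False] by linarith
      then show ?thesis using v[of "n - m i"] v[of "n - m j"] by (auto simp: translate_def)
    qed
    then have "(\<lambda>n. translate (m i) v n * cnj (translate (m j) v n)) = (\<lambda>n. 0)" by (rule ext)
    then show ?thesis using False by (simp only: ip_def) simp
  qed
  have "complex_of_real (nsq (\<lambda>n. \<Sum>i\<in>I. t i * translate (m i) v n)) = (\<Sum>i\<in>I. \<Sum>j\<in>I. t i * (cnj (t j) * ip (translate (m i) v) (translate (m j) v)))"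
    unfolding ip_self[OF f, symmetric]
    by (subst ip_sum_left) (auto intro!: sum.cong simp: fv finsupp_scale ip_scale_left ip_sum_right ip_scale_right sum_distrib_left)
  also have "\<dots> = (\<Sum>i\<in>I. \<Sum>j\<in>I. if j = i then t i * cnj (t i) * nsq v else 0)"
    by (intro sum.cong refl) (auto simp: orth)
  also have "\<dots> = (\<Sum>i\<in>I. t i * cnj (t i) * nsq v)" using fin by (simp add: sum.delta)
  also have "\<dots> = complex_of_real ((\<Sum>i\<in>I. (cmod (t i))\<^sup>2) * nsq v)"
    by (simp add: sum_distrib_right complex_norm_square del: of_real_power)
  finally show ?thesis using of_real_eq_iff by blast
qed

context spectral
begin

text \<open>For \<open>s = False\<close>, turns coordinates with respect to \<open>M L\<close> into coordinates with respect to \<open>L M\<close>.\<close>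

definition test_coords :: "bool \<Rightarrow> (nat \<Rightarrow> complex) \<Rightarrow> nat \<Rightarrow> complex" where
  "test_coords s c = (if s then c else blk_adj \<alpha> False c)"

lemma test_coords_sum: "test_coords s (\<lambda>n. \<Sum>i\<in>I. t i * c i n) = (\<lambda>n. \<Sum>i\<in>I. t i * test_coords s (c i) n)"
  by (simp add: test_coords_def blk_adj_sum blk_adj_scale)

lemma test_function:
  assumes "finsupp c" "rep \<alpha> f (test_coords s c)"
  shows "(LINT z|\<nu>. (cmod (f z))\<^sup>2) = nsq c"
    and "(LINT z|\<nu>. (cmod ((z - z0) * f z))\<^sup>2) = nsq (defect \<alpha> s z0 c)"
proof -
  show "(LINT z|\<nu>. (cmod (f z))\<^sup>2) = nsq c"
    using rep_nsq[OF assms(2)] assms(1) by (simp add: test_coords_def nsq_blk_adj split: if_splits)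
  let ?e = "\<lambda>n. cmv \<alpha> (test_coords s c) n - z0 * test_coords s c n"
  have "rep \<alpha> (\<lambda>z. z * f z - z0 * f z) ?e"
    by (intro rep_diff rep_mult_z rep_scale assms(2))
  then have "(LINT z|\<nu>. (cmod (z * f z - z0 * f z))\<^sup>2) = nsq ?e" by (rule rep_nsq)
  moreover have "nsq ?e = nsq (defect \<alpha> s z0 c)"
  proof (cases s)
    case True
    have "blk \<alpha> True (defect \<alpha> True z0 c) = ?e"
      using blk_add[of \<alpha> True "blk \<alpha> False c" "\<lambda>n. (- z0) * blk_adj \<alpha> True c n"] blk_scale[of \<alpha> True "- z0" "blk_adj \<alpha> True c"] True
      by (simp add: defect_def test_coords_def cmv_def blk_blk_adj)
    then show ?thesis using nsq_blk[OF finsupp_defect[OF assms(1)], of True \<alpha> True z0] True by simp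
  next
    case False
    then have "?e = defect \<alpha> s z0 c" by (simp add: defect_def test_coords_def cmv_def blk_blk_adj fun_eq_iff)
    then show ?thesis by simp
  qed
  ultimately show "(LINT z|\<nu>. (cmod ((z - z0) * f z))\<^sup>2) = nsq (defect \<alpha> s z0 c)"
    by (simp add: left_diff_distrib)
qed

text \<open>If the support had only finitely many points in the ball, some nontrivial combination of the
  translated test functions would vanish at all of them. Translates to separated windows are
  orthogonal and so are their defects, so the combination still satisfies the strict inequality of
  the test vector. But a function supported where \<open>\<bar>z - z0\<bar> \<ge> d\<close> violates it.\<close>

lemma infinitely_many_near:
  assumes m: "\<And>i. \<forall>k<l. \<alpha> (m i + k) = \<beta> k" "\<And>i. even (m i) = p" "\<And>i::nat. m i + l < m (Suc i)"
    and c: "c 0 = 0" "\<And>n. n \<ge> l \<Longrightarrow> c n = 0" "nsq (defect \<beta> s z0 c) < d\<^sup>2 * nsq c" and d: "0 < d"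
  shows "infinite (circle_support \<nu> \<inter> ball z0 d)"
proof
  assume fin: "finite (circle_support \<nu> \<inter> ball z0 d)" (is "finite ?S")
  let ?I = "{..card ?S}"
  define s' where "s' = (s = p)"
  have fc: "finsupp c" unfolding finsupp_def using c(2) by blast
  have su_mult: "i < j \<Longrightarrow> m i + l < m j" for i j
  proof (induction j)
    case (Suc j)
    then show ?case using m(3)[of j] by (cases "i = j") auto
  qed simp
  have sep: "i \<noteq> j \<Longrightarrow> m i + l < m j \<or> m j + l < m i" for i j using su_mult[of i j] su_mult[of j i] by linarith
  have "\<exists>f. rep \<alpha> f (test_coords s' (translate (m i) c))" for i
  proof -
    have "finsupp (test_coords s' (translate (m i) c))" using fc by (simp add: test_coords_def)
    then show ?thesis using rep_surj by blast
  qed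
  then obtain f where f: "\<And>i. rep \<alpha> (f i) (test_coords s' (translate (m i) c))" by metis
  obtain t where t: "\<exists>i\<in>?I. t i \<noteq> 0" "\<forall>z\<in>?S. (\<Sum>i\<in>?I. t i * f i z) = 0"
    using linear_dependence[OF fin, of ?I f] by auto
  let ?F = "\<lambda>z. \<Sum>i\<in>?I. t i * f i z" and ?c = "\<lambda>n. \<Sum>i\<in>?I. t i * translate (m i) c n"
  have F: "rep \<alpha> ?F (test_coords s' ?c)" unfolding test_coords_sum by (intro rep_sum rep_scale f)
  have fcc: "finsupp ?c" by (intro finsupp_sum finsupp_scale finsupp_translate fc)
  have T: "0 < (\<Sum>i\<in>?I. (cmod (t i))\<^sup>2)"
  proof -
    obtain k where "k \<in> ?I" "t k \<noteq> 0" using t(1) by blast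
    then show ?thesis by (intro sum_pos2[of _ k]) auto
  qed
  have r: "defect \<alpha> s' z0 (translate (m i) c) = translate (m i) (defect \<beta> s z0 c)" for i
    unfolding s'_def using defect_translate[of l \<alpha> "m i" \<beta> c s z0] m(1,2)[of i] c by simp
  have "nsq (defect \<alpha> s' z0 ?c) = (\<Sum>i\<in>?I. (cmod (t i))\<^sup>2) * nsq (defect \<beta> s z0 c)"
    unfolding defect_sum r by (rule nsq_separated[where l = l]) (use sep defect_bound[of l c _ \<beta> s z0] c(2) in auto)
  also have "\<dots> < (\<Sum>i\<in>?I. (cmod (t i))\<^sup>2) * (d\<^sup>2 * nsq c)" using T c(3) by (rule mult_strict_left_mono[rotated])
  also have "\<dots> = d\<^sup>2 * nsq ?c"
    by (subst nsq_separated[where l = l]) (use sep c(2) in auto)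
  finally have less: "nsq (defect \<alpha> s' z0 ?c) < d\<^sup>2 * nsq ?c" .
  have cF: "continuous_on (sphere 0 1) ?F" by (rule rep_continuous[OF F])
  have "d\<^sup>2 * nsq ?c = (LINT z|\<nu>. d\<^sup>2 * (cmod (?F z))\<^sup>2)" using test_function(1)[OF fcc F] by simp
  also have "\<dots> \<le> (LINT z|\<nu>. (cmod ((z - z0) * ?F z))\<^sup>2)"
  proof (rule integral_mono_AE)
    show "integrable \<nu> (\<lambda>z. d\<^sup>2 * (cmod (?F z))\<^sup>2)" "integrable \<nu> (\<lambda>z. (cmod ((z - z0) * ?F z))\<^sup>2)"
      by (intro integrable_continuous continuous_intros cF)+
    show "AE z in \<nu>. d\<^sup>2 * (cmod (?F z))\<^sup>2 \<le> (cmod ((z - z0) * ?F z))\<^sup>2"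
      using AE_support
    proof eventually_elim
      case (elim z)
      show ?case
      proof (cases "z \<in> ball z0 d")
        case True
        then have "?F z = 0" using elim t(2) by blast
        then show ?thesis by simp
      next
        case False
        then have "d \<le> cmod (z - z0)" by (simp add: dist_norm norm_minus_commute)
        then have "d\<^sup>2 \<le> (cmod (z - z0))\<^sup>2" using d by (intro power_mono) auto
        then show ?thesis unfolding norm_mult power_mult_distrib by (rule mult_right_mono) simp
      qed
    qed
  qed
  also have "\<dots> = nsq (defect \<alpha> s' z0 ?c)" by (rule test_function(2)[OF fcc F])
  finally show False using less by simp
qed

text \<open>Infinitely many of the occurrences have the same parity, so that one form of the defect serves all
  of them; from these a sequence of separated windows is selected.\<close>

theorem ess_near:
  assumes det: "detects l \<beta> z0 d" and d: "0 < d"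
    and occ: "\<And>m0. \<exists>m\<ge>m0. \<forall>k<l. \<alpha> (m + k) = \<beta> k"
  shows "\<exists>z\<in>ess (circle_support \<nu>). dist z0 z \<le> d"
proof -
  obtain s c where c: "c 0 = 0" "\<And>n. n \<ge> l \<Longrightarrow> c n = 0" "nsq (defect \<beta> s z0 c) < d\<^sup>2 * nsq c"
    using det by (auto simp: detects_def)
  have "\<exists>p. \<forall>m0. \<exists>m\<ge>m0. (\<forall>k<l. \<alpha> (m + k) = \<beta> k) \<and> even m = p"
  proof (rule ccontr)
    assume "\<not> ?thesis"
    then obtain a b where "\<forall>m\<ge>a. (\<forall>k<l. \<alpha> (m + k) = \<beta> k) \<longrightarrow> odd m" "\<forall>m\<ge>b. (\<forall>k<l. \<alpha> (m + k) = \<beta> k) \<longrightarrow> even m"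
      by (metis (full_types))
    moreover obtain m where "m \<ge> max a b" "\<forall>k<l. \<alpha> (m + k) = \<beta> k" using occ by blast
    ultimately show False by auto
  qed
  then obtain p where p: "\<And>m0. \<exists>m\<ge>m0. (\<forall>k<l. \<alpha> (m + k) = \<beta> k) \<and> even m = p" by blast
  have "\<exists>m. \<forall>i. ((\<forall>k<l. \<alpha> (m i + k) = \<beta> k) \<and> even (m i) = p) \<and> m i + l < m (Suc i)"
  proof (rule dependent_nat_choice)
    show "\<exists>x. (\<forall>k<l. \<alpha> (x + k) = \<beta> k) \<and> even x = p" using p[of 0] by blast
    show "\<exists>y. ((\<forall>k<l. \<alpha> (y + k) = \<beta> k) \<and> even y = p) \<and> x + l < y" for x
      using p[of "x + l + 1"] by (metis Suc_eq_plus1 Suc_le_lessD)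
  qed
  then obtain m where m: "\<And>i. \<forall>k<l. \<alpha> (m i + k) = \<beta> k" "\<And>i. even (m i) = p" "\<And>i. m i + l < m (Suc i)" by blast
  have inf: "infinite (circle_support \<nu> \<inter> ball z0 d)"
    by (rule infinitely_many_near[where m = m and l = l and \<beta> = \<beta> and p = p and c = c and s = s]) (rule m c d; assumption?)+
  have "circle_support \<nu> \<inter> ball z0 d \<subseteq> cball z0 d" by auto
  then obtain x where x: "x \<in> cball z0 d" "x islimpt (circle_support \<nu> \<inter> ball z0 d)"
    using compact_cball[of z0 d] inf unfolding compact_eq_Bolzano_Weierstrass by blast
  then have "x islimpt circle_support \<nu>" by (rule_tac islimpt_subset[OF x(2)]) auto
  then show ?thesis using x(1) ess_closed_iff[OF closed_circle_support] by auto
qed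

lemma integral_pos_support:
  fixes h :: "complex \<Rightarrow> real"
  assumes h: "continuous_on (sphere 0 1) h" "\<And>z. h z \<ge> 0" and z1: "z1 \<in> circle_support \<nu>" "h z1 > 0"
  shows "(LINT z|\<nu>. h z) > 0"
proof -
  have i: "integrable \<nu> h" by (rule integrable_continuous[OF h(1)])
  have "z1 \<in> sphere 0 1" using z1(1) circle_support_sphere by blast
  then obtain e where e: "e > 0" "\<And>z. z \<in> sphere 0 1 \<Longrightarrow> dist z z1 < e \<Longrightarrow> dist (h z) (h z1) < h z1"
    using h(1) z1(2) unfolding continuous_on_iff by metis
  have pos: "emeasure \<nu> (ball z1 e \<inter> sphere 0 1) > 0"
    using z1(1) e(1) unfolding circle_support_def by simp
  have "(LINT z|\<nu>. h z) \<noteq> 0"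
  proof
    assume "(LINT z|\<nu>. h z) = 0"
    then have "AE z in \<nu>. h z = 0" using integral_nonneg_eq_0_iff_AE[OF i] h(2) by simp
    then have "AE z in \<nu>. z \<notin> ball z1 e \<inter> sphere 0 1"
    proof eventually_elim
      case (elim z)
      then show ?case using e(2)[of z] by (auto simp: dist_commute dist_real_def)
    qed
    then have "emeasure \<nu> (ball z1 e \<inter> sphere 0 1) = 0"
      by (subst (asm) AE_iff_measurable[OF open_sets_nu[OF open_ball]]) auto
    then show False using pos by simp
  qed
  moreover have "(LINT z|\<nu>. h z) \<ge> 0" by (rule Bochner_Integration.integral_nonneg) (use h(2) in auto)
  ultimately show ?thesis by linarith
qed

text \<open>Conversely, near a non-isolated point there are two points of the support, hence two disjoint bumps
  and a combination \<open>g\<close> of them with integral 0. Subtracting its mean from a Laurent polynomial close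
  to \<open>g\<close> yields coordinates \<open>c'\<close> with \<open>c' 0 = 0\<close>, as a test vector needs.\<close>

theorem detect_at_ess:
  assumes z0: "z0 \<in> ess (circle_support \<nu>)" and d: "0 < d"
  shows "\<exists>l. detects l \<alpha> z0 d"
proof -
  let ?S = "circle_support \<nu>"
  have lim: "z0 islimpt ?S" using z0 ess_closed_iff[OF closed_circle_support] by blast
  have z0S: "z0 \<in> ?S" using z0 by (simp add: ess_def)
  then have nz0: "cmod z0 = 1" using circle_support_sphere by (force simp: subset_iff)
  obtain z2 where z2: "z2 \<in> ?S" "z2 \<noteq> z0" "dist z2 z0 < d / 8"
    using lim d unfolding islimpt_approachable by (meson divide_pos_pos zero_less_numeral)
  define r where "r = dist z2 z0 / 2"
  have r: "0 < r" using z2(2) by (simp add: r_def)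
  have r8: "r < d / 8" using z2(3) zero_le_dist[of z2 z0] unfolding r_def by linarith
  define hat where "hat w z = max 0 (1 - dist z w / r)" for w z :: complex
  have chat: "continuous_on X (hat w)" for X w unfolding hat_def using r by (intro continuous_intros) auto
  have hat0: "hat w z \<ge> 0" for w z by (simp add: hat_def)
  have hatw: "hat w w = 1" for w by (simp add: hat_def)
  have hatz: "hat w z = 0" if "dist z w \<ge> r" for w z using that r by (simp add: hat_def)
  define a b where "a = (LINT z|\<nu>. hat z0 z)" and "b = (LINT z|\<nu>. hat z2 z)"
  have ab: "a > 0" "b > 0" unfolding a_def b_def
    by (rule integral_pos_support[OF chat hat0 z0S], simp add: hatw)
      (rule integral_pos_support[OF chat hat0 z2(1)], simp add: hatw)
  define g where "g z = b * hat z0 z - a * hat z2 z" for z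
  have cg: "continuous_on X g" for X unfolding g_def by (intro continuous_intros chat)
  have ig: "(LINT z|\<nu>. g z) = 0" unfolding g_def
    by (subst Bochner_Integration.integral_diff) (auto intro!: integrable_mult_right integrable_continuous chat simp: a_def b_def)
  have gz: "g z = 0" if "dist z z0 \<ge> d / 4" for z
  proof -
    have "dist z z0 \<ge> r" using that r8 d by linarith
    moreover have "dist z z2 \<ge> r" using that r8 z2(3) dist_triangle[of z z0 z2] by linarith
    ultimately show ?thesis by (simp add: g_def hatz)
  qed
  define J where "J = (LINT z|\<nu>. (g z)\<^sup>2)"
  have "g z0 = b" using hatz[of z0 z2] r by (simp add: g_def hatw r_def dist_commute)
  then have J: "J > 0" unfolding J_def
    by (intro integral_pos_support[of _ z0] continuous_intros cg z0S) (use ab in auto)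
  \<comment> \<open>chosen for \<open>e\<^sup>2 * (32 + 8 * d\<^sup>2) \<le> d\<^sup>2 * J / 4\<close>, the margin between the two bounds below\<close>
  define X where "X = d\<^sup>2 * J / (4 * (32 + 8 * d\<^sup>2))"
  have X: "X > 0" unfolding X_def using d J by (intro divide_pos_pos mult_pos_pos) (auto intro: add_pos_nonneg)
  \<comment> \<open>\<open>e \<le> 1\<close> gives \<open>e\<^sup>2 \<le> e \<le> X\<close>\<close>
  define e where "e = min 1 X"
  have e: "0 < e" "e\<^sup>2 \<le> X" 
  proof -
    show "0 < e" using X by (simp add: e_def)
    then have "e * e \<le> 1 * X" by (intro mult_mono) (auto simp: e_def X less_imp_le)
    then show "e\<^sup>2 \<le> X" by (simp add: power2_eq_square)
  qed
  obtain f c where f: "rep \<alpha> f c" "\<And>z. cmod z = 1 \<Longrightarrow> cmod (f z - of_real (g z)) < e"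
    using rep_dense[of "\<lambda>z. complex_of_real (g z)", OF _ e(1)] cg by (metis continuous_on_of_real)
  have cf: "continuous_on (sphere 0 1) f" by (rule rep_continuous[OF f(1)])
  define k where "k = (LINT z|\<nu>. f z)"
  have k: "cmod k \<le> e"
  proof -
    have "k = (LINT z|\<nu>. f z - of_real (g z))" unfolding k_def
      by (subst Bochner_Integration.integral_diff) (auto intro!: integrable_continuous cf continuous_intros cg simp: ig)
    also have "cmod \<dots> \<le> (LINT z|\<nu>. cmod (f z - of_real (g z)))" by (rule integral_norm_bound)
    also have "\<dots> \<le> e"
    proof (rule integral_le_const)
      show "integrable \<nu> (\<lambda>z. cmod (f z - of_real (g z)))" by (intro integrable_continuous continuous_intros cf cg)
      show "AE z in \<nu>. cmod (f z - of_real (g z)) \<le> e" using f(2) by (intro AE_I2) (simp add: less_imp_le)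
    qed
    finally show ?thesis .
  qed
  define F where "F z = f z - k" for z
  define c' where "c' = (\<lambda>n. c n - k * bvec 0 n)"
  have F: "rep \<alpha> F c'" using rep_diff[OF f(1) rep_scale[OF rep_1, of \<alpha> k]] unfolding F_def c'_def by simp
  have fc': "finsupp c'" by (rule rep_finsupp[OF F])
  have "k = ip c (bvec 0)" using rep_ip[OF f(1) rep_1] by (simp add: k_def)
  then have "k = c 0" using rep_finsupp[OF f(1)] by (simp add: ip_bvec_right)
  then have c'0: "c' 0 = 0" by (simp add: c'_def bvec_def)
  obtain l where l: "\<forall>n\<ge>l. c' n = 0" using fc' by (auto simp: finsupp_def)
  have Fg: "cmod (F z - of_real (g z)) \<le> 2 * e" if "cmod z = 1" for z
  proof -
    have "F z - of_real (g z) = (f z - of_real (g z)) - k" by (simp add: F_def)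
    then have "cmod (F z - of_real (g z)) \<le> cmod (f z - of_real (g z)) + cmod k"
      by (simp only: norm_triangle_ineq4)
    then show ?thesis using f(2)[OF that] k by linarith
  qed
  have cF: "continuous_on (sphere 0 1) F" by (rule rep_continuous[OF F])
  have sq: "(cmod u)\<^sup>2 \<le> 2 * (cmod v)\<^sup>2 + 2 * (cmod (u - v))\<^sup>2" for u v :: complex
  proof -
    have "cmod u \<le> cmod v + cmod (u - v)" using norm_triangle_ineq[of v "u - v"] by simp
    then have "(cmod u)\<^sup>2 \<le> (cmod v + cmod (u - v))\<^sup>2" by (intro power_mono) auto
    also have "\<dots> \<le> 2 * (cmod v)\<^sup>2 + 2 * (cmod (u - v))\<^sup>2"
      using zero_le_power2[of "cmod v - cmod (u - v)"] by (simp add: power2_eq_square algebra_simps)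
    finally show ?thesis .
  qed
  have lower: "J / 2 - 4 * e\<^sup>2 \<le> nsq c'"
  proof -
    have "J \<le> (LINT z|\<nu>. 2 * (cmod (F z))\<^sup>2 + 8 * e\<^sup>2)" unfolding J_def
    proof (rule integral_mono)
      fix z assume "z \<in> space \<nu>"
      then have z: "cmod z = 1" by simp
      have "(cmod (of_real (g z) - F z))\<^sup>2 \<le> (2 * e)\<^sup>2"
        using Fg[OF z] by (intro power_mono) (auto simp: norm_minus_commute)
      then show "(g z)\<^sup>2 \<le> 2 * (cmod (F z))\<^sup>2 + 8 * e\<^sup>2"
        using sq[of "of_real (g z)" "F z"] by (simp add: power_mult_distrib)
    qed (intro integrable_continuous continuous_intros cF cg)+
    also have "\<dots> = 2 * nsq c' + 8 * e\<^sup>2"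
      by (subst Bochner_Integration.integral_add)
        (auto intro!: integrable_continuous continuous_intros cF simp: rep_nsq[OF F] prob_space[simplified])
    finally show ?thesis by simp
  qed
  have upper: "nsq (defect \<alpha> True z0 c') \<le> d\<^sup>2 * J / 8 + 32 * e\<^sup>2"
  proof -
    have "nsq (defect \<alpha> True z0 c') = (LINT z|\<nu>. (cmod ((z - z0) * F z))\<^sup>2)"
      using test_function(2)[OF fc', of F True z0] F by (simp add: test_coords_def)
    also have "\<dots> \<le> (LINT z|\<nu>. d\<^sup>2 / 8 * (g z)\<^sup>2 + 32 * e\<^sup>2)"
    proof (rule integral_mono)
      fix z assume "z \<in> space \<nu>"
      then have z: "cmod z = 1" by simp
      have 1: "(cmod (F z - of_real (g z)))\<^sup>2 \<le> (2 * e)\<^sup>2"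
        using Fg[OF z] by (intro power_mono) auto
      have "cmod (z - z0) \<le> 2" using norm_triangle_ineq4[of z z0] z nz0 by simp
      then have 2: "(cmod (z - z0))\<^sup>2 \<le> 2\<^sup>2" by (intro power_mono) auto
      have 3: "(cmod (z - z0))\<^sup>2 * (g z)\<^sup>2 \<le> (d / 4)\<^sup>2 * (g z)\<^sup>2"
      proof (cases "dist z z0 \<ge> d / 4")
        case False
        then have "(cmod (z - z0))\<^sup>2 \<le> (d / 4)\<^sup>2" by (intro power_mono) (auto simp: dist_norm)
        then show ?thesis by (rule mult_right_mono) simp
      qed (simp add: gz)
      have "(cmod ((z - z0) * F z))\<^sup>2 = (cmod (z - z0))\<^sup>2 * (cmod (F z))\<^sup>2" by (simp add: norm_mult power_mult_distrib)
      also have "\<dots> \<le> (cmod (z - z0))\<^sup>2 * (2 * (g z)\<^sup>2 + 2 * (2 * e)\<^sup>2)"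
        using sq[of "F z" "of_real (g z)"] 1 by (intro mult_left_mono) auto
      also have "\<dots> = 2 * ((cmod (z - z0))\<^sup>2 * (g z)\<^sup>2) + (cmod (z - z0))\<^sup>2 * (8 * e\<^sup>2)" by (simp add: algebra_simps)
      also have "\<dots> \<le> 2 * ((d / 4)\<^sup>2 * (g z)\<^sup>2) + 2\<^sup>2 * (8 * e\<^sup>2)"
        by (intro add_mono mult_left_mono 3 mult_right_mono 2) auto
      also have "\<dots> = d\<^sup>2 / 8 * (g z)\<^sup>2 + 32 * e\<^sup>2" by (simp add: power2_eq_square)
      finally show "(cmod ((z - z0) * F z))\<^sup>2 \<le> d\<^sup>2 / 8 * (g z)\<^sup>2 + 32 * e\<^sup>2" .
    qed (intro integrable_continuous continuous_intros cF cg)+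
    also have "\<dots> = d\<^sup>2 / 8 * J + 32 * e\<^sup>2"
      by (subst Bochner_Integration.integral_add)
        (auto intro!: integrable_continuous continuous_intros cg simp: J_def prob_space[simplified])
    finally show ?thesis by simp
  qed
  have "e\<^sup>2 * (32 + 8 * d\<^sup>2) \<le> X * (32 + 8 * d\<^sup>2)" using e(2) by (intro mult_right_mono) auto
  also have "\<dots> = d\<^sup>2 * J / 4"
  proof -
    have "32 + 8 * d\<^sup>2 \<noteq> 0" using zero_le_power2[of d] by linarith
    then show ?thesis by (simp add: X_def field_simps)
  qed
  finally have "32 * e\<^sup>2 + 8 * (d\<^sup>2 * e\<^sup>2) \<le> d\<^sup>2 * J / 4" by (simp add: algebra_simps)
  moreover have "d\<^sup>2 * (J / 2 - 4 * e\<^sup>2) \<le> d\<^sup>2 * nsq c'" using lower by (intro mult_left_mono) auto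
  moreover have "d\<^sup>2 * (J / 2 - 4 * e\<^sup>2) = d\<^sup>2 * J / 2 - 4 * (d\<^sup>2 * e\<^sup>2)" by (simp add: algebra_simps)
  moreover have "0 < d\<^sup>2 * J" "0 \<le> d\<^sup>2 * e\<^sup>2" using d J by auto
  ultimately have "nsq (defect \<alpha> True z0 c') < d\<^sup>2 * nsq c'" using upper by linarith
  then show ?thesis using c'0 l by (auto simp: detects_def)
qed

end

text \<open>Windows of \<open>\<alpha>\<close> that certify spectrum recur in \<open>\<beta>\<close>, and the set on the right is closed.\<close>

theorem ess_subset:
  assumes a: "\<And>n. cmod (\<alpha> n) < 1" "\<And>n. cmod (\<beta> n) < 1"
    and occ: "\<And>l m0. \<exists>m\<ge>m0. \<forall>k<l. \<beta> (m + k) = \<alpha> k"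
  shows "ess (circle_support (verblunsky_measure \<alpha>)) \<subseteq> ess (circle_support (verblunsky_measure \<beta>))"
proof
  interpret va: verblunsky \<alpha> by unfold_locales (rule a)
  interpret vb: verblunsky \<beta> by unfold_locales (rule a)
  interpret A: spectral \<alpha> "verblunsky_measure \<alpha>" by (rule va.spectral_verblunsky_measure)
  interpret vB: spectral \<beta> "verblunsky_measure \<beta>" by (rule vb.spectral_verblunsky_measure)
  fix z assume z: "z \<in> ess (circle_support (verblunsky_measure \<alpha>))"
  let ?E = "ess (circle_support (verblunsky_measure \<beta>))"
  have "\<exists>y\<in>?E. dist y z < e" if e: "e > 0" for e
  proof -
    obtain l where "detects l \<alpha> z (e / 2)" using A.detect_at_ess[OF z, of "e / 2"] e by auto
    then obtain y where "y \<in> ?E" "dist z y \<le> e / 2" using vB.ess_near[of l \<alpha> z "e / 2"] e occ by auto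
    then show ?thesis using e by (intro bexI[of _ y]) (auto simp: dist_commute)
  qed
  then have "z \<in> closure ?E" by (simp add: closure_approachable)
  then show "z \<in> ?E" using closed_ess[OF closed_circle_support] by simp
qed

section \<open>Transfer matrices\<close>

text \<open>The matrix with rows \<open>(a, b)\<close> and \<open>(cnj b, cnj a)\<close> is stored as \<open>(a, b)\<close>. The Szego transfer matrix at
  \<open>z = \<zeta>\<^sup>2\<close>, divided by \<open>\<zeta>\<close>, has this form and determinant 1, so it is elliptic exactly if the real
  part of \<open>a\<close>, which is half of the trace, has modulus less than 1.\<close>

definition su_mult :: "complex \<times> complex \<Rightarrow> complex \<times> complex \<Rightarrow> complex \<times> complex" where
  "su_mult A C = (fst A * fst C + snd A * cnj (snd C), fst A * snd C + snd A * cnj (fst C))"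

definition su_act :: "complex \<times> complex \<Rightarrow> complex \<times> complex \<Rightarrow> complex \<times> complex" where
  "su_act A v = (fst A * fst v + snd A * snd v, cnj (snd A) * fst v + cnj (fst A) * snd v)"

definition szego :: "complex \<Rightarrow> complex \<Rightarrow> complex \<times> complex" where
  "szego \<zeta> a = (\<zeta> / rho a, - cnj a * cnj \<zeta> / rho a)"

fun mon :: "complex \<Rightarrow> complex list \<Rightarrow> complex \<times> complex" where
  "mon \<zeta> [] = (1, 0)"
| "mon \<zeta> (x # w) = su_mult (mon \<zeta> w) (szego \<zeta> x)"

lemma su_mult_assoc: "su_mult (su_mult A C) D = su_mult A (su_mult C D)"
  by (simp add: su_mult_def algebra_simps)

lemma su_act_mult: "su_act (su_mult A C) v = su_act A (su_act C v)"
  by (simp add: su_mult_def su_act_def algebra_simps)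

lemma su_mult_1: "su_mult A (1, 0) = A" by (simp add: su_mult_def)

lemma mon_append: "mon \<zeta> (u @ v) = su_mult (mon \<zeta> v) (mon \<zeta> u)"
  by (induction u) (simp_all add: su_mult_1 su_mult_assoc)

definition su_det :: "complex \<times> complex \<Rightarrow> complex" where
  "su_det A = fst A * cnj (fst A) - snd A * cnj (snd A)"

lemma su_det_mult: "su_det (su_mult A C) = su_det A * su_det C"
  by (simp add: su_mult_def su_det_def algebra_simps)

lemma su_det_szego:
  assumes "cmod \<zeta> = 1" "cmod a < 1" shows "su_det (szego \<zeta> a) = 1"
proof -
  have z: "\<zeta> * cnj \<zeta> = 1" using assms(1) by (simp add: complex_norm_square[symmetric])
  have r: "complex_of_real (rho a) \<noteq> 0" using rho_pos[OF assms(2)] by simp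
  have "su_det (szego \<zeta> a) = (\<zeta> * cnj \<zeta>) * (1 - a * cnj a) / (complex_of_real (rho a) * complex_of_real (rho a))"
    by (simp add: su_det_def szego_def diff_divide_distrib[symmetric] algebra_simps)
  then show ?thesis using r by (simp add: z rho_sq[OF assms(2), symmetric])
qed

lemma su_det_mon:
  assumes "cmod \<zeta> = 1" "\<And>x. x \<in> set w \<Longrightarrow> cmod x < 1" shows "su_det (mon \<zeta> w) = 1"
  using assms(2)
proof (induction w)
  case Nil
  then show ?case by (simp add: su_det_def)
next
  case (Cons x w)
  then show ?case by (simp add: su_det_mult su_det_szego[OF assms(1)])
qed

lemma elliptic_eigenvector:
  assumes "su_det A = 1" "\<bar>Re (fst A)\<bar> < 1"
  shows "\<exists>v \<mu>. cmod \<mu> = 1 \<and> v \<noteq> (0, 0) \<and> su_act A v = (\<mu> * fst v, \<mu> * snd v)"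
proof (cases "snd A = 0")
  case True
  have "cmod (fst A) = 1"
  proof -
    have "complex_of_real ((cmod (fst A))\<^sup>2) = 1" using assms(1) True unfolding complex_norm_square su_det_def by simp
    then have "(cmod (fst A))\<^sup>2 = 1" using of_real_eq_1_iff by blast
    then show ?thesis by (simp add: power2_eq_1_iff) (metis norm_ge_zero neg_0_le_iff_le not_one_le_zero)
  qed
  then show ?thesis using True by (intro exI[of _ "(1, 0)"] exI[of _ "fst A"]) (simp add: su_act_def)
next
  case False
  let ?x = "Re (fst A)"
  have x2: "?x\<^sup>2 < 1" using assms(2) by (simp add: abs_square_less_1)
  define \<mu> where "\<mu> = Complex ?x (sqrt (1 - ?x\<^sup>2))"
  have mu: "cmod \<mu> = 1" using x2 by (simp add: \<mu>_def cmod_def)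
  \<comment> \<open>the characteristic equation\<close>
  have m2: "\<mu> * \<mu> = (fst A + cnj (fst A)) * \<mu> - 1"
  proof -
    have "sqrt (1 - ?x\<^sup>2) * sqrt (1 - ?x\<^sup>2) = 1 - ?x\<^sup>2" using x2 by simp
    then show ?thesis by (simp add: \<mu>_def complex_eq_iff power2_eq_square)
  qed
  have "cnj (snd A) * snd A + cnj (fst A) * (\<mu> - fst A) = \<mu> * (\<mu> - fst A)"
    using assms(1) m2 unfolding su_det_def by (simp add: algebra_simps)
  then show ?thesis using False mu
    by (intro exI[of _ "(snd A, \<mu> - fst A)"] exI[of _ \<mu>]) (simp add: su_act_def algebra_simps)
qed

text \<open>The square root \<open>\<zeta>\<close> of \<open>z = cis \<theta>\<close> is chosen as \<open>cis (\<theta> / 2)\<close>; the other choice changes at most the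
  sign of the trace.\<close>

definition elliptic :: "complex list \<Rightarrow> real set" where
  "elliptic w = {\<theta>. 0 \<le> \<theta> \<and> \<theta> < 2 * pi \<and> \<bar>Re (fst (mon (cis (\<theta> / 2)) w))\<bar> < 1}"

section \<open>Approximate eigenvectors from powers of a word\<close>

locale periodic_solution =
  fixes w :: "complex list" and \<zeta> \<mu> :: complex and v0 :: "complex \<times> complex"
  assumes wne: "w \<noteq> []" and wdisk: "\<And>x. x \<in> set w \<Longrightarrow> cmod x < 1"
    and zeta: "cmod \<zeta> = 1" and mu: "cmod \<mu> = 1" and v0: "v0 \<noteq> (0, 0)"
    and eig: "su_act (mon \<zeta> w) v0 = (\<mu> * fst v0, \<mu> * snd v0)"
begin

definition \<beta> :: "nat \<Rightarrow> complex" where "\<beta> n = w ! (n mod length w)"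

fun v :: "nat \<Rightarrow> complex \<times> complex" where
  "v 0 = v0" | "v (Suc n) = su_act (szego \<zeta> (\<beta> n)) (v n)"

definition X :: "nat \<Rightarrow> complex" where "X n = fst (v n)"
definition Y :: "nat \<Rightarrow> complex" where "Y n = snd (v n)"

lemma beta_disk: "cmod (\<beta> n) < 1"
  unfolding \<beta>_def using wne by (intro wdisk nth_mem) simp

lemma v_mon: "v n = su_act (mon \<zeta> (map \<beta> [0..<n])) v0"
proof (induction n)
  case 0
  then show ?case by (simp add: su_act_def)
next
  case (Suc n)
  have "mon \<zeta> (map \<beta> [0..<Suc n]) = su_mult (szego \<zeta> (\<beta> n)) (mon \<zeta> (map \<beta> [0..<n]))"
    by (simp add: mon_append su_mult_def)
  then show ?case using Suc by (simp add: su_act_mult)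
qed

lemma v_period: "v (n + length w) = (\<mu> * X n, \<mu> * Y n)"
proof (induction n)
  case 0
  have "map \<beta> [0..<length w] = w" by (rule nth_equalityI) (auto simp: \<beta>_def)
  then show ?case using eig by (simp add: v_mon[of "length w"] X_def Y_def)
next
  case (Suc n)
  have "\<beta> (n + length w) = \<beta> n" by (simp add: \<beta>_def)
  then show ?case using Suc by (simp add: X_def Y_def su_act_def algebra_simps)
qed

lemma zeta_cnj: "\<zeta> * cnj \<zeta> = 1" "cnj \<zeta> * \<zeta> = 1" using zeta by (simp_all add: complex_norm_square[symmetric] mult.commute)

lemma rho_nz: "complex_of_real (rho (\<beta> n)) \<noteq> 0" using rho_pos[OF beta_disk] by (metis less_irrefl of_real_eq_0_iff)

lemma forward: "rho (\<beta> n) * X (Suc n) = \<zeta> * X n - cnj (\<beta> n) * cnj \<zeta> * Y n"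
  "rho (\<beta> n) * Y (Suc n) = - \<beta> n * \<zeta> * X n + cnj \<zeta> * Y n"
  using rho_nz[of n] by (simp_all add: X_def Y_def su_act_def szego_def field_simps)

lemma backward: "rho (\<beta> n) * X n = cnj \<zeta> * X (Suc n) + cnj (\<beta> n) * cnj \<zeta> * Y (Suc n)"
  "rho (\<beta> n) * Y n = \<beta> n * \<zeta> * X (Suc n) + \<zeta> * Y (Suc n)"
proof -
  let ?r = "complex_of_real (rho (\<beta> n))"
  note r = rho_sq[OF beta_disk, of n]
  have "?r * (?r * X n) = (1 - \<beta> n * cnj (\<beta> n)) * X n" using r by (metis mult.assoc)
  also have "\<dots> = (cnj \<zeta> * \<zeta>) * X n - \<beta> n * cnj (\<beta> n) * (cnj \<zeta> * \<zeta>) * X n" by (simp add: zeta_cnj algebra_simps)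
  also have "\<dots> = cnj \<zeta> * (\<zeta> * X n - cnj (\<beta> n) * cnj \<zeta> * Y n) + cnj (\<beta> n) * cnj \<zeta> * (- \<beta> n * \<zeta> * X n + cnj \<zeta> * Y n)"
    by (simp add: algebra_simps)
  also have "\<dots> = ?r * (cnj \<zeta> * X (Suc n) + cnj (\<beta> n) * cnj \<zeta> * Y (Suc n))"
    unfolding forward[symmetric] by (simp add: algebra_simps)
  finally show "?r * X n = cnj \<zeta> * X (Suc n) + cnj (\<beta> n) * cnj \<zeta> * Y (Suc n)" using rho_nz[of n] by simp
  have "?r * (?r * Y n) = (1 - \<beta> n * cnj (\<beta> n)) * Y n" using r by (metis mult.assoc)
  also have "\<dots> = (\<zeta> * cnj \<zeta>) * Y n - \<beta> n * cnj (\<beta> n) * (\<zeta> * cnj \<zeta>) * Y n" by (simp add: zeta_cnj algebra_simps)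
  also have "\<dots> = \<beta> n * \<zeta> * (\<zeta> * X n - cnj (\<beta> n) * cnj \<zeta> * Y n) + \<zeta> * (- \<beta> n * \<zeta> * X n + cnj \<zeta> * Y n)"
    by (simp add: algebra_simps)
  also have "\<dots> = ?r * (\<beta> n * \<zeta> * X (Suc n) + \<zeta> * Y (Suc n))"
    unfolding forward[symmetric] by (simp add: algebra_simps)
  finally show "?r * Y n = \<beta> n * \<zeta> * X (Suc n) + \<zeta> * Y (Suc n)" using rho_nz[of n] by simp
qed

text \<open>The components of the Szego solution, taken alternately, solve the eigenvalue equation of the CMV
  matrix; the factor \<open>cnj \<zeta>\<close> undoes the normalisation of the transfer matrices.\<close>

definition c :: "nat \<Rightarrow> complex" where
  "c n = (if even n then X n else cnj \<zeta> * Y n)"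

lemma defect_solution: assumes "n \<ge> 1" shows "defect \<beta> True (\<zeta> * \<zeta>) c n = 0"
proof -
  obtain k where n: "n = Suc k" using assms by (cases n) auto
  show ?thesis
  proof (cases "even n")
    case True
    have "blk \<beta> False c n = - \<beta> k * X n + cnj \<zeta> * (rho (\<beta> k) * Y k)"
      using True by (simp add: blk_def tridiag_def dg_def od_def c_def n)
    also have "\<dots> = - \<beta> k * X n + (cnj \<zeta> * \<zeta>) * (\<beta> k * X n + Y n)"
      unfolding backward n by (simp add: algebra_simps)
    also have "\<dots> = Y n" by (simp add: zeta_cnj)
    finally have 1: "blk \<beta> False c n = Y n" .
    have "blk_adj \<beta> True c n = \<beta> n * X n + cnj \<zeta> * (rho (\<beta> n) * Y (Suc n))"
      using True by (simp add: blk_adj_def tridiag_def dg_def od_def c_def n)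
    also have "\<dots> = \<beta> n * X n - (cnj \<zeta> * \<zeta>) * (\<beta> n * X n) + cnj \<zeta> * cnj \<zeta> * Y n"
      unfolding forward by (simp add: algebra_simps)
    also have "\<dots> = cnj \<zeta> * cnj \<zeta> * Y n" by (simp add: zeta_cnj)
    finally have "\<zeta> * \<zeta> * blk_adj \<beta> True c n = (\<zeta> * cnj \<zeta>) * (\<zeta> * cnj \<zeta>) * Y n" by (simp add: ac_simps)
    then show ?thesis by (simp add: defect_def 1 zeta_cnj)
  next
    case False
    have "blk \<beta> False c n = cnj (\<beta> n) * (cnj \<zeta> * Y n) + rho (\<beta> n) * X (Suc n)"
      using False by (simp add: blk_def tridiag_def dg_def od_def c_def n)
    also have "\<dots> = \<zeta> * X n"
      unfolding forward by (simp add: algebra_simps)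
    finally have 1: "blk \<beta> False c n = \<zeta> * X n" .
    have "blk_adj \<beta> True c n = - cnj (\<beta> k) * (cnj \<zeta> * Y n) + rho (\<beta> k) * X k"
      using False by (simp add: blk_adj_def tridiag_def dg_def od_def c_def n)
    also have "\<dots> = cnj \<zeta> * X n"
      unfolding backward n by (simp add: algebra_simps)
    finally have 2: "blk_adj \<beta> True c n = cnj \<zeta> * X n" .
    have "\<zeta> * \<zeta> * blk_adj \<beta> True c n = (\<zeta> * cnj \<zeta>) * (\<zeta> * X n)" unfolding 2 by (simp only: mult_ac)
    then have "\<zeta> * \<zeta> * blk_adj \<beta> True c n = \<zeta> * X n" by (simp only: zeta_cnj mult_1)
    then show ?thesis by (simp only: defect_def not_True_eq_False 1 diff_self)
  qed
qed

lemma c_period: "cmod (c (n + 2 * length w)) = cmod (c n)"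
proof -
  have "v (n + 2 * length w) = (\<mu> * (\<mu> * X n), \<mu> * (\<mu> * Y n))"
    using v_period[of n] v_period[of "n + length w"] by (simp add: X_def Y_def add.assoc mult_2)
  then have "X (n + 2 * length w) = \<mu> * (\<mu> * X n)" "Y (n + 2 * length w) = \<mu> * (\<mu> * Y n)" by (simp_all add: X_def Y_def)
  then show ?thesis by (simp add: c_def norm_mult mu)
qed

lemma c_bounded: obtains S where "S \<ge> 0" "\<And>n. cmod (c n) \<le> S"
proof -
  let ?p = "2 * length w"
  let ?S = "\<Sum>i<?p. cmod (c i)"
  have "cmod (c n) = cmod (c (n mod ?p))" for n
  proof -
    have "cmod (c (i + k * ?p)) = cmod (c i)" for i k
      using c_period[of "i + j * ?p" for j] by (induction k) (simp_all add: add.assoc[symmetric] add.commute)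
    from this[of "n mod ?p" "n div ?p"] show ?thesis by (simp add: mod_mult_div_eq mult.commute)
  qed
  moreover have "cmod (c i) \<le> ?S" if "i < ?p" for i
    using that by (intro member_le_sum) auto
  moreover have "n mod ?p < ?p" for n using wne by simp
  ultimately have "cmod (c n) \<le> ?S" for n by metis
  then show ?thesis using that[of ?S] by (simp add: sum_nonneg)
qed

lemma c_sum_blocks: "(\<Sum>n<k * (2 * length w). (cmod (c n))\<^sup>2) = real k * (\<Sum>n<2 * length w. (cmod (c n))\<^sup>2)"
proof (induction k)
  case (Suc k)
  let ?p = "2 * length w"
  have per: "cmod (c (i + k * ?p)) = cmod (c i)" for i k
    using c_period[of "i + j * ?p" for j] by (induction k) (simp_all add: add.assoc[symmetric] add.commute)
  have "(\<Sum>n<Suc k * ?p. (cmod (c n))\<^sup>2) = (\<Sum>n<k * ?p. (cmod (c n))\<^sup>2) + (\<Sum>n = k * ?p..<k * ?p + ?p. (cmod (c n))\<^sup>2)"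
    by (simp add: lessThan_atLeast0 sum.atLeastLessThan_concat add.commute)
  also have "(\<Sum>n = k * ?p..<k * ?p + ?p. (cmod (c n))\<^sup>2) = (\<Sum>n = 0..<?p. (cmod (c (n + k * ?p)))\<^sup>2)"
    using sum.shift_bounds_nat_ivl[of "\<lambda>n. (cmod (c n))\<^sup>2" 0 "k * ?p" ?p] by (simp add: add.commute)
  also have "\<dots> = (\<Sum>n<?p. (cmod (c n))\<^sup>2)" by (simp only: per lessThan_atLeast0)
  finally show ?case using Suc by (simp add: algebra_simps)
qed simp

lemma c_block_pos: "0 < (\<Sum>n<2 * length w. (cmod (c n))\<^sup>2)"
proof -
  have p: "0 < 2 * length w" "1 < 2 * length w" using wne by (auto simp: Suc_lessI)
  have "c 0 \<noteq> 0 \<or> c 1 \<noteq> 0"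
  proof (rule ccontr)
    assume "\<not> ?thesis"
    then have "X 0 = 0" "Y 1 = 0" using zeta by (auto simp: c_def)
    moreover from this have "Y 0 = 0" using forward(2)[of 0] zeta by auto
    moreover have "v0 = (X 0, Y 0)" by (simp add: X_def Y_def)
    ultimately show False using v0 by simp
  qed
  then obtain i where "i < 2 * length w" "c i \<noteq> 0" using p by blast
  then show ?thesis by (intro sum_pos2[of _ i]) auto
qed

lemma coeff_bounds: "cmod (dg \<beta> s n) \<le> 1" "cmod (od \<beta> s n) \<le> 1"
proof -
  have "rho (\<beta> k) \<le> 1" for k unfolding rho_def by simp
  moreover have "rho (\<beta> k) \<ge> 0" for k using rho_pos[OF beta_disk] less_imp_le by blast
  ultimately show "cmod (od \<beta> s n) \<le> 1" by (simp add: od_def)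
  show "cmod (dg \<beta> s n) \<le> 1" using less_imp_le[OF beta_disk] by (auto simp: dg_def)
qed

lemma tridiag_norm_bound:
  assumes "\<And>n. cmod (a n) \<le> 1" "\<And>n. cmod (b n) \<le> 1" "\<And>n. cmod (u n) \<le> S"
  shows "cmod (tridiag a b u n) \<le> 3 * S"
proof -
  have S: "0 \<le> S" using assms(3)[of 0] norm_ge_zero order_trans by blast
  have m: "cmod (x * y) \<le> S" if "cmod x \<le> 1" "cmod y \<le> S" for x y
    using mult_mono[OF that] S by (simp add: norm_mult)
  have "cmod (tridiag a b u n) \<le> cmod (a n * u n) + cmod (b n * u (Suc n)) + cmod (if n = 0 then 0 else b (n - 1) * u (n - 1))"
    unfolding tridiag_def by (meson add_mono norm_triangle_ineq order_refl order_trans)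
  also have "\<dots> \<le> S + S + S"
    by (intro add_mono m assms) (auto intro!: m assms simp: S)
  finally show ?thesis by simp
qed

text \<open>The cut-off solution violates the eigenvalue equation at no more than four places next to the two
  cuts, where the violation is bounded independently of the length, whereas its norm grows with
  the number of periods.\<close>

lemma detect_power:
  assumes d: "d > 0"
  shows "\<exists>N. detects (N * length w) \<beta> (\<zeta> * \<zeta>) d"
proof -
  obtain S where S: "S \<ge> 0" "\<And>n. cmod (c n) \<le> S" using c_bounded by blast
  let ?\<kappa> = "\<Sum>n<2 * length w. (cmod (c n))\<^sup>2"
  obtain k where k: "real k * ?\<kappa> > 144 * S\<^sup>2 / d\<^sup>2 + S\<^sup>2" using reals_Archimedean3[OF c_block_pos] by blast
  have k0: "k > 0"
  proof (rule ccontr)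
    assume "\<not> k > 0"
    then have "144 * S\<^sup>2 / d\<^sup>2 + S\<^sup>2 < 0" using k by simp
    moreover have "144 * S\<^sup>2 / d\<^sup>2 + S\<^sup>2 \<ge> 0" by simp
    ultimately show False by simp
  qed
  define l where "l = k * (2 * length w)"
  have l: "l \<ge> 1" using k0 wne by (simp add: l_def Suc_leI)
  define u where "u n = (if n = 0 \<or> n \<ge> l then 0 else c n)" for n
  have uS: "cmod (u n) \<le> S" for n using S by (simp add: u_def)
  have u0: "u 0 = 0" "\<And>n. n \<ge> l \<Longrightarrow> u n = 0" by (simp_all add: u_def)
  let ?r = "defect \<beta> True (\<zeta> * \<zeta>) u"
  have rb: "cmod (?r n) \<le> 6 * S" for n
  proof -
    have 1: "cmod (blk \<beta> False u n) \<le> 3 * S" unfolding blk_def by (rule tridiag_norm_bound) (rule coeff_bounds uS)+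
    have 2: "cmod (blk_adj \<beta> True u n) \<le> 3 * S" unfolding blk_adj_def
      by (rule tridiag_norm_bound) (simp_all add: coeff_bounds uS)
    have "cmod (?r n) \<le> cmod (blk \<beta> False u n) + cmod (\<zeta> * \<zeta> * blk_adj \<beta> True u n)"
      unfolding defect_def by (simp add: norm_triangle_ineq4)
    also have "cmod (\<zeta> * \<zeta> * blk_adj \<beta> True u n) = cmod (blk_adj \<beta> True u n)" by (simp add: norm_mult zeta)
    finally show ?thesis using 1 2 by simp
  qed
  have rz: "?r n = 0" if "n \<ge> 2" "n + 1 < l" for n
  proof -
    have "u n = c n" "u (Suc n) = c (Suc n)" "u (n - 1) = c (n - 1)" using that by (auto simp: u_def)
    then have "?r n = defect \<beta> True (\<zeta> * \<zeta>) c n" using that by (simp add: defect_def blk_def blk_adj_def tridiag_def)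
    then show ?thesis using defect_solution[of n] that by simp
  qed
  have "nsq ?r = (\<Sum>n<Suc l. (cmod (?r n))\<^sup>2)"
    by (rule nsq_eq_sum) (rule defect_bound[of l u], use u0 in auto)
  also have "\<dots> = (\<Sum>n\<in>{0, 1, l - 1, l}. (cmod (?r n))\<^sup>2)"
  proof (rule sum.mono_neutral_cong_right)
    show "{0, 1, l - 1, l} \<subseteq> {..<Suc l}" using l by auto
    show "\<forall>i\<in>{..<Suc l} - {0, 1, l - 1, l}. (cmod (?r i))\<^sup>2 = 0"
    proof
      fix i assume "i \<in> {..<Suc l} - {0, 1, l - 1, l}"
      then have "i \<ge> 2" "i + 1 < l" by auto
      then show "(cmod (?r i))\<^sup>2 = 0" by (simp add: rz)
    qed
  qed auto
  also have "\<dots> \<le> (\<Sum>n\<in>{0, 1, l - 1, l}. (6 * S)\<^sup>2)"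
    by (intro sum_mono power_mono rb) auto
  also have "\<dots> \<le> 4 * (6 * S)\<^sup>2"
  proof -
    have "card {0, 1, l - 1, l} \<le> 4" by (intro card_insert_le_m1 | simp)+
    then have "real (card {0, 1, l - 1, l}) * (6 * S)\<^sup>2 \<le> 4 * (6 * S)\<^sup>2" by (intro mult_right_mono) auto
    then show ?thesis by simp
  qed
  finally have up: "nsq ?r \<le> 144 * S\<^sup>2" by (simp add: power_mult_distrib)
  have "real k * ?\<kappa> = (\<Sum>n<l. (cmod (c n))\<^sup>2)" unfolding l_def by (rule c_sum_blocks[symmetric])
  also have "\<dots> = (cmod (c 0))\<^sup>2 + (\<Sum>n\<in>{..<l} - {0}. (cmod (c n))\<^sup>2)"
    by (rule sum.remove) (use l in auto)
  also have "(\<Sum>n\<in>{..<l} - {0}. (cmod (c n))\<^sup>2) = (\<Sum>n\<in>{..<l} - {0}. (cmod (u n))\<^sup>2)"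
    by (rule sum.cong) (auto simp: u_def)
  also have "\<dots> \<le> (\<Sum>n<l. (cmod (u n))\<^sup>2)" by (rule sum_mono2) auto
  also have "\<dots> = nsq u" by (rule nsq_eq_sum[symmetric]) (rule u0)
  finally have "real k * ?\<kappa> \<le> S\<^sup>2 + nsq u" using S(2)[of 0] power_mono[OF S(2)[of 0], of 2] by simp
  then have "144 * S\<^sup>2 / d\<^sup>2 < nsq u" using k by linarith
  then have "144 * S\<^sup>2 < d\<^sup>2 * nsq u" using d by (simp add: field_simps)
  then have "detects l \<beta> (\<zeta> * \<zeta>) d" unfolding detects_def using up u0 by (intro exI[of _ True] exI[of _ u]) auto
  then show ?thesis by (intro exI[of _ "2 * k"]) (simp add: l_def mult_ac)
qed

end

theorem elliptic_detects:
  assumes w: "w \<noteq> []" "\<And>x. x \<in> set w \<Longrightarrow> cmod x < 1" and th: "\<theta> \<in> elliptic w" and d: "d > 0"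
  shows "\<exists>N. detects (N * length w) (\<lambda>n. w ! (n mod length w)) (cis \<theta>) d"
proof -
  let ?z = "cis (\<theta> / 2)"
  have "su_det (mon ?z w) = 1" by (rule su_det_mon) (use w in auto)
  moreover have "\<bar>Re (fst (mon ?z w))\<bar> < 1" using th by (simp add: elliptic_def)
  ultimately obtain v0 \<mu> where "cmod \<mu> = 1" "v0 \<noteq> (0, 0)" "su_act (mon ?z w) v0 = (\<mu> * fst v0, \<mu> * snd v0)"
    using elliptic_eigenvector by blast
  then interpret periodic_solution w ?z \<mu> v0 by unfold_locales (use w in auto)
  have "\<beta> = (\<lambda>n. w ! (n mod length w))" by (rule ext) (simp add: \<beta>_def)
  moreover have "?z * ?z = cis \<theta>" by (simp add: cis_mult)
  ultimately show ?thesis using detect_power[OF d] by simp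
qed

section \<open>Inserting a word after powers of another\<close>

text \<open>Cayley-Hamilton for a matrix of determinant 1.\<close>

lemma mon_trace_recurrence:
  assumes "su_det U = 1"
  shows "fst (su_mult (su_mult P U) U) = 2 * Re (fst U) * fst (su_mult P U) - fst P"
proof -
  have d: "snd U * cnj (snd U) = fst U * cnj (fst U) - 1" using assms by (simp add: su_det_def algebra_simps)
  have t: "complex_of_real (2 * Re (fst U)) = fst U + cnj (fst U)" by (simp add: complex_add_cnj)
  have "fst (su_mult (su_mult P U) U) = fst P * (fst U * fst U) + fst P * (snd U * cnj (snd U)) + snd P * cnj (snd U) * (fst U + cnj (fst U))"
    by (simp add: su_mult_def algebra_simps)
  also have "\<dots> = (fst U + cnj (fst U)) * fst (su_mult P U) - fst P"
    unfolding d by (simp add: su_mult_def algebra_simps)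
  finally show ?thesis using t by simp
qed

lemma cos_recurrence:
  fixes t :: "nat \<Rightarrow> real"
  assumes rec: "\<And>k. t (Suc (Suc k)) = 2 * cos \<phi> * t (Suc k) - t k" and s: "sin \<phi> \<noteq> 0"
  shows "\<exists>R \<psi>. \<forall>k. t k = R * cos (real k * \<phi> - \<psi>)"
proof -
  define b where "b = (t 1 - t 0 * cos \<phi>) / sin \<phi>"
  have b: "t 1 = t 0 * cos \<phi> + b * sin \<phi>" using s by (simp add: b_def)
  have "t k = t 0 * cos (real k * \<phi>) + b * sin (real k * \<phi>) \<and> t (Suc k) = t 0 * cos (real (Suc k) * \<phi>) + b * sin (real (Suc k) * \<phi>)" for k
  proof (induction k)
    case 0
    then show ?case using b by simp
  next
    case (Suc k)
    have c: "cos (real (Suc (Suc k)) * \<phi>) = 2 * cos \<phi> * cos (real (Suc k) * \<phi>) - cos (real k * \<phi>)"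
      using cos_add[of "real (Suc k) * \<phi>" \<phi>] cos_diff[of "real (Suc k) * \<phi>" \<phi>] by (simp add: algebra_simps)
    have d: "sin (real (Suc (Suc k)) * \<phi>) = 2 * cos \<phi> * sin (real (Suc k) * \<phi>) - sin (real k * \<phi>)"
      using sin_add[of "real (Suc k) * \<phi>" \<phi>] sin_diff[of "real (Suc k) * \<phi>" \<phi>] by (simp add: algebra_simps)
    have "t (Suc (Suc k)) = t 0 * cos (real (Suc (Suc k)) * \<phi>) + b * sin (real (Suc (Suc k)) * \<phi>)"
      unfolding rec[of k] c d using Suc by (simp only: algebra_simps)
    then show ?case using Suc by blast
  qed
  then have t: "t k = t 0 * cos (real k * \<phi>) + b * sin (real k * \<phi>)" for k by blast
  \<comment> \<open>amplitude and phase of the combination of cosine and sine\<close>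
  define R \<psi> where "R = cmod (Complex (t 0) b)" and "\<psi> = Arg (Complex (t 0) b)"
  have "rcis R \<psi> = Complex (t 0) b" unfolding R_def \<psi>_def by (rule rcis_cmod_Arg)
  then have "t 0 = R * cos \<psi>" "b = R * sin \<psi>" by (metis Re_rcis complex.sel(1), metis Im_rcis complex.sel(2))
  then have "t k = R * cos (real k * \<phi> - \<psi>)" for k
    unfolding t[of k] by (simp add: cos_diff algebra_simps)
  then show ?thesis by blast
qed

text \<open>A Kronecker approximation puts \<open>k \<phi> - \<psi>\<close> close to an odd multiple of \<open>\<pi> / 2\<close>.\<close>

lemma irrational_small_trace:
  fixes t :: "nat \<Rightarrow> real"
  assumes rec: "\<And>k. t (Suc (Suc k)) = 2 * cos \<phi> * t (Suc k) - t k" and irr: "\<phi> / pi \<notin> \<rat>"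
  shows "\<exists>k\<ge>1. \<bar>t k\<bar> < 1"
proof -
  have "sin \<phi> \<noteq> 0"
  proof
    assume "sin \<phi> = 0"
    then obtain i where "\<phi> = of_int i * pi" by (auto simp: sin_zero_iff_int2)
    then show False using irr by simp
  qed
  then obtain R \<psi> where t: "\<And>k. t k = R * cos (real k * \<phi> - \<psi>)" using cos_recurrence[where t = t and \<phi> = \<phi>] rec by blast
  define e where "e = 1 / (pi * (\<bar>R\<bar> + 1))"
  have e: "0 < e" by (simp add: e_def add_nonneg_pos)
  obtain h k where hk: "k > 0" "\<bar>of_int k * (\<phi> / pi) - of_int h - (\<psi> / pi + 1/2)\<bar> < e"
    using sequence_of_fractional_parts_is_dense[OF irr e] by blast
  define n where "n = nat k"
  have n: "n \<ge> 1" "of_int k = real n" using hk(1) by (simp_all add: n_def)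
  define \<delta> where "\<delta> = of_int k * (\<phi> / pi) - of_int h - (\<psi> / pi + 1/2)"
  have "real n * \<phi> - \<psi> = of_int h * pi + (pi / 2 + \<delta> * pi)"
    unfolding \<delta>_def n(2) by (simp add: field_simps)
  then have "cos (real n * \<phi> - \<psi>) = cos (of_int h * pi) * cos (pi / 2 + \<delta> * pi) - sin (of_int h * pi) * sin (pi / 2 + \<delta> * pi)"
    by (simp only: cos_add)
  also have "sin (of_int h * pi) = 0" by (simp add: sin_zero_iff_int2)
  also have "cos (pi / 2 + \<delta> * pi) = - sin (\<delta> * pi)" by (simp add: cos_add)
  finally have "\<bar>cos (real n * \<phi> - \<psi>)\<bar> = \<bar>cos (of_int h * pi)\<bar> * \<bar>sin (\<delta> * pi)\<bar>" by (simp add: abs_mult)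
  also have "\<dots> \<le> 1 * \<bar>\<delta> * pi\<bar>" by (intro mult_mono abs_sin_x_le_abs_x) auto
  finally have c: "\<bar>cos (real n * \<phi> - \<psi>)\<bar> \<le> \<bar>\<delta>\<bar> * pi" by (simp add: abs_mult)
  have "\<bar>t n\<bar> \<le> \<bar>R\<bar> * (\<bar>\<delta>\<bar> * pi)" unfolding t abs_mult by (intro mult_left_mono c) auto
  also have "\<dots> \<le> \<bar>R\<bar> * (e * pi)" using hk(2) by (intro mult_left_mono mult_right_mono) (auto simp: \<delta>_def)
  also have "\<dots> = \<bar>R\<bar> / (\<bar>R\<bar> + 1)" by (simp add: e_def)
  also have "\<dots> < 1" by simp
  finally show ?thesis using n(1) by blast
qed

text \<open>Multiplied by \<open>\<zeta>\<close> to the length of the word, the matrix entries become polynomials in \<open>z = \<zeta>\<^sup>2\<close>. The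
  degree bounds say that the trace is a polynomial of exact degree \<open>length w\<close>, because the leading
  coefficient of the first entry cannot be cancelled.\<close>

definition mon_polys :: "complex list \<Rightarrow> complex poly \<Rightarrow> complex poly \<Rightarrow> complex poly \<Rightarrow> complex poly \<Rightarrow> bool" where
  "mon_polys w P Q R T \<longleftrightarrow>
    (\<forall>\<zeta>. cmod \<zeta> = 1 \<longrightarrow> \<zeta> ^ length w * fst (mon \<zeta> w) = poly P (\<zeta>\<^sup>2) \<and> \<zeta> ^ length w * snd (mon \<zeta> w) = poly Q (\<zeta>\<^sup>2) \<and>
      \<zeta> ^ length w * cnj (snd (mon \<zeta> w)) = poly R (\<zeta>\<^sup>2) \<and> \<zeta> ^ length w * cnj (fst (mon \<zeta> w)) = poly T (\<zeta>\<^sup>2)) \<and>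
    coeff P (length w) \<noteq> 0 \<and> (\<forall>m>length w. coeff P m = 0) \<and> (\<forall>m\<ge>length w. coeff Q m = 0) \<and>
    (\<forall>m>length w. coeff R m = 0) \<and> (\<forall>m>length w. coeff T m = 0) \<and> (w \<noteq> [] \<longrightarrow> coeff T (length w) = 0)"

lemma mon_polys_exist:
  assumes "\<And>x. x \<in> set w \<Longrightarrow> cmod x < 1"
  shows "\<exists>P Q R T. mon_polys w P Q R T"
  using assms
proof (induction w)
  case Nil
  show ?case
    by (intro exI[of _ 1] exI[of _ 0] exI[of _ 0] exI[of _ 1]) (auto simp: mon_polys_def coeff_eq_0)
next
  case (Cons x w)
  let ?n = "length w"
  let ?r = "complex_of_real (rho x)"
  have rp: "?r \<noteq> 0" using rho_pos[of x] Cons.prems by fastforce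
  have "\<exists>P Q R T. mon_polys w P Q R T" by (rule Cons.IH) (rule Cons.prems, simp)
  then obtain P Q R T where PQRT: "mon_polys w P Q R T" by blast
  have ev: "\<zeta> ^ ?n * fst (mon \<zeta> w) = poly P (\<zeta>\<^sup>2)" "\<zeta> ^ ?n * snd (mon \<zeta> w) = poly Q (\<zeta>\<^sup>2)"
      "\<zeta> ^ ?n * cnj (snd (mon \<zeta> w)) = poly R (\<zeta>\<^sup>2)" "\<zeta> ^ ?n * cnj (fst (mon \<zeta> w)) = poly T (\<zeta>\<^sup>2)" if "cmod \<zeta> = 1" for \<zeta>
    using PQRT that by (simp_all add: mon_polys_def)
  have co: "coeff P ?n \<noteq> 0" "\<And>m. m > ?n \<Longrightarrow> coeff P m = 0" "\<And>m. m \<ge> ?n \<Longrightarrow> coeff Q m = 0"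
      "\<And>m. m > ?n \<Longrightarrow> coeff R m = 0" "\<And>m. m > ?n \<Longrightarrow> coeff T m = 0"
    using PQRT by (simp_all add: mon_polys_def)
  define P' where "P' = smult (1 / ?r) (pCons 0 (P - smult x Q))"
  define Q' where "Q' = smult (1 / ?r) (Q - smult (cnj x) P)"
  define R' where "R' = smult (1 / ?r) (pCons 0 (R - smult x T))"
  define T' where "T' = smult (1 / ?r) (T - smult (cnj x) R)"
  have "\<zeta> ^ Suc ?n * fst (mon \<zeta> (x # w)) = poly P' (\<zeta>\<^sup>2) \<and> \<zeta> ^ Suc ?n * snd (mon \<zeta> (x # w)) = poly Q' (\<zeta>\<^sup>2) \<and>
      \<zeta> ^ Suc ?n * cnj (snd (mon \<zeta> (x # w))) = poly R' (\<zeta>\<^sup>2) \<and> \<zeta> ^ Suc ?n * cnj (fst (mon \<zeta> (x # w))) = poly T' (\<zeta>\<^sup>2)"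
    if z: "cmod \<zeta> = 1" for \<zeta>
  proof -
    let ?a = "fst (mon \<zeta> w)" and ?b = "snd (mon \<zeta> w)"
    have zz: "\<zeta> * cnj \<zeta> = 1" using z by (simp add: complex_norm_square[symmetric])
    have e: "poly P (\<zeta>\<^sup>2) = \<zeta> ^ ?n * ?a" "poly Q (\<zeta>\<^sup>2) = \<zeta> ^ ?n * ?b"
      "poly R (\<zeta>\<^sup>2) = \<zeta> ^ ?n * cnj ?b" "poly T (\<zeta>\<^sup>2) = \<zeta> ^ ?n * cnj ?a" by (simp_all add: ev[OF z])
    have m: "fst (mon \<zeta> (x # w)) = \<zeta> * (?a - x * ?b) / ?r" "snd (mon \<zeta> (x # w)) = cnj \<zeta> * (?b - cnj x * ?a) / ?r"
      "cnj (snd (mon \<zeta> (x # w))) = \<zeta> * (cnj ?b - x * cnj ?a) / ?r" "cnj (fst (mon \<zeta> (x # w))) = cnj \<zeta> * (cnj ?a - cnj x * cnj ?b) / ?r"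
      by (simp_all add: su_mult_def szego_def add_divide_distrib diff_divide_distrib algebra_simps)
    have k1: "\<zeta> ^ Suc ?n * (\<zeta> * y / ?r) = \<zeta>\<^sup>2 * (\<zeta> ^ ?n * y) / ?r" for y by (simp add: power2_eq_square)
    have k2: "\<zeta> ^ Suc ?n * (cnj \<zeta> * y / ?r) = \<zeta> ^ ?n * y / ?r" for y
    proof -
      have "\<zeta> ^ Suc ?n * (cnj \<zeta> * y / ?r) = (\<zeta> * cnj \<zeta>) * (\<zeta> ^ ?n * y / ?r)" by simp
      then show ?thesis by (simp only: zz mult_1)
    qed
    have "\<zeta> ^ Suc ?n * fst (mon \<zeta> (x # w)) = poly P' (\<zeta>\<^sup>2)"
      unfolding m(1) k1 P'_def poly_smult poly_pCons poly_diff e by (simp add: algebra_simps diff_divide_distrib)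
    moreover have "\<zeta> ^ Suc ?n * snd (mon \<zeta> (x # w)) = poly Q' (\<zeta>\<^sup>2)"
      unfolding m(2) k2 Q'_def poly_smult poly_diff e by (simp add: algebra_simps diff_divide_distrib)
    moreover have "\<zeta> ^ Suc ?n * cnj (snd (mon \<zeta> (x # w))) = poly R' (\<zeta>\<^sup>2)"
      unfolding m(3) k1 R'_def poly_smult poly_pCons poly_diff e by (simp add: algebra_simps diff_divide_distrib)
    moreover have "\<zeta> ^ Suc ?n * cnj (fst (mon \<zeta> (x # w))) = poly T' (\<zeta>\<^sup>2)"
      unfolding m(4) k2 T'_def poly_smult poly_diff e by (simp add: algebra_simps diff_divide_distrib)
    ultimately show ?thesis by blast
  qed
  moreover have "coeff P' (Suc ?n) \<noteq> 0" using co(1) co(3)[of ?n] rp by (simp add: P'_def)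
  moreover have "\<forall>m>Suc ?n. coeff P' m = 0" "\<forall>m>Suc ?n. coeff R' m = 0"
    using co by (auto simp: P'_def R'_def coeff_pCons split: nat.splits)
  moreover have "\<forall>m\<ge>Suc ?n. coeff Q' m = 0" "\<forall>m\<ge>Suc ?n. coeff T' m = 0"
    using co by (auto simp: Q'_def T'_def)
  ultimately show ?case
    by (intro exI[of _ P'] exI[of _ Q'] exI[of _ R'] exI[of _ T']) (auto simp: mon_polys_def simp del: mon.simps)
qed

text \<open>Squaring the polynomial equation for the trace removes the odd powers of \<open>\<zeta>\<close>. The square
  of the trace polynomial has degree \<open>2 * length w\<close> and the other side is a multiple of
  \<open>z ^ length w\<close>, so the equation is not an identity.\<close>

lemma finite_trace_level:
  assumes w: "w \<noteq> []" "\<And>x. x \<in> set w \<Longrightarrow> cmod x < 1"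
  shows "finite {\<theta>. 0 \<le> \<theta> \<and> \<theta> < 2 * pi \<and> Re (fst (mon (cis (\<theta> / 2)) w)) = x}"
proof -
  let ?n = "length w"
  obtain P Q R T where PQRT: "mon_polys w P Q R T" using mon_polys_exist[OF w(2)] by blast
  have ev: "\<zeta> ^ ?n * fst (mon \<zeta> w) = poly P (\<zeta>\<^sup>2)" "\<zeta> ^ ?n * cnj (fst (mon \<zeta> w)) = poly T (\<zeta>\<^sup>2)" if "cmod \<zeta> = 1" for \<zeta>
    using PQRT that by (simp_all add: mon_polys_def)
  have co: "coeff P ?n \<noteq> 0" "\<And>m. m > ?n \<Longrightarrow> coeff P m = 0" "\<And>m. m > ?n \<Longrightarrow> coeff T m = 0" "coeff T ?n = 0"
    using PQRT w(1) by (simp_all add: mon_polys_def)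
  define G where "G = (P + T)\<^sup>2 - monom (complex_of_real (4 * x\<^sup>2)) ?n"
  have dPT: "degree (P + T) = ?n"
  proof (rule antisym)
    show "degree (P + T) \<le> ?n" by (rule degree_le) (use co in auto)
    show "?n \<le> degree (P + T)" by (rule le_degree) (use co in auto)
  qed
  have "coeff G (2 * ?n) = (coeff (P + T) ?n)\<^sup>2"
    using coeff_mult_degree_sum[of "P + T" "P + T"] w(1) dPT by (simp add: G_def power2_eq_square mult_2)
  then have "G \<noteq> 0" using co by auto
  then have fin: "finite {z. poly G z = 0}" by (rule poly_roots_finite)
  let ?A = "{\<theta>. 0 \<le> \<theta> \<and> \<theta> < 2 * pi \<and> Re (fst (mon (cis (\<theta> / 2)) w)) = x}"
  have "cis ` ?A \<subseteq> {z. poly G z = 0}"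
  proof
    fix z assume "z \<in> cis ` ?A"
    then obtain \<theta> where th: "z = cis \<theta>" "Re (fst (mon (cis (\<theta> / 2)) w)) = x" by auto
    let ?\<zeta> = "cis (\<theta> / 2)"
    have z: "?\<zeta>\<^sup>2 = z" by (simp add: th power2_eq_square cis_mult)
    have "poly (P + T) z = ?\<zeta> ^ ?n * (fst (mon ?\<zeta> w) + cnj (fst (mon ?\<zeta> w)))"
      using ev[of ?\<zeta>] by (simp add: z distrib_left)
    also have "\<dots> = ?\<zeta> ^ ?n * complex_of_real (2 * x)" by (simp only: complex_add_cnj th)
    finally have "(poly (P + T) z)\<^sup>2 = (?\<zeta> ^ ?n)\<^sup>2 * complex_of_real (4 * x\<^sup>2)" by (simp add: power_mult_distrib)
    also have "(?\<zeta> ^ ?n)\<^sup>2 = z ^ ?n" unfolding z[symmetric] by (simp only: power_mult[symmetric] mult.commute)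
    finally show "z \<in> {z. poly G z = 0}" by (simp add: G_def poly_monom mult.commute)
  qed
  then have "finite (cis ` ?A)" using fin finite_subset by blast
  moreover have "inj_on cis ?A"
  proof (rule inj_onI)
    fix a b assume ab: "a \<in> ?A" "b \<in> ?A" "cis a = cis b"
    then obtain i :: int where i: "a = b + 2 * pi * i" using sin_cos_eq_iff[of a b] by (auto simp: complex_eq_iff)
    have "\<bar>2 * pi * i\<bar> < 2 * pi" using ab i by auto
    then have "\<bar>real_of_int i\<bar> < 1" by (simp add: abs_mult)
    then have "i = 0" by linarith
    then show "a = b" using i by simp
  qed
  ultimately show ?thesis by (rule finite_imageD)
qed

text \<open>The exceptional angles are those at which \<open>u\<close> rotates by a rational multiple of \<open>\<pi>\<close>.\<close>

theorem elliptic_insertion: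
  assumes u: "u \<noteq> []" "\<And>x. x \<in> set u \<Longrightarrow> cmod x < 1"
  shows "\<exists>E. countable E \<and> elliptic u - E \<subseteq> (\<Union>k\<in>{1..}. elliptic (concat (replicate k u) @ v))"
proof -
  define E where "E = (\<Union>q\<in>\<rat>. {\<theta>. 0 \<le> \<theta> \<and> \<theta> < 2 * pi \<and> Re (fst (mon (cis (\<theta> / 2)) u)) = cos (pi * q)})"
  have "countable E" unfolding E_def
    by (intro countable_UN countable_rat countable_finite finite_trace_level u)
  moreover have "elliptic u - E \<subseteq> (\<Union>k\<in>{1..}. elliptic (concat (replicate k u) @ v))"
  proof
    fix \<theta> assume th: "\<theta> \<in> elliptic u - E"
    let ?\<zeta> = "cis (\<theta> / 2)"
    let ?U = "mon ?\<zeta> u"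
    define \<phi> where "\<phi> = arccos (Re (fst ?U))"
    have x: "\<bar>Re (fst ?U)\<bar> < 1" and th0: "0 \<le> \<theta>" "\<theta> < 2 * pi" using th by (auto simp: elliptic_def)
    have cos: "cos \<phi> = Re (fst ?U)" unfolding \<phi>_def using x by (intro cos_arccos_abs) simp
    have irr: "\<phi> / pi \<notin> \<rat>"
    proof
      assume q: "\<phi> / pi \<in> \<rat>"
      have "Re (fst ?U) = cos (pi * (\<phi> / pi))" by (simp add: cos)
      then have "\<theta> \<in> E" unfolding E_def using q th0 by blast
      then show False using th by blast
    qed
    define P where "P k = su_mult (mon ?\<zeta> v) (mon ?\<zeta> (concat (replicate k u)))" for k
    have P: "P (Suc k) = su_mult (P k) ?U" for k by (simp add: P_def mon_append su_mult_assoc)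
    have det: "su_det ?U = 1" by (rule su_det_mon) (use u in auto)
    have "Re (fst (P (Suc (Suc k)))) = 2 * cos \<phi> * Re (fst (P (Suc k))) - Re (fst (P k))" for k
      using arg_cong[OF mon_trace_recurrence[OF det, of "P k"], of Re] by (simp add: P cos)
    from irrational_small_trace[of "\<lambda>k. Re (fst (P k))", OF this irr] obtain k where "k \<ge> 1" "\<bar>Re (fst (P k))\<bar> < 1" by blast
    then have "\<theta> \<in> elliptic (concat (replicate k u) @ v)" using th0 by (simp add: elliptic_def mon_append P_def)
    then show "\<theta> \<in> (\<Union>k\<in>{1..}. elliptic (concat (replicate k u) @ v))" using \<open>k \<ge> 1\<close> by auto
  qed
  ultimately show ?thesis by blast
qed

lemma continuous_mon: "continuous_on X (\<lambda>\<theta>. fst (mon (cis (\<theta> / 2)) w)) \<and> continuous_on X (\<lambda>\<theta>. snd (mon (cis (\<theta> / 2)) w))"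
proof (induction w)
  case (Cons x w)
  define k where "k = inverse (complex_of_real (rho x))"
  have cis: "continuous_on X (\<lambda>\<theta>. cis (\<theta> / 2))" by (intro continuous_intros) auto
  have f: "fst (mon \<zeta> (x # w)) = (fst (mon \<zeta> w) * \<zeta> - snd (mon \<zeta> w) * x * \<zeta>) * k"
    "snd (mon \<zeta> (x # w)) = (snd (mon \<zeta> w) * cnj \<zeta> - fst (mon \<zeta> w) * cnj x * cnj \<zeta>) * k" for \<zeta>
    by (simp_all add: su_mult_def szego_def k_def field_simps diff_divide_distrib)
  have a: "continuous_on X (\<lambda>\<theta>. fst (mon (cis (\<theta> / 2)) w))"
    and b: "continuous_on X (\<lambda>\<theta>. snd (mon (cis (\<theta> / 2)) w))"
    using Cons by blast+
  show ?case unfolding f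
    by (intro conjI continuous_on_mult continuous_on_diff continuous_on_const continuous_on_cnj a b cis)
qed simp

lemma elliptic_borel: "elliptic w \<in> sets borel"
proof -
  have "continuous_on UNIV (\<lambda>\<theta>. \<bar>Re (fst (mon (cis (\<theta> / 2)) w))\<bar>)"
    using continuous_mon by (intro continuous_on_rabs continuous_on_Re) blast
  then have "open ((\<lambda>\<theta>. \<bar>Re (fst (mon (cis (\<theta> / 2)) w))\<bar>) -` {..<1})"
    by (intro open_vimage) auto
  moreover have "elliptic w = {0..<2 * pi} \<inter> ((\<lambda>\<theta>. \<bar>Re (fst (mon (cis (\<theta> / 2)) w))\<bar>) -` {..<1})"
    by (auto simp: elliptic_def)
  ultimately show ?thesis by auto
qed

lemma elliptic_singleton_pos:
  "emeasure lborel (elliptic [a]) > 0"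
proof -
  let ?V = "{0<..<2 * pi} \<inter> ((\<lambda>\<theta>. \<bar>Re (fst (mon (cis (\<theta> / 2)) [a]))\<bar>) -` {..<1})"
  have "continuous_on UNIV (\<lambda>\<theta>. \<bar>Re (fst (mon (cis (\<theta> / 2)) [a]))\<bar>)"
    using continuous_mon by (intro continuous_on_rabs continuous_on_Re) blast
  then have "open ((\<lambda>\<theta>. \<bar>Re (fst (mon (cis (\<theta> / 2)) [a]))\<bar>) -` {..<1})"
    by (intro open_vimage) auto
  then have op: "open ?V" by (intro open_Int) auto
  moreover have "pi \<in> ?V" by (simp add: su_mult_def szego_def)
  ultimately obtain e where e: "e > 0" "ball pi e \<subseteq> ?V" by (meson open_contains_ball)
  have "0 < emeasure lborel (ball pi e)" using e(1) by (simp add: ball_eq_greaterThanLessThan)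
  also have "\<dots> \<le> emeasure lborel ?V" 
    using borel_open[OF op] by (intro emeasure_mono[OF e(2)]) (simp del: mon.simps)
  also have "\<dots> \<le> emeasure lborel (elliptic [a])"
  proof (rule emeasure_mono)
    show "?V \<subseteq> elliptic [a]" by (auto simp: elliptic_def simp del: mon.simps)
    show "elliptic [a] \<in> sets lborel" using elliptic_borel[of "[a]"] by simp
  qed
  finally show ?thesis .
qed

section \<open>Towers of words and minimal subshifts\<close>

definition wpow :: "nat \<Rightarrow> 'a list \<Rightarrow> 'a list" where
  "wpow k u = concat (replicate k u)"

lemma length_wpow: "length (wpow k u) = k * length u"
  by (simp add: wpow_def length_concat sum_list_replicate)

lemma wpow_Suc: "wpow (Suc k) u = u @ wpow k u" by (simp add: wpow_def)

lemma nth_wpow: "i < k * length u \<Longrightarrow> wpow k u ! i = u ! (i mod length u)"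
proof (induction k arbitrary: i)
  case (Suc k)
  show ?case
  proof (cases "i < length u")
    case True
    then show ?thesis by (simp add: wpow_Suc nth_append)
  next
    case False
    then have "wpow (Suc k) u ! i = u ! ((i - length u) mod length u)"
      using Suc by (simp add: wpow_Suc nth_append)
    then show ?thesis using False by (simp add: mod_if[of i])
  qed
qed simp

definition pblock :: "nat \<Rightarrow> 'a list list \<Rightarrow> 'a list" where
  "pblock N Ws = concat (map (wpow N) Ws)"

text \<open>The word with \<open>k = 1\<close> is included, so that the first word of each list is a prefix of the first word
  of the next list.\<close>

definition next_words :: "nat \<Rightarrow> nat \<Rightarrow> 'a list list \<Rightarrow> 'a list list" where
  "next_words N K Ws = concat (map (\<lambda>u. map (\<lambda>k. wpow k u @ pblock N Ws) [1..<Suc K]) Ws)"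

lemma set_next_words: "set (next_words N K Ws) = {wpow k u @ pblock N Ws |k u. u \<in> set Ws \<and> 1 \<le> k \<and> k \<le> K}"
proof -
  have "set (next_words N K Ws) = (\<Union>u\<in>set Ws. (\<lambda>k. wpow k u @ pblock N Ws) ` {1..<Suc K})"
    unfolding next_words_def by (simp only: set_concat set_map set_upt image_image)
  moreover have "{1..<Suc K} = {k. 1 \<le> k \<and> k \<le> K}" by auto
  ultimately show ?thesis by blast
qed

lemma hd_next_words: "Ws \<noteq> [] \<Longrightarrow> K \<ge> 1 \<Longrightarrow> hd (next_words N K Ws) = hd Ws @ pblock N Ws"
  by (cases Ws) (auto simp: next_words_def wpow_def upt_conv_Cons hd_append)

lemma next_words_ne: "Ws \<noteq> [] \<Longrightarrow> K \<ge> 1 \<Longrightarrow> next_words N K Ws \<noteq> []"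
  by (cases Ws) (auto simp: next_words_def)

definition concat_of :: "'a list set \<Rightarrow> 'a list \<Rightarrow> bool" where
  "concat_of Y x \<longleftrightarrow> (\<exists>ys. set ys \<subseteq> Y \<and> x = concat ys)"

lemma concat_of_append: "concat_of Y x \<Longrightarrow> concat_of Y y \<Longrightarrow> concat_of Y (x @ y)"
  unfolding concat_of_def by (metis concat_append set_append Un_least)

lemma concat_of_self: "x \<in> Y \<Longrightarrow> concat_of Y x"
  unfolding concat_of_def by (rule exI[of _ "[x]"]) auto

lemma concat_of_concat: "(\<And>y. y \<in> set ys \<Longrightarrow> concat_of Y y) \<Longrightarrow> concat_of Y (concat ys)"
proof (induction ys)
  case Nil
  show ?case unfolding concat_of_def by (rule exI[of _ "[]"]) simp
qed (auto intro: concat_of_append)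

lemma concat_of_wpow: "concat_of Y u \<Longrightarrow> concat_of Y (wpow k u)"
  unfolding wpow_def by (rule concat_of_concat) auto

lemma concat_of_trans: "concat_of Y x \<Longrightarrow> (\<And>y. y \<in> Y \<Longrightarrow> concat_of Z y) \<Longrightarrow> concat_of Z x"
  unfolding concat_of_def[of Y x] by (auto intro: concat_of_concat)

lemma concat_of_pblock: "concat_of (set Ws) (pblock N Ws)"
  unfolding pblock_def by (rule concat_of_concat) (auto intro: concat_of_wpow concat_of_self)

lemma concat_of_next_words: "x \<in> set (next_words N K Ws) \<Longrightarrow> concat_of (set Ws) x"
  unfolding set_next_words using concat_of_append[OF concat_of_wpow[OF concat_of_self] concat_of_pblock] by blast

text \<open>A window of length twice the maximal block length contains a complete block.\<close>

lemma concat_window: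
  assumes "set ys \<subseteq> Y" "\<And>y. y \<in> Y \<Longrightarrow> length y \<le> L" "i + 2 * L \<le> length (concat ys)" "L > 0"
  shows "\<exists>p y s. y \<in> Y \<and> concat ys = p @ y @ s \<and> i \<le> length p \<and> length p + length y \<le> i + 2 * L"
  using assms(1,3)
proof (induction ys arbitrary: i)
  case Nil
  then show ?case using assms(4) by simp
next
  case (Cons z ys)
  have z: "z \<in> Y" "length z \<le> L" using Cons.prems assms(2) by auto
  show ?case
  proof (cases "i \<ge> length z")
    case True
    then have "(i - length z) + 2 * L \<le> length (concat ys)" using Cons.prems by simp
    then obtain p y s where "y \<in> Y" "concat ys = p @ y @ s" "i - length z \<le> length p" "length p + length y \<le> i - length z + 2 * L"
      using Cons.IH[of "i - length z"] Cons.prems by auto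
    then show ?thesis using True by (intro exI[of _ "z @ p"] exI[of _ y] exI[of _ s]) auto
  next
    case False
    show ?thesis
    proof (cases "i = 0")
      case True
      then show ?thesis using z by (intro exI[of _ "[]"] exI[of _ z] exI[of _ "concat ys"]) auto
    next
      case i: False
      have "i + 2 * L \<le> length z + length (concat ys)" using Cons.prems(2) by simp
      then have "length (concat ys) > 0" using z False assms(4) by linarith
      then have "ys \<noteq> []" by auto
      then obtain y ys' where ys: "ys = y # ys'" by (cases ys) auto
      then have y: "y \<in> Y" "length y \<le> L" using Cons.prems assms(2) by auto
      show ?thesis using ys y z i False by (intro exI[of _ z] exI[of _ y] exI[of _ "concat ys'"]) auto
    qed
  qed
qed

definition occ :: "'a list \<Rightarrow> (nat \<Rightarrow> 'a) \<Rightarrow> nat \<Rightarrow> bool" where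
  "occ x \<alpha> m \<longleftrightarrow> (\<forall>i<length x. \<alpha> (m + i) = x ! i)"

lemma occ_sub: assumes "occ (p @ y @ s) \<alpha> m" shows "occ y \<alpha> (m + length p)"
  unfolding occ_def
proof (intro allI impI)
  fix i assume "i < length y"
  then show "\<alpha> (m + length p + i) = y ! i"
    using assms[unfolded occ_def, rule_format, of "length p + i"] by (simp add: nth_append add.assoc)
qed

text \<open>\<open>K \<ge> 2\<close> is needed for aperiodicity, which compares \<open>u v\<close> with \<open>u u v\<close>; \<open>n < N n\<close> makes the powers at
  level \<open>p\<close> longer than a supposed period \<open>p\<close>.\<close>

locale tower =
  fixes W :: "nat \<Rightarrow> 'a list list" and N K :: "nat \<Rightarrow> nat" and a b :: 'a
  assumes W0: "W 0 = [[a], [b]]" and ab: "a \<noteq> b"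
    and WS: "\<And>n. W (Suc n) = next_words (N n) (K n) (W n)"
    and N: "\<And>n. n < N n" and K: "\<And>n. 2 \<le> K n"
begin

lemma K1: "1 \<le> K n" using K[of n] by simp

lemma W_ne: "W n \<noteq> []"
proof (induction n)
  case (Suc n)
  show ?case unfolding WS by (rule next_words_ne[OF Suc K1])
qed (simp add: W0)

lemma W_words: "u \<in> set (W n) \<Longrightarrow> u \<noteq> [] \<and> set u \<subseteq> {a, b}"
proof (induction n arbitrary: u)
  case (Suc n)
  then obtain k x where u: "u = wpow k x @ pblock (N n) (W n)" "x \<in> set (W n)" "1 \<le> k" by (auto simp: WS set_next_words)
  obtain k' where "k = Suc k'" using u(3) by (cases k) auto
  then have "u \<noteq> []" using Suc.IH[OF u(2)] u(1) by (simp add: wpow_Suc)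
  moreover have "set (wpow k y) \<subseteq> {a, b}" if "y \<in> set (W n)" for y k using Suc.IH[OF that] by (auto simp: wpow_def)
  then have "set u \<subseteq> {a, b}" using u by (auto simp: pblock_def)
  ultimately show ?case by blast
qed (auto simp: W0)

definition w :: "nat \<Rightarrow> 'a list" where "w n = hd (W n)"

lemma w_in: "w n \<in> set (W n)" unfolding w_def using W_ne by simp

lemma w_Suc: "w (Suc n) = w n @ pblock (N n) (W n)"
  unfolding w_def WS by (rule hd_next_words[OF W_ne K1])

lemma pblock_length: "length (pblock (N n) (W n)) \<ge> 1"
proof -
  obtain u us where W: "W n = u # us" using W_ne[of n] by (cases "W n") auto
  then have "u \<noteq> []" using W_words[of u n] by simp
  moreover obtain j where "N n = Suc j" using N[of n] by (cases "N n") auto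
  ultimately show ?thesis using W by (cases u) (simp_all add: pblock_def wpow_Suc)
qed

lemma w_length: "length (w n) > n"
proof (induction n)
  case 0
  then show ?case by (simp add: w_def W0)
next
  case (Suc n)
  then show ?case using pblock_length[of n] by (simp add: w_Suc)
qed

lemma w_prefix: "n \<le> m \<Longrightarrow> \<exists>s. w m = w n @ s"
proof (induction m rule: dec_induct)
  case (step m)
  then show ?case by (auto simp: w_Suc)
qed simp

definition \<alpha>0 :: "nat \<Rightarrow> 'a" where "\<alpha>0 i = w i ! i"

lemma occ_w: "occ (w n) \<alpha>0 0"
  unfolding occ_def
proof (intro allI impI)
  fix i assume i: "i < length (w n)"
  show "\<alpha>0 (0 + i) = w n ! i"
  proof (cases "n \<le> i")
    case True
    then show ?thesis using w_prefix[OF True] i by (auto simp: \<alpha>0_def nth_append)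
  next
    case False
    then show ?thesis using w_prefix[of i n] w_length[of i] by (auto simp: \<alpha>0_def nth_append)
  qed
qed

lemma concat_of_W: "n \<le> m \<Longrightarrow> x \<in> set (W m) \<Longrightarrow> concat_of (set (W n)) x"
proof (induction m arbitrary: x rule: dec_induct)
  case base
  then show ?case by (rule concat_of_self)
next
  case (step m)
  then show ?case using concat_of_next_words[of x "N m" "K m" "W m"] concat_of_trans by (metis WS)
qed

lemma syndetic:
  obtains L where "\<And>i. \<exists>j y. y \<in> set (W n) \<and> i \<le> j \<and> j + length y \<le> i + L \<and> occ y \<alpha>0 j"
proof -
  define L where "L = Suc (sum_list (map length (W n)))"
  have L: "length y \<le> L" if "y \<in> set (W n)" for y
    using member_le_sum_list[of "length y" "map length (W n)"] that by (auto simp: L_def)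
  have "\<exists>j y. y \<in> set (W n) \<and> i \<le> j \<and> j + length y \<le> i + 2 * L \<and> occ y \<alpha>0 j" for i
  proof -
    define m where "m = max n (i + 2 * L)"
    have "concat_of (set (W n)) (w m)" by (rule concat_of_W[of n m]) (simp_all add: m_def w_in)
    then obtain ys where ys: "set ys \<subseteq> set (W n)" "w m = concat ys" by (auto simp: concat_of_def)
    have "i + 2 * L \<le> length (concat ys)" using w_length[of m] ys(2) by (simp add: m_def)
    then obtain p y s where y: "y \<in> set (W n)" "concat ys = p @ y @ s" "i \<le> length p" "length p + length y \<le> i + 2 * L"
      using concat_window[OF ys(1) L, of i] by (auto simp: L_def)
    then have "occ y \<alpha>0 (0 + length p)" using occ_sub occ_w[of m] ys(2) by metis
    then show ?thesis using y by auto
  qed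
  then show ?thesis using that by blast
qed

lemma power_factor:
  assumes "u \<in> set (W n)" "x \<in> set (W (Suc n))" shows "\<exists>p s. x = p @ wpow (N n) u @ s"
proof -
  obtain k y where x: "x = wpow k y @ pblock (N n) (W n)" using assms(2) by (auto simp: WS set_next_words)
  obtain us vs where "W n = us @ u # vs" using assms(1) by (meson split_list)
  then have "x = (wpow k y @ concat (map (wpow (N n)) us)) @ wpow (N n) u @ concat (map (wpow (N n)) vs)"
    by (simp add: x pblock_def)
  then show ?thesis by blast
qed

definition \<Omega> :: "(nat \<Rightarrow> 'a) set" where
  "\<Omega> = {\<alpha>. \<forall>l. \<exists>m. \<forall>i<l. \<alpha> i = \<alpha>0 (m + i)}"

text \<open>Every word of level \<open>n + 1\<close> contains the \<open>N n\<close>-th powers of all words of level \<open>n\<close>, and words of level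
  \<open>n + 1\<close> occur with bounded gaps.\<close>

lemma powers_recur:
  assumes \<alpha>: "\<alpha> \<in> \<Omega>" and u: "u \<in> set (W n)"
  shows "\<exists>j\<ge>i. occ (wpow (N n) u) \<alpha> j"
proof -
  obtain L where L: "\<And>i. \<exists>j y. y \<in> set (W (Suc n)) \<and> i \<le> j \<and> j + length y \<le> i + L \<and> occ y \<alpha>0 j"
    using syndetic[of "Suc n"] by blast
  obtain m where m: "\<forall>k<i + L. \<alpha> k = \<alpha>0 (m + k)" using \<alpha> by (auto simp: \<Omega>_def)
  obtain j y where y: "y \<in> set (W (Suc n))" "m + i \<le> j" "j + length y \<le> m + i + L" "occ y \<alpha>0 j"
    using L[of "m + i"] by blast
  obtain p s where ps: "y = p @ wpow (N n) u @ s" using power_factor[OF u y(1)] by blast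
  have o: "occ (wpow (N n) u) \<alpha>0 (j + length p)" using y(4) occ_sub unfolding ps by blast
  have "occ (wpow (N n) u) \<alpha> (j + length p - m)"
    unfolding occ_def
  proof (intro allI impI)
    fix k assume k: "k < length (wpow (N n) u)"
    then have "j + length p + k < j + length y" by (simp add: ps)
    then have "j + length p - m + k < i + L" using y by linarith
    moreover have "m + (j + length p - m + k) = j + length p + k" using y by simp
    ultimately show "\<alpha> (j + length p - m + k) = wpow (N n) u ! k"
      using m o[unfolded occ_def, rule_format, OF k] by metis
  qed
  then show ?thesis using y(2) by (intro exI[of _ "j + length p - m"]) auto
qed

lemma \<alpha>0_in: "\<alpha>0 \<in> \<Omega>" unfolding \<Omega>_def by (auto intro: exI[of _ 0])

lemma windows_recur:
  assumes "\<alpha> \<in> \<Omega>" "\<alpha>' \<in> \<Omega>"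
  shows "\<exists>m\<ge>m0. \<forall>k<l. \<alpha> (m + k) = \<alpha>' k"
proof -
  obtain q where q: "\<forall>i<l. \<alpha>' i = \<alpha>0 (q + i)" using assms(2) by (auto simp: \<Omega>_def)
  define n where "n = q + l"
  obtain j where j: "j \<ge> m0" "occ (wpow (N n) (w n)) \<alpha> j" using powers_recur[OF assms(1) w_in] by blast
  obtain r where "N n = Suc r" using N[of n] by (cases "N n") auto
  then have "occ (w n) \<alpha> j" using j(2) occ_sub[of "[]" "w n" "wpow r (w n)" \<alpha> j] by (simp add: wpow_Suc)
  have "\<alpha> (j + q + k) = \<alpha>' k" if "k < l" for k
  proof -
    have "q + k < length (w n)" using w_length[of n] that by (simp add: n_def)
    then have "\<alpha> (j + (q + k)) = \<alpha>0 (0 + (q + k))" using \<open>occ (w n) \<alpha> j\<close> occ_w[of n] by (simp add: occ_def)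
    then show ?thesis using q that by (simp add: add.assoc)
  qed
  then show ?thesis using j(1) by (intro exI[of _ "j + q"]) auto
qed

lemma funpow_shift: "(shift ^^ n) \<alpha> = (\<lambda>i. \<alpha> (n + i))"
  by (induction n arbitrary: \<alpha>) (auto simp: shift_def funpow_swap1 fun_eq_iff)

lemma \<Omega>_letters: "\<alpha> \<in> \<Omega> \<Longrightarrow> \<alpha> i \<in> {a, b}"
proof -
  assume "\<alpha> \<in> \<Omega>"
  then obtain m where "\<forall>k<Suc i. \<alpha> k = \<alpha>0 (m + k)" by (auto simp: \<Omega>_def)
  then have "\<alpha> i = w (m + i) ! (m + i)" by (simp add: \<alpha>0_def)
  also have "\<dots> \<in> set (w (m + i))" using w_length by (rule nth_mem)
  finally show ?thesis using W_words[OF w_in] by blast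
qed

text \<open>At level \<open>p\<close> a period \<open>p\<close> fits into the occurring powers of \<open>u\<close>, so \<open>length u\<close> is a period too. From
  there the claim that all word lengths are periods descends to level 0: it holds for \<open>u v\<close> and
  \<open>u u v\<close>, hence for \<open>u\<close>. At level 0 it says that the sequence is constant.\<close>

lemma nonperiodic: "nonperiodic_subshift \<Omega>"
  unfolding nonperiodic_subshift_def periodic_seq_def
proof (intro ballI notI)
  fix \<alpha> assume \<alpha>: "\<alpha> \<in> \<Omega>" and "\<exists>p>0. (shift ^^ p) \<alpha> = \<alpha>"
  then obtain p where p: "p > 0" "\<And>i. \<alpha> (p + i) = \<alpha> i" unfolding funpow_shift by (metis)
  have pm: "\<alpha> i = \<alpha> (i mod p)" for i
  proof (induction i rule: less_induct)
    case (less i)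
    show ?case
    proof (cases "i < p")
      case False
      then have "\<alpha> i = \<alpha> (i - p)" using p(2)[of "i - p"] by simp
      then show ?thesis using less[of "i - p"] False p(1) by (simp add: mod_if[of i])
    qed simp
  qed
  have top: "\<alpha> (i + length u) = \<alpha> i" if u: "u \<in> set (W p)" for u i
  proof -
    obtain j where j: "occ (wpow (N p) u) \<alpha> j" using powers_recur[OF \<alpha> u] by blast
    \<comment> \<open>a position \<open>j + r\<close> congruent to \<open>i\<close> in the first \<open>p\<close> letters of the power; \<open>p * j\<close> keeps the subtraction exact\<close>
    define r where "r = (i + p * j - j) mod p"
    have pj: "j \<le> p * j" using p(1) by simp
    have r: "r < p" using p(1) by (simp add: r_def)
    have "(j + r) mod p = (j + (i + p * j - j)) mod p" unfolding r_def by (simp add: mod_add_right_eq)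
    also have "j + (i + p * j - j) = i + p * j" using pj by linarith
    also have "(i + p * j) mod p = i mod p" by simp
    finally have c: "(j + r) mod p = i mod p" .
    then have c': "(j + r + length u) mod p = (i + length u) mod p" by (metis mod_add_left_eq)
    have lu: "1 \<le> length u" using W_words[OF u] by (cases u) auto
    have "r + length u < N p * length u"
    proof -
      have "p * 1 \<le> p * length u" using lu by (rule mult_le_mono2)
      then have "r + length u < p * length u + length u" using r by linarith
      also have "\<dots> = Suc p * length u" by simp
      also have "\<dots> \<le> N p * length u" using N[of p] by (intro mult_le_mono1) simp
      finally show ?thesis .
    qed
    then have "\<alpha> (j + (r + length u)) = u ! ((r + length u) mod length u)" "\<alpha> (j + r) = u ! (r mod length u)"
      using j by (auto simp: occ_def length_wpow nth_wpow)
    then have "\<alpha> (j + r + length u) = \<alpha> (j + r)" by (simp add: add.assoc)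
    then show ?thesis using pm[of "j + r + length u"] pm[of "j + r"] pm[of i] pm[of "i + length u"] c c' by simp
  qed
  have "\<forall>u\<in>set (W (p - k)). \<forall>i. \<alpha> (i + length u) = \<alpha> i" if "k \<le> p" for k
    using that
  proof (induction k)
    case 0
    then show ?case using top by simp
  next
    case (Suc k)
    then have s: "p - k = Suc (p - Suc k)" by simp
    let ?n = "p - Suc k"
    show ?case
    proof (intro ballI allI)
      fix u i assume u: "u \<in> set (W ?n)"
      have "wpow 1 u @ pblock (N ?n) (W ?n) \<in> set (W (Suc ?n))" "wpow 2 u @ pblock (N ?n) (W ?n) \<in> set (W (Suc ?n))"
        using u K[of ?n] unfolding WS set_next_words by fastforce+
      note mem = this
      have IH: "\<alpha> (i + length x) = \<alpha> i" if "x \<in> set (W (Suc ?n))" for x i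
        using Suc s that by simp
      have "\<alpha> (i + length u + (length u + length (pblock (N ?n) (W ?n)))) = \<alpha> (i + length u)"
        "\<alpha> (i + (2 * length u + length (pblock (N ?n) (W ?n)))) = \<alpha> i"
        using IH[OF mem(1), of "i + length u"] IH[OF mem(2), of i] by (simp_all add: length_wpow)
      then show "\<alpha> (i + length u) = \<alpha> i" by (simp add: mult_2 add.assoc)
    qed
  qed
  from this[of p] have "\<forall>u\<in>set (W 0). \<forall>i. \<alpha> (i + length u) = \<alpha> i" by simp
  then have one: "\<alpha> (Suc i) = \<alpha> i" for i by (simp add: W0)
  have const: "\<alpha> i = \<alpha> 0" for i by (induction i) (simp_all add: one)
  obtain r where r: "N 0 = Suc r" using N[of 0] by (cases "N 0") auto
  have letter: "\<exists>i. \<alpha> i = x" if x: "[x] \<in> set (W 0)" for x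
  proof -
    obtain i where "occ (wpow (N 0) [x]) \<alpha> i" using powers_recur[OF \<alpha> x] by blast
    from this[unfolded occ_def, rule_format, of 0] have "\<alpha> i = x" by (simp add: r wpow_Suc)
    then show ?thesis by blast
  qed
  then obtain i j where "\<alpha> i = a" "\<alpha> j = b" unfolding W0 by (metis list.set_intros)
  then show False using const ab by metis
qed

lemma minimal:
  assumes "a \<in> A" "b \<in> A"
  shows "minimal_subshift A \<Omega>"
proof -
  have top: "topspace (sequence_space A) = {\<alpha>. \<forall>i. \<alpha> i \<in> A}"
    by (auto simp: sequence_space_def PiE_def Pi_def)
  have sub: "\<Omega> \<subseteq> topspace (sequence_space A)" unfolding top
  proof (intro subsetI CollectI allI)
    fix \<alpha> i assume "\<alpha> \<in> \<Omega>"
    then show "\<alpha> i \<in> A" using \<Omega>_letters[of \<alpha> i] assms by auto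
  qed
  have cyl: "openin (sequence_space A) {\<beta>. (\<forall>i. \<beta> i \<in> A) \<and> (\<forall>i<l. \<beta> i = \<alpha> i)}" if "\<forall>i. \<alpha> i \<in> A" for \<alpha> l
  proof -
    have eq: "{\<beta>. (\<forall>i. \<beta> i \<in> A) \<and> (\<forall>i<l. \<beta> i = \<alpha> i)} = PiE UNIV (\<lambda>i. if i < l then {\<alpha> i} else A)"
      using that by (auto simp: PiE_def Pi_def split: if_splits) 
    show ?thesis unfolding sequence_space_def eq
      by (subst openin_PiE_gen) (use that in \<open>auto intro: finite_subset[of _ "{..<l}"]\<close>)
  qed
  have cyl_in: "\<exists>l. \<forall>\<beta>. (\<forall>i. \<beta> i \<in> A) \<longrightarrow> (\<forall>i<l. \<beta> i = \<alpha> i) \<longrightarrow> \<beta> \<in> U"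
    if U: "openin (sequence_space A) U" "\<alpha> \<in> U" for U \<alpha>
  proof -
    obtain V where V: "finite {i. V i \<noteq> A}" "\<alpha> \<in> PiE UNIV V" "PiE UNIV V \<subseteq> U"
      using U unfolding sequence_space_def openin_product_topology_alt by fastforce
    obtain l where l: "\<forall>i\<in>{i. V i \<noteq> A}. i < l" using V(1) finite_nat_set_iff_bounded by blast
    have "\<beta> \<in> U" if "\<forall>i. \<beta> i \<in> A" "\<forall>i<l. \<beta> i = \<alpha> i" for \<beta>
    proof -
      have "\<beta> i \<in> V i" for i
      proof (cases "V i = A")
        case False
        then show ?thesis using l V(2) that(2) by (auto simp: PiE_def Pi_def)
      qed (use that in auto)
      then show ?thesis using V(3) by (auto simp: PiE_def Pi_def)
    qed
    then show ?thesis by blast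
  qed
  have "closedin (sequence_space A) \<Omega>"
    unfolding closedin_def
  proof (intro conjI sub)
    show "openin (sequence_space A) (topspace (sequence_space A) - \<Omega>)"
    proof (subst openin_subopen, intro ballI)
      fix \<alpha> assume \<alpha>: "\<alpha> \<in> topspace (sequence_space A) - \<Omega>"
      then obtain l where l: "\<And>m. \<not> (\<forall>i<l. \<alpha> i = \<alpha>0 (m + i))" by (auto simp: \<Omega>_def)
      let ?C = "{\<beta>. (\<forall>i. \<beta> i \<in> A) \<and> (\<forall>i<l. \<beta> i = \<alpha> i)}"
      have "?C \<inter> \<Omega> = {}"
      proof (rule ccontr)
        assume "?C \<inter> \<Omega> \<noteq> {}"
        then obtain \<beta> where \<beta>: "\<forall>i<l. \<beta> i = \<alpha> i" "\<beta> \<in> \<Omega>" by auto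
        from \<beta>(2) obtain m where "\<forall>i<l. \<beta> i = \<alpha>0 (m + i)" unfolding \<Omega>_def by blast
        then have "\<forall>i<l. \<alpha> i = \<alpha>0 (m + i)" using \<beta>(1) by simp
        then show False using l by blast
      qed
      then show "\<exists>T. openin (sequence_space A) T \<and> \<alpha> \<in> T \<and> T \<subseteq> topspace (sequence_space A) - \<Omega>"
        using cyl[of \<alpha> l] \<alpha> unfolding top by (intro exI[of _ ?C]) auto
    qed
  qed
  moreover have "shift ` \<Omega> \<subseteq> \<Omega>"
  proof
    fix \<beta> assume "\<beta> \<in> shift ` \<Omega>"
    then obtain \<alpha> where \<alpha>: "\<alpha> \<in> \<Omega>" "\<beta> = shift \<alpha>" by blast
    show "\<beta> \<in> \<Omega>" unfolding \<Omega>_def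
    proof (intro CollectI allI)
      fix l
      obtain m where "\<forall>i<Suc l. \<alpha> i = \<alpha>0 (m + i)" using \<alpha>(1) by (auto simp: \<Omega>_def)
      then show "\<exists>m. \<forall>i<l. \<beta> i = \<alpha>0 (m + i)" by (intro exI[of _ "Suc m"]) (auto simp: \<alpha>(2) shift_def)
    qed
  qed
  moreover have "\<Omega> \<subseteq> sequence_space A closure_of (range (\<lambda>n. (shift ^^ n) \<alpha>))" if \<alpha>: "\<alpha> \<in> \<Omega>" for \<alpha>
  proof
    fix \<beta> assume \<beta>: "\<beta> \<in> \<Omega>"
    show "\<beta> \<in> sequence_space A closure_of (range (\<lambda>n. (shift ^^ n) \<alpha>))"
      unfolding in_closure_of
    proof (intro conjI allI impI)
      show "\<beta> \<in> topspace (sequence_space A)" using sub \<beta> by blast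
      fix U assume U: "\<beta> \<in> U \<and> openin (sequence_space A) U"
      from cyl_in[OF conjunct2[OF U] conjunct1[OF U]]
      obtain l where l: "\<forall>\<gamma>. (\<forall>i. \<gamma> i \<in> A) \<longrightarrow> (\<forall>i<l. \<gamma> i = \<beta> i) \<longrightarrow> \<gamma> \<in> U" by blast
      obtain m where "\<forall>k<l. \<alpha> (m + k) = \<beta> k" using windows_recur[OF \<alpha> \<beta>] by blast
      moreover have "\<forall>i. \<alpha> i \<in> A" using sub \<alpha> unfolding top by blast
      ultimately have "(shift ^^ m) \<alpha> \<in> U" using l[rule_format, of "(shift ^^ m) \<alpha>"] unfolding funpow_shift by simp
      then show "\<exists>y. y \<in> range (\<lambda>n. (shift ^^ n) \<alpha>) \<and> y \<in> U" by blast
    qed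
  qed
  ultimately show ?thesis unfolding minimal_subshift_def subshift_def using \<alpha>0_in by blast
qed

end

section \<open>Lebesgue measure along the tower\<close>

definition detected :: "complex list \<Rightarrow> nat \<Rightarrow> real \<Rightarrow> real set" where
  "detected u N d = {\<theta>. detects (N * length u) (\<lambda>n. u ! (n mod length u)) (cis \<theta>) d}"

lemma open_detected: "open (detected u N d)"
proof -
  let ?\<beta> = "\<lambda>n. u ! (n mod length u)" and ?l = "N * length u"
  have "detected u N d = (\<Union>(s, c) \<in> {(s, c). c 0 = 0 \<and> (\<forall>n\<ge>?l. c n = 0)}. {\<theta>. nsq (defect ?\<beta> s (cis \<theta>) c) < d\<^sup>2 * nsq c})"
    by (auto simp: detected_def detects_def)
  also have "open \<dots>"
  proof (intro open_UN ballI, clarify)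
    fix s and c :: "nat \<Rightarrow> complex" assume c: "\<forall>n\<ge>?l. c n = 0"
    have "nsq (defect ?\<beta> s (cis \<theta>) c) = (\<Sum>n<Suc ?l. (cmod (blk ?\<beta> (\<not> s) c n - cis \<theta> * blk_adj ?\<beta> s c n))\<^sup>2)" for \<theta>
    proof -
      have "nsq (defect ?\<beta> s (cis \<theta>) c) = (\<Sum>n<Suc ?l. (cmod (defect ?\<beta> s (cis \<theta>) c n))\<^sup>2)"
        by (rule nsq_eq_sum) (rule defect_bound[of ?l c], use c in auto)
      then show ?thesis by (simp only: defect_def)
    qed
    then show "open {\<theta>. nsq (defect ?\<beta> s (cis \<theta>) c) < d\<^sup>2 * nsq c}"
      by (auto intro!: open_Collect_less continuous_intros)
  qed
  finally show ?thesis .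
qed

lemma detected_mono: "N \<le> N' \<Longrightarrow> detected u N d \<subseteq> detected u N' d"
  unfolding detected_def using detect_mono by (auto simp: mult_le_mono1)

lemma emeasure_small:
  fixes F :: "nat \<Rightarrow> real set"
  assumes "\<And>n. F n \<in> sets borel" "decseq F" "F 0 \<subseteq> {0..2 * pi}" "countable (\<Inter>n. F n)" "\<delta> > 0"
  shows "\<exists>n. \<forall>m\<ge>n. emeasure lborel (F m) \<le> ennreal \<delta>"
proof -
  have fin: "emeasure lborel (F n) \<noteq> \<infinity>" for n
  proof -
    have "F n \<subseteq> {0..2 * pi}" using assms(2,3) unfolding decseq_def by blast
    then have "emeasure lborel (F n) \<le> emeasure lborel {0..2 * pi}" by (intro emeasure_mono) auto
    then show ?thesis by (auto simp: top_unique)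
  qed
  have "(\<lambda>n. emeasure lborel (F n)) \<longlonglongrightarrow> emeasure lborel (\<Inter>n. F n)"
    by (rule Lim_emeasure_decseq) (use assms fin in auto)
  moreover have "emeasure lborel (\<Inter>n. F n) = 0" by (rule emeasure_lborel_countable[OF assms(4)])
  ultimately have "\<forall>\<^sub>F n in sequentially. emeasure lborel (F n) < ennreal \<delta>"
    using assms(5) by (intro order_tendstoD(2)[of _ 0]) auto
  then show ?thesis by (auto simp: eventually_sequentially intro: less_imp_le)
qed

text \<open>Both losses decrease to measure 0: the first one by \<open>elliptic_detects\<close> as \<open>N\<close> grows, the second
  one by \<open>elliptic_insertion\<close> as \<open>K\<close> grows, for the \<open>N\<close> already chosen.\<close>

lemma next_words_exists:
  assumes Ws: "\<And>u. u \<in> set Ws \<Longrightarrow> u \<noteq> [] \<and> (\<forall>x\<in>set u. cmod x < 1)" and d: "d > 0" and \<delta>: "\<delta> > 0"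
  shows "\<exists>N K. n < N \<and> 2 \<le> K \<and> emeasure lborel (\<Union>u\<in>set Ws. elliptic u - detected u N d) \<le> ennreal \<delta> \<and>
    emeasure lborel ((\<Union>u\<in>set Ws. elliptic u) - (\<Union>x\<in>set (next_words N K Ws). elliptic x)) \<le> ennreal \<delta>"
proof -
  have sp: "elliptic u \<subseteq> {0..2 * pi}" for u by (auto simp: elliptic_def)
  define F where "F N = (\<Union>u\<in>set Ws. elliptic u - detected u N d)" for N
  have "\<exists>N. \<forall>m\<ge>N. emeasure lborel (F m) \<le> ennreal \<delta>"
  proof (rule emeasure_small[OF _ _ _ _ \<delta>])
    show "F N \<in> sets borel" for N unfolding F_def
      by (intro sets.finite_UN sets.Diff elliptic_borel borel_open open_detected) auto
    show "decseq F" unfolding decseq_def F_def using detected_mono by blast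
    show "F 0 \<subseteq> {0..2 * pi}" unfolding F_def using sp by blast
    have "(\<Inter>N. F N) = {}"
    proof (rule ccontr)
      assume "(\<Inter>N. F N) \<noteq> {}"
      then obtain \<theta> where th: "\<And>N. \<theta> \<in> F N" by auto
      have "\<exists>N. \<theta> \<in> elliptic u \<longrightarrow> \<theta> \<in> detected u N d" if "u \<in> set Ws" for u
        using elliptic_detects[of u \<theta> d] Ws[OF that] d unfolding detected_def by blast
      then obtain M where M: "\<And>u. u \<in> set Ws \<Longrightarrow> \<theta> \<in> elliptic u \<Longrightarrow> \<theta> \<in> detected u (M u) d" by metis
      obtain Mx where Mx: "\<And>u. u \<in> set Ws \<Longrightarrow> M u \<le> Mx"
        using finite_nat_set_iff_bounded_le[of "M ` set Ws"] by auto
      from th[of Mx] obtain u where "u \<in> set Ws" "\<theta> \<in> elliptic u" "\<theta> \<notin> detected u Mx d" by (auto simp: F_def)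
      then show False using M Mx detected_mono by blast
    qed
    then show "countable (\<Inter>N. F N)" by simp
  qed
  then obtain N1 where N1: "\<And>m. m \<ge> N1 \<Longrightarrow> emeasure lborel (F m) \<le> ennreal \<delta>" by blast
  define N where "N = max N1 (Suc n)"
  define G where "G K = (\<Union>u\<in>set Ws. elliptic u) - (\<Union>x\<in>set (next_words N K Ws). elliptic x)" for K
  have "\<exists>K. \<forall>m\<ge>K. emeasure lborel (G m) \<le> ennreal \<delta>"
  proof (rule emeasure_small[OF _ _ _ _ \<delta>])
    show "G K \<in> sets borel" for K unfolding G_def
      by (intro sets.finite_UN sets.Diff elliptic_borel) auto
    have "set (next_words N K Ws) \<subseteq> set (next_words N K' Ws)" if "K \<le> K'" for K K'
      using that unfolding set_next_words by fastforce
    then show "decseq G" unfolding decseq_def G_def by blast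
    show "G 0 \<subseteq> {0..2 * pi}" unfolding G_def using sp by blast
    have "\<exists>E. countable E \<and> elliptic u - E \<subseteq> (\<Union>k\<in>{1..}. elliptic (wpow k u @ pblock N Ws))" if "u \<in> set Ws" for u
      unfolding wpow_def using elliptic_insertion[of u] Ws[OF that] by blast
    then obtain E where E: "\<And>u. u \<in> set Ws \<Longrightarrow> countable (E u) \<and> elliptic u - E u \<subseteq> (\<Union>k\<in>{1..}. elliptic (wpow k u @ pblock N Ws))"
      by metis
    have "(\<Inter>K. G K) \<subseteq> (\<Union>u\<in>set Ws. E u)"
    proof
      fix \<theta> assume th: "\<theta> \<in> (\<Inter>K. G K)"
      then obtain u where u: "u \<in> set Ws" "\<theta> \<in> elliptic u" by (auto simp: G_def)
      show "\<theta> \<in> (\<Union>u\<in>set Ws. E u)"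
      proof (rule ccontr)
        assume "\<theta> \<notin> (\<Union>u\<in>set Ws. E u)"
        then obtain k where k: "k \<ge> 1" "\<theta> \<in> elliptic (wpow k u @ pblock N Ws)" using E[OF u(1)] u by blast
        have "wpow k u @ pblock N Ws \<in> set (next_words N k Ws)" using u(1) k(1) unfolding set_next_words by blast
        then show False using th k(2) unfolding G_def by blast
      qed
    qed
    then show "countable (\<Inter>K. G K)" using E by (meson countable_UN countable_finite countable_subset finite_set)
  qed
  then obtain K1 where K1: "\<And>m. m \<ge> K1 \<Longrightarrow> emeasure lborel (G m) \<le> ennreal \<delta>" by blast
  show ?thesis
    by (rule exI[of _ N], rule exI[of _ "max K1 2"])
       (use N1[of N] K1[of "max K1 2"] in \<open>auto simp: N_def F_def G_def\<close>)
qed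

lemma tower_exists:
  fixes a b :: complex
  assumes ab: "cmod a < 1" "cmod b < 1" "a \<noteq> b" and e: "\<And>n. e n > (0::real)"
  obtains W N K where "tower W N K a b"
    "\<And>n. emeasure lborel (\<Union>u\<in>set (W n). elliptic u - detected u (N n) (1 / real (Suc n))) \<le> ennreal (e n)"
    "\<And>n. emeasure lborel ((\<Union>u\<in>set (W n). elliptic u) - (\<Union>u\<in>set (W (Suc n)). elliptic u)) \<le> ennreal (e n)"
proof -
  define P where "P n Ws \<longleftrightarrow> (\<forall>u\<in>set Ws. u \<noteq> [] \<and> (\<forall>x\<in>set u. cmod x < 1)) \<and> (n = 0 \<longrightarrow> Ws = [[a], [b]])" for n :: nat and Ws
  define Q where "Q n Ws Ws' N K \<longleftrightarrow> Ws' = next_words N K Ws \<and> n < N \<and> 2 \<le> K \<and>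
     emeasure lborel (\<Union>u\<in>set Ws. elliptic u - detected u N (1 / real (Suc n))) \<le> ennreal (e n) \<and>
     emeasure lborel ((\<Union>u\<in>set Ws. elliptic u) - (\<Union>x\<in>set Ws'. elliptic x)) \<le> ennreal (e n)" for n Ws Ws' N K
  have "\<exists>W. \<forall>n. P n (W n) \<and> (\<exists>N K. Q n (W n) (W (Suc n)) N K)"
  proof (rule dependent_nat_choice)
    show "\<exists>x. P 0 x" using ab by (auto simp: P_def)
    fix Ws n assume P: "P n Ws"
    have "\<exists>N K. n < N \<and> 2 \<le> K \<and> emeasure lborel (\<Union>u\<in>set Ws. elliptic u - detected u N (1 / real (Suc n))) \<le> ennreal (e n) \<and>
      emeasure lborel ((\<Union>u\<in>set Ws. elliptic u) - (\<Union>x\<in>set (next_words N K Ws). elliptic x)) \<le> ennreal (e n)"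
      by (rule next_words_exists) (use P e in \<open>simp_all add: P_def\<close>)
    then obtain N K where NK: "n < N" "2 \<le> K" "emeasure lborel (\<Union>u\<in>set Ws. elliptic u - detected u N (1 / real (Suc n))) \<le> ennreal (e n)"
      "emeasure lborel ((\<Union>u\<in>set Ws. elliptic u) - (\<Union>x\<in>set (next_words N K Ws). elliptic x)) \<le> ennreal (e n)"
      by blast
    have "P (Suc n) (next_words N K Ws)"
      unfolding P_def
    proof (intro conjI ballI)
      fix u assume "u \<in> set (next_words N K Ws)"
      then obtain k x where u: "u = wpow k x @ pblock N Ws" "x \<in> set Ws" "1 \<le> k" by (auto simp: set_next_words)
      obtain k' where "k = Suc k'" using u(3) by (cases k) auto
      then show "u \<noteq> []" using u P by (simp add: P_def wpow_Suc)
      have "set (wpow k y) \<subseteq> set y" for y :: "complex list" and k by (auto simp: wpow_def)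
      then have "set u \<subseteq> (\<Union>y\<in>set Ws. set y)" using u(2) unfolding u(1) pblock_def by (auto 4 3)
      then show "cmod y < 1" if "y \<in> set u" for y
        using that P unfolding P_def by blast
    qed simp
    then show "\<exists>y. P (Suc n) y \<and> (\<exists>N K. Q n Ws y N K)" using NK unfolding Q_def by blast
  qed
  then obtain W where W: "\<And>n. P n (W n)" "\<And>n. \<exists>N K. Q n (W n) (W (Suc n)) N K" by blast
  then obtain N K where NK: "\<And>n. Q n (W n) (W (Suc n)) (N n) (K n)" by metis
  show thesis
  proof (rule that)
    show "tower W N K a b"
    proof
      show "W 0 = [[a], [b]]" using W(1)[of 0] by (simp add: P_def)
      show "W (Suc n) = next_words (N n) (K n) (W n)" "n < N n" "2 \<le> K n" for n
        using NK[of n] unfolding Q_def by blast+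
    qed (rule ab(3))
    show "emeasure lborel (\<Union>u\<in>set (W n). elliptic u - detected u (N n) (1 / real (Suc n))) \<le> ennreal (e n)"
      "emeasure lborel ((\<Union>u\<in>set (W n). elliptic u) - (\<Union>u\<in>set (W (Suc n)). elliptic u)) \<le> ennreal (e n)" for n
      using NK[of n] unfolding Q_def by blast+
  qed
qed

section \<open>The subshift\<close>

definition arc_near :: "complex set \<Rightarrow> nat \<Rightarrow> real set" where
  "arc_near S n = {\<theta>. 0 \<le> \<theta> \<and> \<theta> < 2 * pi \<and> setdist {cis \<theta>} S \<le> 1 / real (Suc n)}"

lemma arc_near_borel: "arc_near S n \<in> sets lborel"
proof -
  have "continuous_on UNIV (\<lambda>\<theta>. setdist {cis \<theta>} S)"
    by (rule continuous_on_compose2[OF continuous_on_setdist[of UNIV S]]) (auto intro!: continuous_on_cis continuous_on_id)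
  then have "closed {\<theta>. setdist {cis \<theta>} S \<le> 1 / real (Suc n)}"
    by (intro closed_Collect_le continuous_on_const)
  moreover have "arc_near S n = {0..<2 * pi} \<inter> {\<theta>. setdist {cis \<theta>} S \<le> 1 / real (Suc n)}" by (auto simp: arc_near_def)
  ultimately show ?thesis by auto
qed

lemma emeasure_arc_length:
  assumes "closed S" "S \<subseteq> sphere 0 1"
  shows "emeasure arc_length_measure S = emeasure lborel {\<theta>. 0 \<le> \<theta> \<and> \<theta> < 2 * pi \<and> cis \<theta> \<in> S}"
proof -
  have "S \<in> sets circle_borel" unfolding circle_borel_def sets_restrict_space
    using assms by (intro image_eqI[of _ _ S]) auto
  moreover have "cis \<in> restrict_space lborel {0..<2 * pi} \<rightarrow>\<^sub>M circle_borel"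
    by (intro measurable_restrict_space1) (use measurable_cis_circle in simp)
  ultimately have "emeasure arc_length_measure S = emeasure (restrict_space lborel {0..<2 * pi}) (cis -` S \<inter> space (restrict_space lborel {0..<2 * pi}))"
    unfolding arc_length_measure_def by (intro emeasure_distr)
  also have "\<dots> = emeasure lborel (cis -` S \<inter> {0..<2 * pi})"
    by (subst emeasure_restrict_space) (auto simp: space_restrict_space)
  also have "cis -` S \<inter> {0..<2 * pi} = {\<theta>. 0 \<le> \<theta> \<and> \<theta> < 2 * pi \<and> cis \<theta> \<in> S}" by auto
  finally show ?thesis .
qed

text \<open>A closed set is the intersection of its closed neighbourhoods.\<close>

lemma arc_length_pos:
  assumes cl: "closed S" and ne: "S \<noteq> {}" and sub: "S \<subseteq> sphere 0 1"
    and mr: "0 \<le> r" "r < m" and low: "\<And>n. ennreal m \<le> emeasure lborel (arc_near S n) + ennreal r"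
  shows "0 < emeasure arc_length_measure S"
proof -
  have dec: "decseq (arc_near S)" unfolding decseq_def
  proof (intro allI impI subsetI)
    fix i j :: nat and \<theta> assume ij: "i \<le> j" and th: "\<theta> \<in> arc_near S j"
    have "1 / real (Suc j) \<le> 1 / real (Suc i)" using ij by (intro divide_left_mono) auto
    then show "\<theta> \<in> arc_near S i" using th by (simp add: arc_near_def)
  qed
  have fin: "emeasure lborel (arc_near S n) \<noteq> \<infinity>" for n
  proof -
    have "emeasure lborel (arc_near S n) \<le> emeasure lborel {0..2 * pi}" by (intro emeasure_mono) (auto simp: arc_near_def)
    then show ?thesis by (auto simp: top_unique)
  qed
  let ?R = "\<Inter>n. arc_near S n" and ?S = "{\<theta>. 0 \<le> \<theta> \<and> \<theta> < 2 * pi \<and> cis \<theta> \<in> S}"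
  have "(\<lambda>n. emeasure lborel (arc_near S n)) \<longlonglongrightarrow> emeasure lborel ?R"
    by (rule Lim_emeasure_decseq) (use arc_near_borel dec fin in auto)
  then have "(\<lambda>n. emeasure lborel (arc_near S n) + ennreal r) \<longlonglongrightarrow> emeasure lborel ?R + ennreal r"
    by (intro tendsto_add tendsto_const)
  then have R: "ennreal m \<le> emeasure lborel ?R + ennreal r"
    by (rule LIMSEQ_le_const) (use low in blast)
  have "?R \<subseteq> ?S"
  proof
    fix \<theta> assume th: "\<theta> \<in> ?R"
    then have th': "0 \<le> \<theta> \<and> \<theta> < 2 * pi \<and> setdist {cis \<theta>} S \<le> 1 / real (Suc n)" for n
      unfolding arc_near_def by blast
    have "setdist {cis \<theta>} S \<le> 0"
    proof (rule LIMSEQ_le_const)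
      show "(\<lambda>n. 1 / real (Suc n)) \<longlonglongrightarrow> 0" using LIMSEQ_inverse_real_of_nat by (simp add: inverse_eq_divide)
      show "\<exists>N. \<forall>n\<ge>N. setdist {cis \<theta>} S \<le> 1 / real (Suc n)" using th' by blast
    qed
    then have "setdist {cis \<theta>} S = 0" using setdist_pos_le[of "{cis \<theta>}" S] by linarith
    then have "cis \<theta> \<in> S" using setdist_eq_0_closed[OF cl, of "cis \<theta>"] ne by blast
    then show "\<theta> \<in> ?S" using th' by blast
  qed
  moreover have "?S \<in> sets lborel"
  proof -
    have "closed (cis -` S)" 
      using cl by (rule closed_vimage) (intro continuous_on_cis continuous_on_id)
    moreover have "?S = {0..<2 * pi} \<inter> cis -` S" by auto
    ultimately show ?thesis by auto
  qed
  ultimately have le: "emeasure lborel ?R \<le> emeasure arc_length_measure S"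
    unfolding emeasure_arc_length[OF cl sub] by (rule emeasure_mono)
  show ?thesis
  proof (rule ccontr)
    assume "\<not> ?thesis"
    then have "emeasure lborel ?R = 0" using le by simp
    then have "ennreal m \<le> ennreal r" using R by simp
    then show False using mr by (simp add: ennreal_le_iff)
  qed
qed

lemma emeasure_union_bound:
  assumes "X \<subseteq> Y \<union> D" "Y \<in> sets M" "D \<in> sets M" "emeasure M D \<le> d"
  shows "emeasure M X \<le> emeasure M Y + d"
proof -
  have "emeasure M X \<le> emeasure M (Y \<union> D)" using assms by (intro emeasure_mono) auto
  also have "\<dots> \<le> emeasure M Y + emeasure M D" using assms by (intro emeasure_subadditive) auto
  also have "\<dots> \<le> emeasure M Y + d" using assms by (intro add_left_mono)
  finally show ?thesis .
qed

lemma cumulative_loss: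
  fixes G :: "nat \<Rightarrow> 'a set" and e :: "nat \<Rightarrow> real"
  assumes sets: "\<And>n. G n \<in> sets M" and loss: "\<And>n. emeasure M (G n - G (Suc n)) \<le> ennreal (e n)"
    and e: "\<And>n. 0 \<le> e n" and start: "ennreal m \<le> emeasure M (G 0)"
  shows "ennreal m \<le> emeasure M (G n) + ennreal (\<Sum>k<n. e k)"
proof (induction n)
  case 0
  then show ?case using start by simp
next
  case (Suc n)
  have "emeasure M (G n) \<le> emeasure M (G (Suc n)) + ennreal (e n)"
    by (rule emeasure_union_bound[OF _ _ _ loss]) (use sets in auto)
  then have "emeasure M (G n) + ennreal (\<Sum>k<n. e k) \<le> emeasure M (G (Suc n)) + ennreal (e n) + ennreal (\<Sum>k<n. e k)"
    by (rule add_right_mono)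
  also have "\<dots> = emeasure M (G (Suc n)) + ennreal (\<Sum>k<Suc n. e k)"
    using e by (simp add: add.assoc sum_nonneg ennreal_plus[symmetric] add.commute del: ennreal_plus)
  finally show ?case using Suc by (rule order_trans[rotated])
qed

theorem theorem2:
  fixes A :: "complex set"
  assumes "A \<subseteq> ball 0 1" and "finite A" and "2 \<le> card A"
  shows "\<exists>\<Omega>. minimal_subshift A \<Omega> \<and> nonperiodic_subshift \<Omega> \<and>
           (\<exists>\<Sigma>. associated_set \<Omega> \<Sigma> \<and> emeasure arc_length_measure \<Sigma> > 0)"
proof -
  obtain a b where abA: "a \<in> A" "b \<in> A" "a \<noteq> b"
    using assms(3) by (metis One_nat_def card_le_Suc0_iff_eq assms(2) not_less_eq_eq numeral_2_eq_2)
  have disk: "cmod a < 1" "cmod b < 1" using abA assms(1) by auto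
  have "\<exists>m::real. m > 0 \<and> ennreal m \<le> emeasure lborel (elliptic [a])"
  proof -
    have "emeasure lborel (elliptic [a]) > 0" by (rule elliptic_singleton_pos)
    then obtain m where m: "0 < m" "m < emeasure lborel (elliptic [a])" using dense by blast
    then have "m \<noteq> \<top>" by auto
    then obtain r where "m = ennreal r" "r \<ge> 0" by (cases m) auto
    then show ?thesis using m by (intro exI[of _ r]) auto
  qed
  then obtain m where m: "m > 0" "ennreal m \<le> emeasure lborel (elliptic [a])" by blast
  \<comment> \<open>the two kinds of losses add up to at most three quarters of \<open>m\<close>\<close>
  define e where "e n = m / 4 * (1 / 2) ^ n" for n :: nat
  have e: "e n > 0" for n using m by (simp add: e_def)
  obtain W N K where T: "tower W N K a b"
    and det: "\<And>n. emeasure lborel (\<Union>u\<in>set (W n). elliptic u - detected u (N n) (1 / real (Suc n))) \<le> ennreal (e n)"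
    and ins: "\<And>n. emeasure lborel ((\<Union>u\<in>set (W n). elliptic u) - (\<Union>u\<in>set (W (Suc n)). elliptic u)) \<le> ennreal (e n)"
    using tower_exists[where e = e, OF disk abA(3) e] by blast
  interpret tower W N K a b by (rule T)
  have in_disk: "cmod (\<alpha> n) < 1" if "\<alpha> \<in> \<Omega>" for \<alpha> n using \<Omega>_letters[OF that, of n] disk by auto
  define \<Sigma> where "\<Sigma> = ess (circle_support (verblunsky_measure \<alpha>0))"
  have const: "ess (circle_support (verblunsky_measure \<alpha>)) = \<Sigma>" if "\<alpha> \<in> \<Omega>" for \<alpha>
    unfolding \<Sigma>_def
    using ess_subset[of \<alpha> \<alpha>0] ess_subset[of \<alpha>0 \<alpha>] in_disk that \<alpha>0_in windows_recur by blast
  then have assoc: "associated_set \<Omega> \<Sigma>" by (auto simp: associated_set_def ess_def)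
  have cl: "closed \<Sigma>" unfolding \<Sigma>_def by (rule closed_ess[OF closed_circle_support])
  interpret v0: verblunsky \<alpha>0 by unfold_locales (rule in_disk[OF \<alpha>0_in])
  interpret s0: spectral \<alpha>0 "verblunsky_measure \<alpha>0" by (rule v0.spectral_verblunsky_measure)
  have near: "\<exists>z\<in>\<Sigma>. dist (cis \<theta>) z \<le> 1 / real (Suc n)" if u: "u \<in> set (W n)" "\<theta> \<in> detected u (N n) (1 / real (Suc n))" for u n \<theta>
    unfolding \<Sigma>_def
  proof (rule s0.ess_near)
    show "detects (N n * length u) (\<lambda>k. u ! (k mod length u)) (cis \<theta>) (1 / real (Suc n))" using u(2) by (simp add: detected_def)
    fix m0
    obtain j where "j \<ge> m0" "occ (wpow (N n) u) \<alpha>0 j" using powers_recur[OF \<alpha>0_in u(1)] by blast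
    then show "\<exists>m\<ge>m0. \<forall>k<N n * length u. \<alpha>0 (m + k) = u ! (k mod length u)"
      by (intro exI[of _ j]) (auto simp: occ_def length_wpow nth_wpow)
  qed simp
  define G where "G n = (\<Union>u\<in>set (W n). elliptic u)" for n
  have Gb: "G n \<in> sets lborel" for n unfolding G_def using elliptic_borel by (intro sets.finite_UN) auto
  have GT: "G n \<subseteq> arc_near \<Sigma> n \<union> (\<Union>u\<in>set (W n). elliptic u - detected u (N n) (1 / real (Suc n)))" for n
  proof
    fix \<theta> assume "\<theta> \<in> G n"
    then obtain u where u: "u \<in> set (W n)" "\<theta> \<in> elliptic u" unfolding G_def by blast
    show "\<theta> \<in> arc_near \<Sigma> n \<union> (\<Union>u\<in>set (W n). elliptic u - detected u (N n) (1 / real (Suc n)))"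
    proof (cases "\<theta> \<in> detected u (N n) (1 / real (Suc n))")
      case True
      then obtain z where z: "z \<in> \<Sigma>" "dist (cis \<theta>) z \<le> 1 / real (Suc n)" using near[OF u(1)] by blast
      have "setdist {cis \<theta>} \<Sigma> \<le> dist (cis \<theta>) z" by (rule setdist_le_dist) (use z in auto)
      then have "\<theta> \<in> arc_near \<Sigma> n" using z(2) u(2) by (simp add: arc_near_def elliptic_def)
      then show ?thesis by blast
    qed (use u in blast)
  qed
  have "elliptic [a] \<subseteq> G 0" unfolding G_def W0 by simp
  then have "emeasure lborel (elliptic [a]) \<le> emeasure lborel (G 0)" using Gb by (rule emeasure_mono)
  then have G0: "ennreal m \<le> emeasure lborel (G 0)" using m(2) by (rule order_trans[rotated])
  have Glow: "ennreal m \<le> emeasure lborel (G n) + ennreal (\<Sum>k<n. e k)" for n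
  proof (rule cumulative_loss[where G = G and e = e, OF Gb _ _ G0])
    show "emeasure lborel (G k - G (Suc k)) \<le> ennreal (e k)" for k using ins[of k] by (simp only: G_def)
  qed (rule less_imp_le[OF e])
  have esum: "e n + (\<Sum>k<n. e k) \<le> 3 * m / 4" for n
  proof -
    have "(\<Sum>k<n. e k) = m / 4 * (\<Sum>k<n. (1 / 2) ^ k)" by (simp add: e_def sum_distrib_left)
    also have "(\<Sum>k<n. (1 / 2 :: real) ^ k) = 2 * (1 - (1 / 2) ^ n)"
      using sum_gp_strict[of "1/2 :: real" n] by simp
    finally have "e n + (\<Sum>k<n. e k) = m / 2 - m / 4 * (1 / 2) ^ n" by (simp add: e_def algebra_simps)
    also have "\<dots> \<le> 3 * m / 4" 
    proof -
      have "0 \<le> m / 4 * (1 / 2) ^ n" using m(1) by simp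
      then show ?thesis using m(1) by linarith
    qed
    finally show ?thesis .
  qed
  have low: "ennreal m \<le> emeasure lborel (arc_near \<Sigma> n) + ennreal (3 * m / 4)" for n
  proof -
    have "emeasure lborel (G n) \<le> emeasure lborel (arc_near \<Sigma> n) + ennreal (e n)"
    proof (rule emeasure_union_bound[OF GT arc_near_borel _ det])
      show "(\<Union>u\<in>set (W n). elliptic u - detected u (N n) (1 / real (Suc n))) \<in> sets lborel"
        using elliptic_borel borel_open[OF open_detected] by (intro sets.finite_UN sets.Diff) auto
    qed
    then have "emeasure lborel (G n) + ennreal (\<Sum>k<n. e k) \<le> emeasure lborel (arc_near \<Sigma> n) + ennreal (e n) + ennreal (\<Sum>k<n. e k)"
      by (rule add_right_mono)
    also have "\<dots> = emeasure lborel (arc_near \<Sigma> n) + ennreal (e n + (\<Sum>k<n. e k))"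
      using e by (simp add: add.assoc sum_nonneg less_imp_le)
    also have "\<dots> \<le> emeasure lborel (arc_near \<Sigma> n) + ennreal (3 * m / 4)"
      by (intro add_left_mono ennreal_leI esum)
    finally show ?thesis using Glow[of n] by (rule order_trans[rotated])
  qed
  have ne: "\<Sigma> \<noteq> {}"
  proof -
    have "\<exists>x\<in>sphere 0 1. x islimpt circle_support (verblunsky_measure \<alpha>0)"
      using compact_sphere[of "0::complex" 1] s0.infinite_support circle_support_sphere[of "verblunsky_measure \<alpha>0"]
      unfolding compact_eq_Bolzano_Weierstrass by blast
    then show ?thesis unfolding \<Sigma>_def using ess_closed_iff[OF closed_circle_support] by blast
  qed
  have "\<Sigma> \<subseteq> sphere 0 1" unfolding \<Sigma>_def ess_def using circle_support_sphere by blast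
  then have "0 < emeasure arc_length_measure \<Sigma>"
    using arc_length_pos[OF cl ne _ _ _ low] m(1) by simp
  then show ?thesis using minimal[OF abA(1,2)] nonperiodic assoc by blast
qed

end
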